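(* Let $T$ be dependent (NIP). The following are equivalent for a set $A$: (1) $A$ is an extension base for non-forking: for every $a$, $tp(a/A)$ does not fork over $A$. (2) Non-forking has left extension over $A$: whenever $tp(a/bA)$ does not fork over $A$ and $D\supseteq a$, there is $D'\equiv_{Aa}D$ with $tp(D'/bA)$ not forking over $A$. (3) Forking equals dividing over $A$. (4) $A$ is an extension base for strict invariance: for every $a$, $tp(a/A)$ is strictly invariant over $A$.
   Context: $tp(a/Bb)$ is strictly invariant over $B$ if it has a global extension $q$ fixed by every automorphism in $AutfL(\mathfrak{C}/B)$ (the group generated by automorphisms fixing some small model containing $B$) such that for any $C\supseteq B$ and $c\models q|_C$, $tp(C/Bc)$ does not fork over $B$. *)

theory Defs
  imports Main
begin

unbundle cardinal_syntax

section \<open>First-order syntax and semantics\<close>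

text \<open>Locally nameless syntax: bound variables are de Bruijn indices, free variables come from an
  arbitrary type \<open>'v\<close>. This allows types in infinitely many variables, and formulas with parameters
  from a structure on \<open>'a\<close> are formulas over \<open>'x + 'a\<close> (variables \<open>Inl x\<close>, parameters \<open>Inr b\<close>).\<close>

datatype (dead 'f, tm_vars: 'v) tm =
  BVar nat | FVar 'v | App 'f "('f, 'v) tm list"
  for map: map_tm

datatype (dead 'f, dead 'r, fm_vars: 'v) fm =
  Eq "('f, 'v) tm" "('f, 'v) tm"
| Rel 'r "('f, 'v) tm list"
| Neg "('f, 'r, 'v) fm"
| Conj "('f, 'r, 'v) fm" "('f, 'r, 'v) fm"
| Exi "('f, 'r, 'v) fm"
  for map: map_fm

text \<open>A language is given by its symbols together with their arities. Either set may be empty.\<close>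

record ('f, 'r) lang =
  Funs :: "('f \<times> nat) set"
  Rels :: "('r \<times> nat) set"

primrec wf_tm :: "('f, 'r) lang \<Rightarrow> nat \<Rightarrow> ('f, 'v) tm \<Rightarrow> bool" where
  "wf_tm L n (BVar i) \<longleftrightarrow> i < n"
| "wf_tm L n (FVar x) \<longleftrightarrow> True"
| "wf_tm L n (App f ts) \<longleftrightarrow> (f, length ts) \<in> Funs L \<and> list_all (wf_tm L n) ts"

text \<open>\<open>wf_fm L n \<phi>\<close>: \<open>\<phi>\<close> respects the arities of \<open>L\<close> and has at most \<open>n\<close> dangling indices.\<close>

primrec wf_fm :: "('f, 'r) lang \<Rightarrow> nat \<Rightarrow> ('f, 'r, 'v) fm \<Rightarrow> bool" where
  "wf_fm L n (Eq s t) \<longleftrightarrow> wf_tm L n s \<and> wf_tm L n t"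
| "wf_fm L n (Rel r ts) \<longleftrightarrow> (r, length ts) \<in> Rels L \<and> list_all (wf_tm L n) ts"
| "wf_fm L n (Neg \<phi>) \<longleftrightarrow> wf_fm L n \<phi>"
| "wf_fm L n (Conj \<phi> \<psi>) \<longleftrightarrow> wf_fm L n \<phi> \<and> wf_fm L n \<psi>"
| "wf_fm L n (Exi \<phi>) \<longleftrightarrow> wf_fm L (Suc n) \<phi>"

text \<open>The universe of a structure is the whole type \<open>'a\<close>. Values of an interpretation at symbols
  or arities outside the language are irrelevant.\<close>

record ('f, 'r, 'a) interp =
  fun_int :: "'f \<Rightarrow> 'a list \<Rightarrow> 'a"
  rel_int :: "'r \<Rightarrow> 'a list \<Rightarrow> bool"

primrec tm_val :: "('f, 'r, 'a) interp \<Rightarrow> 'a list \<Rightarrow> ('v \<Rightarrow> 'a) \<Rightarrow> ('f, 'v) tm \<Rightarrow> 'a" where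
  "tm_val M e v (BVar i) = e ! i"
| "tm_val M e v (FVar x) = v x"
| "tm_val M e v (App f ts) = fun_int M f (map (tm_val M e v) ts)"

text \<open>Satisfaction with quantifiers ranging over \<open>U\<close>, i.e. satisfaction in the substructure of \<open>M\<close>
  on \<open>U\<close> (in \<open>M\<close> itself for \<open>U = UNIV\<close>).\<close>

primrec sat_on :: "('f, 'r, 'a) interp \<Rightarrow> 'a set \<Rightarrow> 'a list \<Rightarrow> ('v \<Rightarrow> 'a) \<Rightarrow> ('f, 'r, 'v) fm \<Rightarrow> bool"
where
  "sat_on M U e v (Eq s t) \<longleftrightarrow> tm_val M e v s = tm_val M e v t"
| "sat_on M U e v (Rel r ts) \<longleftrightarrow> rel_int M r (map (tm_val M e v) ts)"
| "sat_on M U e v (Neg \<phi>) \<longleftrightarrow> \<not> sat_on M U e v \<phi>"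
| "sat_on M U e v (Conj \<phi> \<psi>) \<longleftrightarrow> sat_on M U e v \<phi> \<and> sat_on M U e v \<psi>"
| "sat_on M U e v (Exi \<phi>) \<longleftrightarrow> (\<exists>x\<in>U. sat_on M U (x # e) v \<phi>)"

definition sat :: "('f, 'r, 'a) interp \<Rightarrow> ('v \<Rightarrow> 'a) \<Rightarrow> ('f, 'r, 'v) fm \<Rightarrow> bool" where
  "sat M v \<phi> \<longleftrightarrow> sat_on M UNIV [] v \<phi>"

text \<open>\<open>L(B)\<close>-formulas in the variables \<open>(x\<^sub>i)\<close>, \<open>i \<in> I\<close>.\<close>

definition formulas :: "('f, 'r) lang \<Rightarrow> 'x set \<Rightarrow> 'a set \<Rightarrow> ('f, 'r, 'x + 'a) fm set" where
  "formulas L I B = {\<phi>. wf_fm L 0 \<phi> \<and> fm_vars \<phi> \<subseteq> Inl ` I \<union> Inr ` B}"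

definition holds :: "('f, 'r, 'a) interp \<Rightarrow> ('x \<Rightarrow> 'a) \<Rightarrow> ('f, 'r, 'x + 'a) fm \<Rightarrow> bool" where
  "holds M c \<phi> \<longleftrightarrow> sat M (case_sum c id) \<phi>"


section \<open>Types, automorphisms and the monster model\<close>

text \<open>The type over \<open>B\<close> of the tuple \<open>(a i)\<close>, \<open>i \<in> I\<close>. A set \<open>D\<close> is regarded as the tuple
  enumerated by itself, so \<open>tp(D/B)\<close> is \<open>tp L M D id B\<close>.\<close>

definition tp ::
  "('f, 'r) lang \<Rightarrow> ('f, 'r, 'a) interp \<Rightarrow> 'x set \<Rightarrow> ('x \<Rightarrow> 'a) \<Rightarrow> 'a set \<Rightarrow> ('f, 'r, 'x + 'a) fm set"
where
  "tp L M I a B = {\<phi> \<in> formulas L I B. holds M a \<phi>}"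

definition fin_sat :: "('f, 'r, 'a) interp \<Rightarrow> ('f, 'r, 'x + 'a) fm set \<Rightarrow> bool" where
  "fin_sat M p \<longleftrightarrow> (\<forall>\<Phi>. finite \<Phi> \<and> \<Phi> \<subseteq> p \<longrightarrow> (\<exists>c. \<forall>\<phi>\<in>\<Phi>. holds M c \<phi>))"

definition global_type ::
  "('f, 'r) lang \<Rightarrow> ('f, 'r, 'a) interp \<Rightarrow> 'x set \<Rightarrow> ('f, 'r, 'x + 'a) fm set \<Rightarrow> bool"
where
  "global_type L M I q \<longleftrightarrow>
     q \<subseteq> formulas L I UNIV \<and> fin_sat M q \<and> (\<forall>\<phi>\<in>formulas L I UNIV. \<phi> \<in> q \<or> Neg \<phi> \<in> q)"

definition automorphism :: "('f, 'r) lang \<Rightarrow> ('f, 'r, 'a) interp \<Rightarrow> ('a \<Rightarrow> 'a) \<Rightarrow> bool" where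
  "automorphism L M g \<longleftrightarrow> bij g \<and>
     (\<forall>(f, n)\<in>Funs L. \<forall>xs. length xs = n \<longrightarrow> g (fun_int M f xs) = fun_int M f (map g xs)) \<and>
     (\<forall>(r, n)\<in>Rels L. \<forall>xs. length xs = n \<longrightarrow> rel_int M r xs = rel_int M r (map g xs))"

definition elem_substructure :: "('f, 'r) lang \<Rightarrow> ('f, 'r, 'a) interp \<Rightarrow> 'a set \<Rightarrow> bool" where
  "elem_substructure L M N \<longleftrightarrow> N \<noteq> {} \<and>
     (\<forall>(f, n)\<in>Funs L. \<forall>xs. length xs = n \<and> set xs \<subseteq> N \<longrightarrow> fun_int M f xs \<in> N) \<and>
     (\<forall>(\<phi> :: ('f, 'r, nat) fm) v. wf_fm L 0 \<phi> \<and> range v \<subseteq> N \<longrightarrow>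
        sat_on M N [] v \<phi> = sat_on M UNIV [] v \<phi>)"

definition saturated :: "('f, 'r) lang \<Rightarrow> 'k rel \<Rightarrow> ('f, 'r, 'a) interp \<Rightarrow> bool" where
  "saturated L \<kappa> M \<longleftrightarrow>
     (\<forall>(B :: 'a set) (p :: ('f, 'r, unit + 'a) fm set).
        |B| <o \<kappa> \<and> p \<subseteq> formulas L UNIV B \<and> fin_sat M p \<longrightarrow> (\<exists>c. \<forall>\<phi>\<in>p. holds M c \<phi>))"

text \<open>Elementary maps with small domain extend to automorphisms.\<close>

definition strongly_homogeneous :: "('f, 'r) lang \<Rightarrow> 'k rel \<Rightarrow> ('f, 'r, 'a) interp \<Rightarrow> bool" where
  "strongly_homogeneous L \<kappa> M \<longleftrightarrow>
     (\<forall>(B :: 'a set) h. |B| <o \<kappa> \<and> tp L M B h {} = tp L M B id {} \<longrightarrow>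
        (\<exists>g. automorphism L M g \<and> (\<forall>b\<in>B. g b = h b)))"

text \<open>\<open>M\<close> is a monster model of the complete theory \<open>T = Th(M)\<close>. A set is small if its cardinality
  is below \<open>\<kappa>\<close>. As \<open>\<kappa>\<close> is a cardinal on the type \<open>'k\<close>, every small tuple can be indexed by a subset
  of \<open>'k\<close>.\<close>

definition monster :: "('f, 'r) lang \<Rightarrow> 'k rel \<Rightarrow> ('f, 'r, 'a) interp \<Rightarrow> bool" where
  "monster L \<kappa> M \<longleftrightarrow>
     Card_order \<kappa> \<and> natLeq <o \<kappa> \<and> |Funs L| <o \<kappa> \<and> |Rels L| <o \<kappa> \<and>
     saturated L \<kappa> M \<and> strongly_homogeneous L \<kappa> M"

text \<open>\<open>Th(M)\<close> is dependent (NIP): no formula \<open>\<phi>(x, y)\<close> has the independence property. The variables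
  of \<open>x\<close> and \<open>y\<close> are the \<open>Inl i\<close> and \<open>Inr j\<close>; only finitely many occur in \<open>\<phi>\<close>.\<close>

definition has_IP :: "('f, 'r, 'a) interp \<Rightarrow> ('f, 'r, nat + nat) fm \<Rightarrow> bool" where
  "has_IP M \<phi> \<longleftrightarrow>
     (\<exists>(a :: nat \<Rightarrow> nat \<Rightarrow> 'a) (b :: nat set \<Rightarrow> nat \<Rightarrow> 'a).
        \<forall>i S. sat M (case_sum (a i) (b S)) \<phi> \<longleftrightarrow> i \<in> S)"

definition dependent :: "('f, 'r) lang \<Rightarrow> ('f, 'r, 'a) interp \<Rightarrow> bool" where
  "dependent L M \<longleftrightarrow> \<not> (\<exists>\<phi>. wf_fm L 0 \<phi> \<and> has_IP M \<phi>)"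


section \<open>Forking and dividing\<close>

definition params :: "('f, 'r, 'x + 'a) fm \<Rightarrow> 'a set" where
  "params \<phi> = {b. Inr b \<in> fm_vars \<phi>}"

text \<open>\<open>inst_params h \<phi>\<close> is \<open>\<phi>(x, h(b))\<close> for \<open>\<phi> = \<phi>(x, b)\<close>.\<close>

definition inst_params :: "('a \<Rightarrow> 'a) \<Rightarrow> ('f, 'r, 'x + 'a) fm \<Rightarrow> ('f, 'r, 'x + 'a) fm" where
  "inst_params h = map_fm (map_sum id h)"

text \<open>\<open>\<phi>(x, b)\<close> divides over \<open>A\<close> if there are \<open>k\<close> and \<open>(b\<^sub>i)\<close>, \<open>i < \<omega>\<close>, with \<open>tp(b\<^sub>i/A) = tp(b/A)\<close> such
  that \<open>{\<phi>(x, b\<^sub>i) : i < \<omega>}\<close> is \<open>k\<close>-inconsistent (as an indexed family). Here \<open>b\<close> is the tuple of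
  parameters of \<open>\<phi>\<close>, enumerated by itself, and \<open>b\<^sub>i\<close> is its image under \<open>h i\<close>.\<close>

definition divides ::
  "('f, 'r) lang \<Rightarrow> ('f, 'r, 'a) interp \<Rightarrow> 'a set \<Rightarrow> ('f, 'r, 'x + 'a) fm \<Rightarrow> bool"
where
  "divides L M A \<phi> \<longleftrightarrow>
     (\<exists>(k :: nat) (h :: nat \<Rightarrow> 'a \<Rightarrow> 'a).
        (\<forall>i. tp L M (params \<phi>) (h i) A = tp L M (params \<phi>) id A) \<and>
        (\<forall>S. finite S \<and> card S = k \<longrightarrow> \<not> (\<exists>c. \<forall>i\<in>S. holds M c (inst_params (h i) \<phi>))))"

text \<open>The formulas in the disjunction have to be in the same variables \<open>(x\<^sub>i)\<close>, \<open>i \<in> I\<close>, as \<open>\<phi>\<close>; this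
  matters for \<open>I = {}\<close>.\<close>

definition forks ::
  "('f, 'r) lang \<Rightarrow> ('f, 'r, 'a) interp \<Rightarrow> 'a set \<Rightarrow> 'x set \<Rightarrow> ('f, 'r, 'x + 'a) fm \<Rightarrow> bool"
where
  "forks L M A I \<phi> \<longleftrightarrow> \<phi> \<in> formulas L I UNIV \<and>
     (\<exists>\<Psi>. finite \<Psi> \<and> \<Psi> \<subseteq> formulas L I UNIV \<and> (\<forall>\<psi>\<in>\<Psi>. divides L M A \<psi>) \<and>
        (\<forall>c. holds M c \<phi> \<longrightarrow> (\<exists>\<psi>\<in>\<Psi>. holds M c \<psi>)))"

text \<open>A type in the variables \<open>(x\<^sub>i)\<close>, \<open>i \<in> I\<close>, forks if it implies a forking formula, where implication
  is through a finite part of the type.\<close>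

definition type_forks ::
  "('f, 'r) lang \<Rightarrow> ('f, 'r, 'a) interp \<Rightarrow> 'a set \<Rightarrow> 'x set \<Rightarrow> ('f, 'r, 'x + 'a) fm set \<Rightarrow> bool"
where
  "type_forks L M A I p \<longleftrightarrow>
     (\<exists>\<Phi> \<phi>. finite \<Phi> \<and> \<Phi> \<subseteq> p \<and> forks L M A I \<phi> \<and>
        (\<forall>c. (\<forall>\<psi>\<in>\<Phi>. holds M c \<psi>) \<longrightarrow> holds M c \<phi>))"


section \<open>Strict invariance\<close>

text \<open>The group generated by the automorphisms fixing pointwise some small model containing \<open>B\<close>.\<close>

inductive_set AutfL :: "('f, 'r) lang \<Rightarrow> 'k rel \<Rightarrow> ('f, 'r, 'a) interp \<Rightarrow> 'a set \<Rightarrow> ('a \<Rightarrow> 'a) set"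
  for L :: "('f, 'r) lang" and \<kappa> :: "'k rel" and M :: "('f, 'r, 'a) interp" and B :: "'a set"
where
  gen: "automorphism L M g \<Longrightarrow> elem_substructure L M N \<Longrightarrow> |N| <o \<kappa> \<Longrightarrow> B \<subseteq> N \<Longrightarrow>
    (\<And>x. x \<in> N \<Longrightarrow> g x = x) \<Longrightarrow> g \<in> AutfL L \<kappa> M B"
| one: "id \<in> AutfL L \<kappa> M B"
| comp: "g \<in> AutfL L \<kappa> M B \<Longrightarrow> h \<in> AutfL L \<kappa> M B \<Longrightarrow> g \<circ> h \<in> AutfL L \<kappa> M B"
| inverse: "g \<in> AutfL L \<kappa> M B \<Longrightarrow> inv g \<in> AutfL L \<kappa> M B"

text \<open>Strict invariance over \<open>B\<close> of a type \<open>p = tp(a/Bb)\<close> in the variables \<open>(x\<^sub>i)\<close>, \<open>i \<in> I\<close>. The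
  realisation \<open>c\<close> of \<open>q|\<^sub>C\<close> is the tuple \<open>(c i)\<close>, \<open>i \<in> I\<close>.\<close>

definition strictly_invariant ::
  "('f, 'r) lang \<Rightarrow> 'k rel \<Rightarrow> ('f, 'r, 'a) interp \<Rightarrow> 'a set \<Rightarrow> 'x set \<Rightarrow> ('f, 'r, 'x + 'a) fm set \<Rightarrow> bool"
where
  "strictly_invariant L \<kappa> M B I p \<longleftrightarrow>
     (\<exists>q. global_type L M I q \<and> p \<subseteq> q \<and>
        (\<forall>g\<in>AutfL L \<kappa> M B. inst_params g ` q = q) \<and>
        (\<forall>C c. |C| <o \<kappa> \<and> B \<subseteq> C \<and> (\<forall>\<phi>\<in>q \<inter> formulas L I C. holds M c \<phi>) \<longrightarrow>
           \<not> type_forks L M B C (tp L M C id (B \<union> c ` I))))"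


section \<open>The four conditions\<close>

definition nonforking_extension_base ::
  "('f, 'r) lang \<Rightarrow> 'k rel \<Rightarrow> ('f, 'r, 'a) interp \<Rightarrow> 'a set \<Rightarrow> bool"
where
  "nonforking_extension_base L \<kappa> M A \<longleftrightarrow>
     (\<forall>(I :: 'k set) a. |I| <o \<kappa> \<longrightarrow> \<not> type_forks L M A I (tp L M I a A))"

text \<open>\<open>D'\<close> is the tuple \<open>(d e)\<close>, \<open>e \<in> D\<close>, realising the type of \<open>D\<close> over \<open>Aa\<close>.\<close>

definition nonforking_left_extension ::
  "('f, 'r) lang \<Rightarrow> 'k rel \<Rightarrow> ('f, 'r, 'a) interp \<Rightarrow> 'a set \<Rightarrow> bool"
where
  "nonforking_left_extension L \<kappa> M A \<longleftrightarrow>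
     (\<forall>(I :: 'k set) a (J :: 'k set) b (D :: 'a set).
        |I| <o \<kappa> \<and> |J| <o \<kappa> \<and> |D| <o \<kappa> \<and> a ` I \<subseteq> D \<and>
        \<not> type_forks L M A I (tp L M I a (b ` J \<union> A)) \<longrightarrow>
        (\<exists>d :: 'a \<Rightarrow> 'a. tp L M D d (A \<union> a ` I) = tp L M D id (A \<union> a ` I) \<and>
           \<not> type_forks L M A D (tp L M D d (b ` J \<union> A))))"

definition forking_eq_dividing :: "('f, 'r) lang \<Rightarrow> ('f, 'r, 'a) interp \<Rightarrow> 'a set \<Rightarrow> bool" where
  "forking_eq_dividing L M A \<longleftrightarrow>
     (\<forall>(I :: nat set) (\<phi> :: ('f, 'r, nat + 'a) fm). finite I \<and> \<phi> \<in> formulas L I UNIV \<longrightarrow>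
        (forks L M A I \<phi> \<longleftrightarrow> divides L M A \<phi>))"

definition strict_invariance_extension_base ::
  "('f, 'r) lang \<Rightarrow> 'k rel \<Rightarrow> ('f, 'r, 'a) interp \<Rightarrow> 'a set \<Rightarrow> bool"
where
  "strict_invariance_extension_base L \<kappa> M A \<longleftrightarrow>
     (\<forall>(I :: 'k set) a. |I| <o \<kappa> \<longrightarrow> strictly_invariant L \<kappa> M A I (tp L M I a A))"

end

theory Submission
  imports Defs "HOL-Library.FuncSet" "HOL-Library.Sublist" "HOL-Library.Countable_Set"
begin

text \<open>Types over small sets are orbits of the automorphism group, and global types are represented by
  ultrafilters on the set of all assignments; a coheir over \<open>N\<close> is an ultrafilter containing the
  set of assignments with values in \<open>N\<close>. Dividing of a definable set \<open>X\<close> over \<open>A\<close> means that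
  some sequence of translates of \<open>X\<close> under automorphisms fixing \<open>A\<close> is \<open>k\<close>-inconsistent.

  The heart of the matter is (1) \<open>\<Longrightarrow>\<close> (3), which is first shown over a model \<open>N\<close>. A formula
  that divides over \<open>N\<close> divides along the Morley sequences of some coheir, by the pigeonhole principle
  and dependence. A colouring argument (in place of the broom lemma) turns this into: a formula that
  forks over \<open>N\<close> quasi-divides over \<open>N\<close>, i.e. finitely many conjugates of it are inconsistent. This
  suffices to construct strictly invariant extensions over \<open>N\<close>, and every dividing formula divides
  along all their Morley sequences, so that disjunctions of dividing formulas divide as well. Over an
  extension base \<open>A\<close> one moves a model \<open>N \<supseteq> A\<close> so that its type over the given parameters does not
  fork over \<open>A\<close>; then formulas dividing over \<open>A\<close> still divide over \<open>N\<close>.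

  In a dependent theory, non-forking global types are Lascar invariant, so the same construction of
  strict extensions over \<open>A\<close> gives (4) from (1) and (3).\<close>


section \<open>Substitution, satisfaction and automorphisms\<close>

text \<open>The obstacle in (1) implies (3) is that the coheir along which a formula divides depends
  on the formula, so a disjunction of dividing formulas has no common coheir to divide along. The
  colouring argument copes with several coheirs at once, but it only yields a finite set of
  conjugates with empty intersection and says nothing about its subfamilies. Strictness removes the
  dependence: if the type of \<open>B\<close> over \<open>N\<close> and \<open>c\<close> does not
  fork over \<open>N\<close>, a sequence witnessing that W(x, c) divides can be moved into the type
  of \<open>c\<close> over \<open>B\<close>. So a single invariant type serves all disjuncts, and
  counting finishes. Dependence enters only through \<open>no_alternation\<close>: a point cannot
  alternate on arbitrarily many pairs of tuples when every selection of one tuple per pair is a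
  Morley sequence.

  The way back from (4) to (1) needs witnesses of dividing that preserve a Lascar invariant type.
  They are found by arranging that the translating automorphisms fix a model containing
  \<open>A\<close>.\<close>

lemma tm_val_map: "tm_val M e v (map_tm f t) = tm_val M e (v \<circ> f) t"
proof (induction t)
  case (App g ts)
  then show ?case by (simp add: comp_def cong: map_cong)
qed simp_all

lemma tm_val_map_comp: "tm_val M e v \<circ> map_tm f = tm_val M e (v \<circ> f)"
  by (rule ext) (simp add: tm_val_map)

lemma sat_on_map: "sat_on M U e v (map_fm f \<phi>) = sat_on M U e (v \<circ> f) \<phi>"
  by (induction \<phi> arbitrary: e) (simp_all add: tm_val_map tm_val_map_comp)

lemma wf_tm_map: "wf_tm L n (map_tm f t) = wf_tm L n t"
  by (induction t) (simp_all add: list.pred_map comp_def list_all_iff)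

lemma wf_fm_map: "wf_fm L n (map_fm f \<phi>) = wf_fm L n \<phi>"
  by (induction \<phi> arbitrary: n) (simp_all add: wf_tm_map list.pred_map comp_def)

lemma finite_tm_vars: "finite (tm_vars t)"
  by (induction t) simp_all

lemma finite_fm_vars: "finite (fm_vars \<phi>)"
  by (induction \<phi>) (simp_all add: finite_tm_vars)

text \<open>Simultaneous substitution for dangling indices (\<open>\<beta>\<close>) and free variables (\<open>\<xi>\<close>); the
  substitutes are indices \<open>Inl k\<close> or variables \<open>Inr x\<close>.\<close>

fun atom_tm :: "nat + 'w \<Rightarrow> ('f, 'w) tm" where
  "atom_tm (Inl k) = BVar k"
| "atom_tm (Inr x) = FVar x"

abbreviation shift :: "nat + 'w \<Rightarrow> nat + 'w" where
  "shift \<equiv> map_sum Suc id"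

primrec subst_tm :: "(nat \<Rightarrow> nat + 'w) \<Rightarrow> ('v \<Rightarrow> nat + 'w) \<Rightarrow> ('f, 'v) tm \<Rightarrow> ('f, 'w) tm" where
  "subst_tm \<beta> \<xi> (BVar i) = atom_tm (\<beta> i)"
| "subst_tm \<beta> \<xi> (FVar x) = atom_tm (\<xi> x)"
| "subst_tm \<beta> \<xi> (App f ts) = App f (map (subst_tm \<beta> \<xi>) ts)"

text \<open>Renaming by \<open>map_fm\<close> cannot move a variable across a quantifier;
  substitution can. \<open>Def_ex1\<close> turns a free variable into index 0 before quantifying it,
  and \<open>mdl_sat_on\<close> turns dangling indices into parameters. As all substitutes are
  atoms, \<open>shift\<close> alone avoids capture.\<close>

primrec subst_fm ::
  "(nat \<Rightarrow> nat + 'w) \<Rightarrow> ('v \<Rightarrow> nat + 'w) \<Rightarrow> ('f, 'r, 'v) fm \<Rightarrow> ('f, 'r, 'w) fm"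
where
  "subst_fm \<beta> \<xi> (Eq s t) = Eq (subst_tm \<beta> \<xi> s) (subst_tm \<beta> \<xi> t)"
| "subst_fm \<beta> \<xi> (Rel r ts) = Rel r (map (subst_tm \<beta> \<xi>) ts)"
| "subst_fm \<beta> \<xi> (Neg \<phi>) = Neg (subst_fm \<beta> \<xi> \<phi>)"
| "subst_fm \<beta> \<xi> (Conj \<phi> \<psi>) = Conj (subst_fm \<beta> \<xi> \<phi>) (subst_fm \<beta> \<xi> \<psi>)"
| "subst_fm \<beta> \<xi> (Exi \<phi>) = Exi (subst_fm (case_nat (Inl 0) (shift \<circ> \<beta>)) (shift \<circ> \<xi>) \<phi>)"

abbreviation atom_val :: "'a list \<Rightarrow> ('w \<Rightarrow> 'a) \<Rightarrow> nat + 'w \<Rightarrow> 'a" where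
  "atom_val e w \<equiv> case_sum ((!) e) w"

lemma tm_val_atom: "tm_val M e w (atom_tm z) = atom_val e w z"
  by (cases z) simp_all

lemma tm_val_subst:
  assumes "wf_tm L n t" "\<And>i. i < n \<Longrightarrow> atom_val e w (\<beta> i) = e' ! i"
    "\<And>x. x \<in> tm_vars t \<Longrightarrow> atom_val e w (\<xi> x) = v x"
  shows "tm_val M e w (subst_tm \<beta> \<xi> t) = tm_val M e' v t"
  using assms
proof (induction t)
  case (App g ts)
  then have "map (tm_val M e w \<circ> subst_tm \<beta> \<xi>) ts = map (tm_val M e' v) ts"
    by (auto simp: list_all_iff)
  then show ?case by (simp del: map_eq_conv)
qed (simp_all add: tm_val_atom)

lemma atom_val_shift: "atom_val (x # e) w (shift z) = atom_val e w z"
  by (cases z) simp_all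

lemma map_tm_val_subst:
  assumes "list_all (wf_tm L n) ts" "\<And>i. i < n \<Longrightarrow> atom_val e w (\<beta> i) = e' ! i"
    "\<And>x t. t \<in> set ts \<Longrightarrow> x \<in> tm_vars t \<Longrightarrow> atom_val e w (\<xi> x) = v x"
  shows "map (tm_val M e w \<circ> subst_tm \<beta> \<xi>) ts = map (tm_val M e' v) ts"
  using assms by (auto simp: list_all_iff intro!: tm_val_subst[where L = L and n = n])

lemma sat_on_subst:
  assumes "wf_fm L n \<phi>" "\<And>i. i < n \<Longrightarrow> atom_val e w (\<beta> i) = e' ! i"
    "\<And>x. x \<in> fm_vars \<phi> \<Longrightarrow> atom_val e w (\<xi> x) = v x"
  shows "sat_on M U e w (subst_fm \<beta> \<xi> \<phi>) = sat_on M U e' v \<phi>"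
  using assms
proof (induction \<phi> arbitrary: n e e' \<beta> \<xi>)
  case (Eq s t)
  have "tm_val M e w (subst_tm \<beta> \<xi> s) = tm_val M e' v s"
    using Eq by (intro tm_val_subst[where L = L and n = n]) auto
  moreover have "tm_val M e w (subst_tm \<beta> \<xi> t) = tm_val M e' v t"
    using Eq by (intro tm_val_subst[where L = L and n = n]) auto
  ultimately show ?case by simp
next
  case (Rel r ts)
  have "map (tm_val M e w \<circ> subst_tm \<beta> \<xi>) ts = map (tm_val M e' v) ts"
    using Rel by (intro map_tm_val_subst[where L = L and n = n]) auto
  then show ?case by (simp del: map_eq_conv)
next
  case (Neg \<phi>)
  have "sat_on M U e w (subst_fm \<beta> \<xi> \<phi>) = sat_on M U e' v \<phi>"
    using Neg.prems by (intro Neg.IH[where n = n]) auto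
  then show ?case by simp
next
  case (Conj \<phi> \<psi>)
  have "sat_on M U e w (subst_fm \<beta> \<xi> \<phi>) = sat_on M U e' v \<phi>"
    using Conj.prems by (intro Conj.IH(1)[where n = n]) auto
  moreover have "sat_on M U e w (subst_fm \<beta> \<xi> \<psi>) = sat_on M U e' v \<psi>"
    using Conj.prems by (intro Conj.IH(2)[where n = n]) auto
  ultimately show ?case by simp
next
  case (Exi \<phi>)
  have "sat_on M U (x # e) w (subst_fm (case_nat (Inl 0) (shift \<circ> \<beta>)) (shift \<circ> \<xi>) \<phi>) =
      sat_on M U (x # e') v \<phi>" for x
    using Exi.prems
    by (intro Exi.IH[where n = "Suc n"]) (auto simp: atom_val_shift split: nat.split)
  then show ?case by simp
qed

lemma shift_InlD: "shift z = Inl k \<Longrightarrow> \<exists>k'. z = Inl k' \<and> k = Suc k'"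
  by (cases z) auto

lemma shift_InrD: "shift z = Inr x \<Longrightarrow> z = Inr x"
  by (cases z) auto

lemma wf_tm_atom: "(\<And>k. z = Inl k \<Longrightarrow> k < m) \<Longrightarrow> wf_tm L m (atom_tm z)"
  by (cases z) simp_all

lemma wf_tm_subst:
  assumes "wf_tm L n t" "\<And>i k. i < n \<Longrightarrow> \<beta> i = Inl k \<Longrightarrow> k < m"
    "\<And>x k. \<xi> x = Inl k \<Longrightarrow> k < m"
  shows "wf_tm L m (subst_tm \<beta> \<xi> t)"
  using assms by (induction t) (auto intro!: wf_tm_atom simp: list_all_iff)

lemma wf_fm_subst:
  assumes "wf_fm L n \<phi>" "\<And>i k. i < n \<Longrightarrow> \<beta> i = Inl k \<Longrightarrow> k < m"
    "\<And>x k. \<xi> x = Inl k \<Longrightarrow> k < m"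
  shows "wf_fm L m (subst_fm \<beta> \<xi> \<phi>)"
  using assms
proof (induction \<phi> arbitrary: n m \<beta> \<xi>)
  case (Rel r ts)
  then show ?case by (auto simp: list_all_iff intro: wf_tm_subst)
next
  case (Exi \<phi>)
  have "wf_fm L (Suc m) (subst_fm (case_nat (Inl 0) (shift \<circ> \<beta>)) (shift \<circ> \<xi>) \<phi>)"
    using Exi.prems
    by (intro Exi.IH[where n = "Suc n"]) (auto split: nat.splits dest!: shift_InlD)
  then show ?case by simp
qed (auto intro: wf_tm_subst)

lemma tm_vars_atom: "tm_vars (atom_tm z) = {x. z = Inr x}"
  by (cases z) auto

lemma tm_vars_subst:
  assumes "wf_tm L n t"
  shows "tm_vars (subst_tm \<beta> \<xi> t) \<subseteq> {x. Inr x \<in> \<beta> ` {..<n} \<union> \<xi> ` tm_vars t}"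
  using assms by (induction t) (force simp: tm_vars_atom list_all_iff)+

lemma fm_vars_subst:
  assumes "wf_fm L n \<phi>"
  shows "fm_vars (subst_fm \<beta> \<xi> \<phi>) \<subseteq> {x. Inr x \<in> \<beta> ` {..<n} \<union> \<xi> ` fm_vars \<phi>}"
  using assms
proof (induction \<phi> arbitrary: n \<beta> \<xi>)
  case (Eq s t)
  then show ?case using tm_vars_subst[of L n s \<beta> \<xi>] tm_vars_subst[of L n t \<beta> \<xi>] by fastforce
next
  case (Rel r ts)
  then show ?case using tm_vars_subst[of L n _ \<beta> \<xi>] by (fastforce simp: list_all_iff)
next
  case (Neg \<phi>)
  then show ?case by simp
next
  case (Conj \<phi> \<psi>)
  from Conj.IH(1)[of n \<beta> \<xi>] Conj.IH(2)[of n \<beta> \<xi>] Conj.prems show ?case by auto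
next
  case (Exi \<phi>)
  have "fm_vars (subst_fm (case_nat (Inl 0) (shift \<circ> \<beta>)) (shift \<circ> \<xi>) \<phi>)
      \<subseteq> {x. Inr x \<in> case_nat (Inl 0) (shift \<circ> \<beta>) ` {..<Suc n} \<union> (shift \<circ> \<xi>) ` fm_vars \<phi>}"
    using Exi.prems by (intro Exi.IH) simp
  also have "\<dots> \<subseteq> {x. Inr x \<in> \<beta> ` {..<n} \<union> \<xi> ` fm_vars \<phi>}"
  proof
    fix x assume "x \<in> {x. Inr x \<in> case_nat (Inl 0) (shift \<circ> \<beta>) ` {..<Suc n} \<union> (shift \<circ> \<xi>) ` fm_vars \<phi>}"
    then consider i where "i < Suc n" "case_nat (Inl 0) (shift \<circ> \<beta>) i = Inr x"
      | y where "y \<in> fm_vars \<phi>" "shift (\<xi> y) = Inr x"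
      by (fastforce simp: comp_def)
    then show "x \<in> {x. Inr x \<in> \<beta> ` {..<n} \<union> \<xi> ` fm_vars \<phi>}"
    proof cases
      case (1 i)
      then obtain j where "i = Suc j" "j < n" "shift (\<beta> j) = Inr x" by (cases i) auto
      then show ?thesis using shift_InrD by (metis (mono_tags, lifting) UnI1 imageI lessThan_iff mem_Collect_eq)
    next
      case (2 y)
      then show ?thesis using shift_InrD by (metis (mono_tags, lifting) UnI2 imageI mem_Collect_eq)
    qed
  qed
  finally show ?case by simp
qed

lemma tm_val_cong: "(\<And>x. x \<in> tm_vars t \<Longrightarrow> v x = v' x) \<Longrightarrow> tm_val M e v t = tm_val M e v' t"
proof (induction t)
  case (App f ts)
  then have "map (tm_val M e v) ts = map (tm_val M e v') ts" by auto
  then show ?case by (simp del: map_eq_conv)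
qed simp_all

lemma sat_on_cong: "(\<And>x. x \<in> fm_vars \<phi> \<Longrightarrow> v x = v' x) \<Longrightarrow> sat_on M U e v \<phi> = sat_on M U e v' \<phi>"
proof (induction \<phi> arbitrary: e)
  case (Eq s t)
  have "tm_val M e v s = tm_val M e v' s" "tm_val M e v t = tm_val M e v' t"
    using Eq by (auto intro!: tm_val_cong)
  then show ?case by simp
next
  case (Rel r ts)
  then have "map (tm_val M e v) ts = map (tm_val M e v') ts" by (auto intro!: tm_val_cong)
  then show ?case by (simp del: map_eq_conv)
qed auto

section \<open>Automorphisms preserve satisfaction\<close>

lemma automorphism_fun:
  "automorphism L M g \<Longrightarrow> (f, length xs) \<in> Funs L \<Longrightarrow> g (fun_int M f xs) = fun_int M f (map g xs)"
  unfolding automorphism_def by blast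

lemma automorphism_rel:
  "automorphism L M g \<Longrightarrow> (r, length xs) \<in> Rels L \<Longrightarrow> rel_int M r xs = rel_int M r (map g xs)"
  unfolding automorphism_def by blast

lemma tm_val_automorphism:
  assumes "automorphism L M g" "wf_tm L (length e) t"
  shows "tm_val M (map g e) (\<lambda>x. g (v x)) t = g (tm_val M e v t)"
  using assms(2)
proof (induction t)
  case (App f ts)
  then have "map (tm_val M (map g e) (\<lambda>x. g (v x))) ts = map g (map (tm_val M e v) ts)"
    by (simp add: list_all_iff)
  moreover have "(f, length (map (tm_val M e v) ts)) \<in> Funs L" using App.prems by simp
  ultimately show ?case by (simp only: tm_val.simps automorphism_fun[OF assms(1)])
qed simp_all

lemma sat_on_automorphism:
  assumes g: "automorphism L M g" and "wf_fm L (length e) \<phi>"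
  shows "sat_on M UNIV (map g e) (\<lambda>x. g (v x)) \<phi> = sat_on M UNIV e v \<phi>"
  using assms(2)
proof (induction \<phi> arbitrary: e)
  case (Eq s t)
  have "inj g" using g by (simp add: automorphism_def bij_is_inj)
  with Eq show ?case by (simp add: tm_val_automorphism[OF g] inj_eq)
next
  case (Rel r ts)
  have "map (tm_val M (map g e) (\<lambda>x. g (v x))) ts = map g (map (tm_val M e v) ts)"
    using Rel by (simp add: list_all_iff tm_val_automorphism[OF g])
  moreover have "(r, length (map (tm_val M e v) ts)) \<in> Rels L" using Rel by simp
  ultimately show ?case by (simp only: sat_on.simps automorphism_rel[OF g, symmetric])
next
  case (Exi \<phi>)
  have "surj g" using g by (simp add: automorphism_def bij_is_surj)
  then have "(\<exists>x. sat_on M UNIV (x # map g e) (\<lambda>x. g (v x)) \<phi>) \<longleftrightarrow>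
      (\<exists>x. sat_on M UNIV (map g (x # e)) (\<lambda>x. g (v x)) \<phi>)"
    unfolding list.map by (metis surjD)
  also have "\<dots> \<longleftrightarrow> (\<exists>x. sat_on M UNIV (x # e) v \<phi>)"
  proof (rule ex_cong1)
    fix x show "sat_on M UNIV (map g (x # e)) (\<lambda>x. g (v x)) \<phi> = sat_on M UNIV (x # e) v \<phi>"
      using Exi.prems by (intro Exi.IH) simp
  qed
  finally show ?case by simp
qed auto


section \<open>Definable sets\<close>

text \<open>Definable sets stand for formulas up to equivalence, so that connectives, projections
  and implications become set operations. Points are total assignments, although by
  \<open>Def_cong\<close> only the coordinates in \<open>I\<close> matter; this avoids partial
  tuples.\<close>

definition Def ::
  "('f, 'r) lang \<Rightarrow> ('f, 'r, 'a) interp \<Rightarrow> 'x set \<Rightarrow> 'a set \<Rightarrow> ('x \<Rightarrow> 'a) set set"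
where
  "Def L M I B = {{c. holds M c \<phi>} |\<phi>. \<phi> \<in> formulas L I B}"

lemma Def_formula: "\<phi> \<in> formulas L I B \<Longrightarrow> {c. holds M c \<phi>} \<in> Def L M I B"
  unfolding Def_def by blast

lemma DefE:
  assumes "X \<in> Def L M I B"
  obtains \<phi> where "\<phi> \<in> formulas L I B" "X = {c. holds M c \<phi>}"
  using assms unfolding Def_def by blast

lemma Def_mono: "X \<in> Def L M I B \<Longrightarrow> I \<subseteq> I' \<Longrightarrow> B \<subseteq> B' \<Longrightarrow> X \<in> Def L M I' B'"
  unfolding Def_def formulas_def by blast

lemma Def_cong:
  assumes "X \<in> Def L M I B" "\<And>i. i \<in> I \<Longrightarrow> c i = c' i"
  shows "c \<in> X \<longleftrightarrow> c' \<in> X"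
proof -
  obtain \<phi> where \<phi>: "\<phi> \<in> formulas L I B" "X = {c. holds M c \<phi>}" using assms(1) by (rule DefE)
  have "sat M (case_sum c id) \<phi> = sat M (case_sum c' id) \<phi>"
    unfolding sat_def
  proof (rule sat_on_cong)
    fix x assume "x \<in> fm_vars \<phi>"
    then show "case_sum c id x = case_sum c' id x"
      using \<phi>(1) assms(2) by (auto simp: formulas_def)
  qed
  then show ?thesis by (simp add: \<phi>(2) holds_def)
qed

lemma Def_finite:
  fixes X :: "('x \<Rightarrow> 'a) set"
  assumes "X \<in> Def L M I B"
  obtains I0 B0 where "finite I0" "I0 \<subseteq> I" "finite B0" "B0 \<subseteq> B" "X \<in> Def L M I0 B0"
proof -
  obtain \<phi> where \<phi>: "\<phi> \<in> formulas L I B" "X = {c. holds M c \<phi>}" using assms by (rule DefE)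
  let ?I = "{i. Inl i \<in> fm_vars \<phi>}" and ?B = "{b. Inr b \<in> fm_vars \<phi>}"
  have "finite ?I" "finite ?B"
    using finite_vimageI[OF finite_fm_vars inj_Inl, of \<phi>] finite_vimageI[OF finite_fm_vars inj_Inr, of \<phi>]
    by (simp_all add: vimage_def)
  moreover have "?I \<subseteq> I" "?B \<subseteq> B" using \<phi>(1) by (auto simp: formulas_def)
  moreover have "\<phi> \<in> formulas L ?I ?B"
  proof -
    have "x \<in> Inl ` {i. Inl i \<in> V} \<union> Inr ` {b. Inr b \<in> V}" if "x \<in> V"
      for x :: "'x + 'a" and V
      using that by (cases x) auto
    then show ?thesis using \<phi>(1) by (auto simp: formulas_def)
  qed
  then have "X \<in> Def L M ?I ?B" unfolding \<phi>(2) by (rule Def_formula)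
  ultimately show ?thesis using that by blast
qed

lemma Def_Compl: "X \<in> Def L M I B \<Longrightarrow> - X \<in> Def L M I B"
proof (erule DefE)
  fix \<phi> assume "\<phi> \<in> formulas L I B" "X = {c. holds M c \<phi>}"
  then have "Neg \<phi> \<in> formulas L I B" "- X = {c. holds M c (Neg \<phi>)}"
    by (auto simp: formulas_def holds_def sat_def)
  then show ?thesis by (metis Def_formula)
qed

lemma Def_Int:
  assumes "X \<in> Def L M I B" "Y \<in> Def L M I B"
  shows "X \<inter> Y \<in> Def L M I B"
proof -
  obtain \<phi> \<psi> where \<phi>: "\<phi> \<in> formulas L I B" "X = {c. holds M c \<phi>}"
    and \<psi>: "\<psi> \<in> formulas L I B" "Y = {c. holds M c \<psi>}"
    using assms by (metis DefE)
  then have "Conj \<phi> \<psi> \<in> formulas L I B" "X \<inter> Y = {c. holds M c (Conj \<phi> \<psi>)}"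
    by (auto simp: formulas_def holds_def sat_def)
  then show ?thesis by (metis Def_formula)
qed

lemma Def_Un: "X \<in> Def L M I B \<Longrightarrow> Y \<in> Def L M I B \<Longrightarrow> X \<union> Y \<in> Def L M I B"
  using Def_Compl[OF Def_Int[OF Def_Compl Def_Compl], of X L M I B Y] by simp

lemma Def_UNIV: "UNIV \<in> Def L M I B"
proof -
  have "Exi (Eq (BVar 0) (BVar 0)) \<in> formulas L I B"
    "UNIV = {c. holds M c (Exi (Eq (BVar 0) (BVar 0)))}"
    by (auto simp: formulas_def holds_def sat_def)
  then show ?thesis by (metis Def_formula)
qed

lemma Def_empty: "{} \<in> Def L M I B"
  using Def_Compl[OF Def_UNIV, of L M I B] by simp

lemma Def_INT:
  "finite F \<Longrightarrow> (\<And>x. x \<in> F \<Longrightarrow> f x \<in> Def L M I B) \<Longrightarrow> (\<Inter>x\<in>F. f x) \<in> Def L M I B"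
  by (induction F rule: finite_induct) (auto simp: Def_UNIV intro: Def_Int)

lemma Def_UN:
  "finite F \<Longrightarrow> (\<And>x. x \<in> F \<Longrightarrow> f x \<in> Def L M I B) \<Longrightarrow> (\<Union>x\<in>F. f x) \<in> Def L M I B"
  by (induction F rule: finite_induct) (auto simp: Def_empty intro: Def_Un)

lemma Def_Inter: "finite F \<Longrightarrow> F \<subseteq> Def L M I B \<Longrightarrow> \<Inter>F \<in> Def L M I B"
  using Def_INT[of F id L M I B] by auto

lemma Def_Union: "finite F \<Longrightarrow> F \<subseteq> Def L M I B \<Longrightarrow> \<Union>F \<in> Def L M I B"
  using Def_UN[of F id L M I B] by auto

lemma Def_subst:
  fixes X :: "('x \<Rightarrow> 'a) set" and \<sigma> :: "'x \<Rightarrow> 'y + 'a"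
  assumes "X \<in> Def L M I B" "\<And>i. i \<in> I \<Longrightarrow> \<sigma> i \<in> Inl ` J \<union> Inr ` C" "B \<subseteq> C"
  shows "{c. (\<lambda>i. case_sum c id (\<sigma> i)) \<in> X} \<in> Def L M J C"
proof -
  obtain \<phi> where \<phi>: "\<phi> \<in> formulas L I B" "X = {c. holds M c \<phi>}" using assms(1) by (rule DefE)
  let ?\<psi> = "map_fm (case_sum \<sigma> Inr) \<phi>"
  have "?\<psi> \<in> formulas L J C"
  proof -
    have "case_sum \<sigma> Inr x \<in> Inl ` J \<union> Inr ` C" if "x \<in> fm_vars \<phi>" for x
    proof -
      have "x \<in> Inl ` I \<union> Inr ` B" using that \<phi>(1) unfolding formulas_def by blast
      then consider i where "x = Inl i" "i \<in> I" | b where "x = Inr b" "b \<in> B" by blast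
      then show ?thesis
      proof cases
        case (1 i)
        then show ?thesis using assms(2)[of i] by simp
      next
        case (2 b)
        then show ?thesis using assms(3) by auto
      qed
    qed
    then have "fm_vars (map_fm (case_sum \<sigma> Inr) \<phi>) \<subseteq> Inl ` J \<union> Inr ` C"
      unfolding fm.set_map by blast
    then show ?thesis using \<phi>(1) by (simp add: formulas_def wf_fm_map)
  qed
  moreover have "case_sum c id \<circ> case_sum \<sigma> Inr = case_sum (\<lambda>i. case_sum c id (\<sigma> i)) id" for c :: "'y \<Rightarrow> 'a"
    by (rule ext) (simp split: sum.split)
  then have "holds M c ?\<psi> \<longleftrightarrow> holds M (\<lambda>i. case_sum c id (\<sigma> i)) \<phi>" for c
    by (simp add: holds_def sat_def sat_on_map)
  then have "{c. (\<lambda>i. case_sum c id (\<sigma> i)) \<in> X} = {c. holds M c ?\<psi>}" by (simp add: \<phi>(2))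
  ultimately show ?thesis by (metis Def_formula)
qed

lemma Def_reindex: "X \<in> Def L M I B \<Longrightarrow> {c. (\<lambda>i. c (\<rho> i)) \<in> X} \<in> Def L M (\<rho> ` I) B"
  using Def_subst[of X L M I B "\<lambda>i. Inl (\<rho> i)" "\<rho> ` I" B] by simp

section \<open>Projections of definable sets\<close>

lemma Def_ex1:
  fixes X :: "('x \<Rightarrow> 'a) set"
  assumes "X \<in> Def L M I B"
  shows "{c. \<exists>z. c(x := z) \<in> X} \<in> Def L M (I - {x}) B"
proof -
  obtain \<phi> where \<phi>: "\<phi> \<in> formulas L I B" "X = {c. holds M c \<phi>}" using assms(1) by (rule DefE)
  let ?\<xi> = "\<lambda>y. if y = Inl x then Inl 0 else Inr y"
  let ?\<psi> = "Exi (subst_fm (\<lambda>_. Inl 0) ?\<xi> \<phi>)"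
  have wf: "wf_fm L 0 \<phi>" and vars: "fm_vars \<phi> \<subseteq> Inl ` I \<union> Inr ` B"
    using \<phi>(1) by (auto simp: formulas_def)
  have "wf_fm L 0 ?\<psi>" using wf by (auto intro!: wf_fm_subst split: if_splits)
  moreover have "fm_vars ?\<psi> \<subseteq> Inl ` (I - {x}) \<union> Inr ` B"
  proof
    fix y assume "y \<in> fm_vars ?\<psi>"
    then have "Inr y \<in> ?\<xi> ` fm_vars \<phi>" using fm_vars_subst[OF wf, of "\<lambda>_. Inl 0" ?\<xi>] by auto
    then have "y \<in> fm_vars \<phi>" "y \<noteq> Inl x" by (auto split: if_splits)
    then show "y \<in> Inl ` (I - {x}) \<union> Inr ` B" using vars by blast
  qed
  ultimately have "?\<psi> \<in> formulas L (I - {x}) B" by (simp add: formulas_def)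
  moreover have eq: "sat_on M UNIV [z] (case_sum c id) (subst_fm (\<lambda>_. Inl 0) ?\<xi> \<phi>) =
      sat_on M UNIV [] (case_sum (c(x := z)) id) \<phi>" for c z
  proof (rule sat_on_subst[OF wf])
    fix y show "atom_val [z] (case_sum c id) (?\<xi> y) = case_sum (c(x := z)) id y"
      by (cases y) simp_all
  qed simp
  have "{c. \<exists>z. c(x := z) \<in> X} = {c. holds M c ?\<psi>}"
  proof (rule Collect_cong)
    fix c
    have "holds M c ?\<psi> = (\<exists>z. sat_on M UNIV [z] (case_sum c id) (subst_fm (\<lambda>_. Inl 0) ?\<xi> \<phi>))"
      by (simp only: holds_def sat_def sat_on.simps bex_UNIV)
    also have "\<dots> = (\<exists>z. c(x := z) \<in> X)"
      unfolding eq \<phi>(2) by (simp only: mem_Collect_eq holds_def sat_def)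
    finally show "(\<exists>z. c(x := z) \<in> X) = holds M c ?\<psi>" by (rule sym)
  qed
  ultimately show ?thesis using Def_formula[of ?\<psi> L "I - {x}" B M] by (simp only:)
qed

lemma Def_ex_finite:
  fixes X :: "('x \<Rightarrow> 'a) set"
  assumes "finite J" "X \<in> Def L M I B"
  shows "{c. \<exists>d. (\<lambda>i. if i \<in> J then d i else c i) \<in> X} \<in> Def L M (I - J) B"
  using assms
proof (induction J arbitrary: X I rule: finite_induct)
  case (insert x J)
  have "{c. \<exists>d. (\<lambda>i. if i \<in> J then d i else c i) \<in> {c. \<exists>z. c(x := z) \<in> X}}
      \<in> Def L M ((I - {x}) - J) B"
    by (rule insert.IH[OF Def_ex1[OF insert.prems]])
  moreover have eq: "(\<lambda>i. if i \<in> J then d i else c i)(x := z) =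
      (\<lambda>i. if i \<in> insert x J then (d(x := z)) i else c i)" for c d :: "'x \<Rightarrow> 'a" and z
    by (rule ext) auto
  have "{c. \<exists>d. (\<lambda>i. if i \<in> J then d i else c i) \<in> {c. \<exists>z. c(x := z) \<in> X}} =
      {c. \<exists>d. (\<lambda>i. if i \<in> insert x J then d i else c i) \<in> X}"
  proof (intro Collect_cong iffI)
    fix c assume "\<exists>d. (\<lambda>i. if i \<in> J then d i else c i) \<in> {c. \<exists>z. c(x := z) \<in> X}"
    then obtain d z where "(\<lambda>i. if i \<in> J then d i else c i)(x := z) \<in> X" by blast
    then show "\<exists>d. (\<lambda>i. if i \<in> insert x J then d i else c i) \<in> X"
      unfolding eq by (rule exI[where x = "d(x := z)"])
  next
    fix c assume "\<exists>d. (\<lambda>i. if i \<in> insert x J then d i else c i) \<in> X"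
    then obtain d where "(\<lambda>i. if i \<in> insert x J then d i else c i) \<in> X" by blast
    then have "(\<lambda>i. if i \<in> J then d i else c i)(x := d x) \<in> X" unfolding eq fun_upd_triv .
    then show "\<exists>d. (\<lambda>i. if i \<in> J then d i else c i) \<in> {c. \<exists>z. c(x := z) \<in> X}" by blast
  qed
  moreover have "I - {x} - J = I - insert x J" by blast
  ultimately show ?case by simp
qed simp

text \<open>\<open>J\<close> may be infinite, but a formula mentions only finitely many coordinates,
  and those on the right are quantified one at a time. The default \<open>Inr undefined\<close>
  fills right coordinates, none of which is left in the support by then.\<close>

lemma Def_ex:
  fixes X :: "('x + 'y \<Rightarrow> 'a) set"
  assumes "X \<in> Def L M (I <+> J) B"
  shows "{c. \<exists>d. case_sum c d \<in> X} \<in> Def L M I B"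
proof -
  obtain K where K: "finite K" "K \<subseteq> I <+> J" "X \<in> Def L M K B"
  proof (rule Def_finite[OF assms])
    fix K B0 assume "finite K" "K \<subseteq> I <+> J" "B0 \<subseteq> B" "X \<in> Def L M K B0"
    then show thesis using that[of K] Def_mono[of X L M K B0 K B] by simp
  qed
  let ?R = "K \<inter> range Inr"
  let ?Y = "{c. \<exists>d. (\<lambda>i. if i \<in> ?R then d i else c i) \<in> X}"
  have "?Y \<in> Def L M (K - ?R) B" using K by (intro Def_ex_finite) auto
  then have "{c. (\<lambda>i. case_sum c id (case_sum Inl (\<lambda>_. Inr undefined) i)) \<in> ?Y} \<in> Def L M I B"
    using K(2) by (intro Def_subst) auto
  moreover have "(\<lambda>i. case_sum c id (case_sum Inl (\<lambda>_. Inr undefined) i)) \<in> ?Y \<longleftrightarrow>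
      (\<exists>d. case_sum c d \<in> X)" for c :: "'x \<Rightarrow> 'a"
  proof
    assume "(\<lambda>i. case_sum c id (case_sum Inl (\<lambda>_. Inr undefined) i)) \<in> ?Y"
    then obtain d where "(\<lambda>i. if i \<in> ?R then d i else case_sum c id (case_sum Inl (\<lambda>_. Inr undefined) i)) \<in> X"
      by blast
    then have "case_sum c (\<lambda>j. d (Inr j)) \<in> X"
      by (subst (asm) Def_cong[OF K(3), of _ "case_sum c (\<lambda>j. d (Inr j))"]) (auto split: sum.split)
    then show "\<exists>d. case_sum c d \<in> X" by (rule exI[where x = "\<lambda>j. d (Inr j)"])
  next
    assume "\<exists>d. case_sum c d \<in> X"
    then obtain d where "case_sum c d \<in> X" ..
    then have "(\<lambda>i. if i \<in> ?R then case_sum c d i else case_sum c id (case_sum Inl (\<lambda>_. Inr undefined) i)) \<in> X"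
      by (subst Def_cong[OF K(3), of _ "case_sum c d"]) (auto split: sum.split)
    then show "(\<lambda>i. case_sum c id (case_sum Inl (\<lambda>_. Inr undefined) i)) \<in> ?Y" by blast
  qed
  ultimately show ?thesis by simp
qed

lemma Def_eq: "i \<in> I \<Longrightarrow> j \<in> I \<Longrightarrow> {c. c i = c j} \<in> Def L M I B"
  using Def_formula[of "Eq (FVar (Inl i)) (FVar (Inl j))" L I B M]
  by (simp add: formulas_def holds_def sat_def)

lemma Def_eq_param: "i \<in> I \<Longrightarrow> b \<in> B \<Longrightarrow> {c. c i = b} \<in> Def L M I B"
  using Def_formula[of "Eq (FVar (Inl i)) (FVar (Inr b))" L I B M]
  by (simp add: formulas_def holds_def sat_def)

text \<open>The instance \<open>W(x, d)\<close> of a relation \<open>W(x, y)\<close>.\<close>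

definition fib :: "('x + 'y \<Rightarrow> 'a) set \<Rightarrow> ('y \<Rightarrow> 'a) \<Rightarrow> ('x \<Rightarrow> 'a) set" where
  "fib W d = {c. case_sum c d \<in> W}"

lemma mem_fib: "c \<in> fib W d \<longleftrightarrow> case_sum c d \<in> W"
  by (simp add: fib_def)

lemma Def_fib:
  fixes W :: "('x + 'y \<Rightarrow> 'a) set"
  assumes W: "W \<in> Def L M (I <+> J) B"
  shows "fib W d \<in> Def L M I (B \<union> d ` J)"
proof -
  have "{c. (\<lambda>i. case_sum c id (case_sum Inl (\<lambda>j. Inr (d j)) i)) \<in> W} \<in> Def L M I (B \<union> d ` J)"
    by (rule Def_subst[OF W]) auto
  moreover have "(\<lambda>i. case_sum c id (case_sum Inl (\<lambda>j. Inr (d j)) i)) = case_sum c d" for c :: "'x \<Rightarrow> 'a"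
    by (rule ext) (simp split: sum.split)
  ultimately show ?thesis by (simp add: fib_def)
qed

lemma Def_fib_left:
  fixes W :: "('x + 'y \<Rightarrow> 'a) set"
  assumes W: "W \<in> Def L M (I <+> J) B"
  shows "{d. case_sum c d \<in> W} \<in> Def L M J (B \<union> c ` I)"
proof -
  have "{d. (\<lambda>i. case_sum d id (case_sum (\<lambda>i. Inr (c i)) Inl i)) \<in> W} \<in> Def L M J (B \<union> c ` I)"
    by (rule Def_subst[OF W]) auto
  moreover have "(\<lambda>i. case_sum d id (case_sum (\<lambda>i. Inr (c i)) Inl i)) = case_sum c d" for d :: "'y \<Rightarrow> 'a"
    by (rule ext) (simp split: sum.split)
  ultimately show ?thesis by simp
qed

text \<open>Splits a definable set into a relation \<open>W\<close> over \<open>B\<close> and the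
  tuple \<open>d\<close>, so that moving the parameters means moving \<open>d\<close> with
  \<open>W\<close> fixed. As \<open>d\<close> may repeat values, each parameter outside
  \<open>B\<close> is replaced by one chosen index.\<close>

lemma Def_params:
  fixes X :: "('x \<Rightarrow> 'a) set"
  assumes "X \<in> Def L M I (B \<union> d ` J)"
  obtains W where "W \<in> Def L M (I <+> J) B" "X = fib W d"
proof -
  obtain \<phi> where \<phi>: "\<phi> \<in> formulas L I (B \<union> d ` J)" "X = {c. holds M c \<phi>}"
    using assms(1) by (rule DefE)
  let ?p = "\<lambda>b. SOME j. j \<in> J \<and> d j = b"
  let ?f = "case_sum (\<lambda>i. Inl (Inl i)) (\<lambda>b. if b \<in> B then Inr b else Inl (Inr (?p b)))"
  have p: "?p b \<in> J \<and> d (?p b) = b" if "b \<in> d ` J" for b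
    using that by (intro someI_ex[of "\<lambda>j. j \<in> J \<and> d j = b"]) auto
  have "?f x \<in> Inl ` (I <+> J) \<union> Inr ` B" if "x \<in> fm_vars \<phi>" for x
  proof -
    have "x \<in> Inl ` I \<union> Inr ` (B \<union> d ` J)" using that \<phi>(1) unfolding formulas_def by blast
    then consider i where "x = Inl i" "i \<in> I" | b where "x = Inr b" "b \<in> B"
      | b where "x = Inr b" "b \<notin> B" "b \<in> d ` J" by blast
    then show ?thesis
    proof cases
      case (3 b)
      then show ?thesis using p[of b] by (auto intro!: imageI InrI)
    qed (auto intro!: imageI InlI)
  qed
  then have "fm_vars (map_fm ?f \<phi>) \<subseteq> Inl ` (I <+> J) \<union> Inr ` B"
    unfolding fm.set_map by blast
  then have \<psi>: "map_fm ?f \<phi> \<in> formulas L (I <+> J) B"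
    using \<phi>(1) by (simp add: formulas_def wf_fm_map)
  have "holds M (case_sum c d) (map_fm ?f \<phi>) = holds M c \<phi>" for c
    unfolding holds_def sat_def sat_on_map
  proof (rule sat_on_cong)
    fix x assume "x \<in> fm_vars \<phi>"
    then have "x \<in> Inl ` I \<union> Inr ` (B \<union> d ` J)" using \<phi>(1) unfolding formulas_def by blast
    then show "(case_sum (case_sum c d) id \<circ> ?f) x = case_sum c id x" using p by auto
  qed
  then have "X = fib {v. holds M v (map_fm ?f \<phi>)} d" by (simp add: fib_def \<phi>(2))
  then show ?thesis by (rule that[OF Def_formula[OF \<psi>]])
qed


section \<open>The action of the automorphism group\<close>

definition act :: "('a \<Rightarrow> 'a) \<Rightarrow> ('x \<Rightarrow> 'a) set \<Rightarrow> ('x \<Rightarrow> 'a) set" where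
  "act g X = (\<lambda>c i. g (c i)) ` X"

definition Aut :: "('f, 'r) lang \<Rightarrow> ('f, 'r, 'a) interp \<Rightarrow> 'a set \<Rightarrow> ('a \<Rightarrow> 'a) set" where
  "Aut L M B = {g. automorphism L M g \<and> (\<forall>b\<in>B. g b = b)}"

lemma mem_act_image: "inj g \<Longrightarrow> (\<lambda>i. g (c i)) \<in> act g X \<longleftrightarrow> c \<in> X"
proof
  assume g: "inj g" and "(\<lambda>i. g (c i)) \<in> act g X"
  then obtain c' where "c' \<in> X" "(\<lambda>i. g (c i)) = (\<lambda>i. g (c' i))" by (auto simp: act_def)
  moreover from this g have "c = c'" by (auto simp: fun_eq_iff inj_eq)
  ultimately show "c \<in> X" by simp
qed (auto simp: act_def)

lemma mem_act: "bij g \<Longrightarrow> c \<in> act g X \<longleftrightarrow> (\<lambda>i. inv g (c i)) \<in> X"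
  using mem_act_image[of g "\<lambda>i. inv g (c i)" X] by (simp add: bij_is_inj bij_inv_eq_iff surj_f_inv_f bij_is_surj)

lemma act_act: "act g (act h X) = act (g \<circ> h) X"
  by (simp add: act_def image_image)

lemma act_ident: "act id X = X"
  by (simp add: act_def)

lemma act_mono: "X \<subseteq> Y \<Longrightarrow> act g X \<subseteq> act g Y"
  unfolding act_def by blast

lemma AutD: "g \<in> Aut L M B \<Longrightarrow> automorphism L M g" "g \<in> Aut L M B \<Longrightarrow> b \<in> B \<Longrightarrow> g b = b"
  by (simp_all add: Aut_def)

lemma automorphism_bij: "automorphism L M g \<Longrightarrow> bij g"
  by (simp add: automorphism_def)

lemma Aut_bij: "g \<in> Aut L M B \<Longrightarrow> bij g"
  by (simp add: Aut_def automorphism_def)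

lemma automorphism_id: "automorphism L M id"
  by (simp add: automorphism_def)

lemma automorphism_comp:
  assumes g: "automorphism L M g" and h: "automorphism L M h"
  shows "automorphism L M (g \<circ> h)"
  unfolding automorphism_def
proof (intro conjI ballI, goal_cases)
  case 1 show ?case using g h by (simp add: automorphism_def bij_comp)
next
  case (2 fn)
  show ?case
  proof (cases fn)
    case (Pair f n)
    have "(g \<circ> h) (fun_int M f xs) = fun_int M f (map (g \<circ> h) xs)" if "length xs = n" for xs
      using automorphism_fun[OF h, of f xs] automorphism_fun[OF g, of f "map h xs"] 2 that
      by (simp add: Pair comp_def)
    then show ?thesis by (simp add: Pair)
  qed
next
  case (3 rn)
  show ?case
  proof (cases rn)
    case (Pair r n)
    have "rel_int M r xs = rel_int M r (map (g \<circ> h) xs)" if "length xs = n" for xs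
    proof -
      have r: "(r, length xs) \<in> Rels L" using 3 that by (simp add: Pair)
      then have "(r, length (map h xs)) \<in> Rels L" by simp
      from trans[OF automorphism_rel[OF h r] automorphism_rel[OF g this]] show ?thesis
        unfolding map_map .
    qed
    then show ?thesis unfolding Pair prod.case by blast
  qed
qed

lemma automorphism_inv:
  assumes g: "automorphism L M g"
  shows "automorphism L M (inv g)"
proof -
  have b: "bij g" by (rule automorphism_bij[OF g])
  have m: "map g (map (inv g) xs) = xs" for xs
    using b by (simp add: comp_def bij_is_surj surj_f_inv_f)
  have "inv g (fun_int M f xs) = fun_int M f (map (inv g) xs)" if "(f, length xs) \<in> Funs L" for f xs
  proof -
    have "g (fun_int M f (map (inv g) xs)) = fun_int M f xs"
      using automorphism_fun[OF g, of f "map (inv g) xs"] that m by simp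
    then show ?thesis using b by (metis bij_inv_eq_iff)
  qed
  moreover have "rel_int M r xs = rel_int M r (map (inv g) xs)" if "(r, length xs) \<in> Rels L" for r xs
    using automorphism_rel[OF g, of r "map (inv g) xs"] that m by simp
  ultimately show ?thesis using b by (auto simp: automorphism_def bij_imp_bij_inv)
qed

lemma Aut_id: "id \<in> Aut L M B"
  by (simp add: Aut_def automorphism_id)

lemma Aut_comp: "g \<in> Aut L M B \<Longrightarrow> h \<in> Aut L M B \<Longrightarrow> g \<circ> h \<in> Aut L M B"
  by (simp add: Aut_def automorphism_comp)

lemma Aut_inv: "g \<in> Aut L M B \<Longrightarrow> inv g \<in> Aut L M B"
  unfolding Aut_def mem_Collect_eq by (metis automorphism_inv automorphism_bij bij_is_inj inv_f_eq)

lemma Aut_mono: "B \<subseteq> C \<Longrightarrow> Aut L M C \<subseteq> Aut L M B"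
  by (auto simp: Aut_def)

lemma act_holds:
  fixes \<phi> :: "('f, 'r, 'x + 'a) fm"
  assumes g: "automorphism L M g" and wf: "wf_fm L 0 \<phi>"
  shows "act g {c. holds M c \<phi>} = {c. holds M c (inst_params g \<phi>)}"
proof -
  have b: "bij g" by (rule automorphism_bij[OF g])
  have "holds M c (inst_params g \<phi>) \<longleftrightarrow> holds M (\<lambda>i. inv g (c i)) \<phi>" for c
  proof -
    have "case_sum c id \<circ> map_sum id g = (\<lambda>x. g (case_sum (\<lambda>i. inv g (c i)) id x))"
      using b by (intro ext) (simp add: bij_is_surj surj_f_inv_f split: sum.split)
    then have "holds M c (inst_params g \<phi>) =
        sat_on M UNIV [] (\<lambda>x. g (case_sum (\<lambda>i. inv g (c i)) id x)) \<phi>"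
      by (simp only: holds_def sat_def inst_params_def sat_on_map)
    also have "\<dots> = holds M (\<lambda>i. inv g (c i)) \<phi>"
      using sat_on_automorphism[OF g, of "[]" \<phi>] wf by (simp only: holds_def sat_def list.map list.size)
    finally show ?thesis .
  qed
  then show ?thesis by (intro set_eqI) (simp only: mem_act[OF b] mem_Collect_eq)
qed

lemma inst_params_formulas: "\<phi> \<in> formulas L I B \<Longrightarrow> inst_params g \<phi> \<in> formulas L I (g ` B)"
  unfolding formulas_def inst_params_def by (auto simp: wf_fm_map fm.set_map)

lemma Def_act:
  assumes g: "automorphism L M g" and X: "X \<in> Def L M I B"
  shows "act g X \<in> Def L M I (g ` B)"
proof -
  obtain \<phi> where \<phi>: "\<phi> \<in> formulas L I B" "X = {c. holds M c \<phi>}" using X by (rule DefE)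
  then show ?thesis
    using act_holds[OF g, of \<phi>] Def_formula[OF inst_params_formulas[OF \<phi>(1)], of M g]
    by (simp add: formulas_def)
qed

lemma Def_act_UNIV: "automorphism L M g \<Longrightarrow> X \<in> Def L M I UNIV \<Longrightarrow> act g X \<in> Def L M I UNIV"
  by (rule Def_mono[OF Def_act]) auto

lemma act_fix:
  assumes g: "g \<in> Aut L M B" and X: "X \<in> Def L M I B"
  shows "act g X = X"
proof -
  obtain \<phi> where \<phi>: "\<phi> \<in> formulas L I B" "X = {c. holds M c \<phi>}" using X by (rule DefE)
  have "inst_params g \<phi> = map_fm id \<phi>"
    unfolding inst_params_def
    by (rule fm.map_cong0) (use \<phi>(1) AutD(2)[OF g] in \<open>auto simp: formulas_def\<close>)
  then have "inst_params g \<phi> = \<phi>" by (simp add: fm.map_id)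
  then show ?thesis using act_holds[OF AutD(1)[OF g], of \<phi>] \<phi> by (simp add: formulas_def)
qed

lemma Aut_mem_iff:
  "g \<in> Aut L M B \<Longrightarrow> X \<in> Def L M I B \<Longrightarrow> (\<lambda>i. g (c i)) \<in> X \<longleftrightarrow> c \<in> X"
  by (metis act_fix mem_act_image Aut_bij bij_is_inj)

text \<open>An automorphism over \<open>B\<close> preserves \<open>W\<close>, so only the tuple
  moves. This identifies the translates in the definition of dividing with instances along conjugate
  tuples.\<close>

lemma act_fib:
  fixes W :: "('x + 'y \<Rightarrow> 'a) set"
  assumes g: "g \<in> Aut L M B" and W: "W \<in> Def L M (I <+> J) B"
  shows "act g (fib W d) = fib W (\<lambda>j. g (d j))"
proof -
  have b: "bij g" by (rule Aut_bij[OF g])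
  have "(\<lambda>i. g (case_sum (\<lambda>i. inv g (c i)) d i)) = case_sum c (\<lambda>j. g (d j))"
    for c :: "'x \<Rightarrow> 'a"
    using b by (intro ext) (simp add: bij_is_surj surj_f_inv_f split: sum.split)
  then have "case_sum (\<lambda>i. inv g (c i)) d \<in> W \<longleftrightarrow> case_sum c (\<lambda>j. g (d j)) \<in> W" for c
    using Aut_mem_iff[OF g W, of "case_sum (\<lambda>i. inv g (c i)) d"] by (simp only:)
  then show ?thesis by (intro set_eqI) (simp only: mem_act[OF b] mem_fib)
qed

lemma act_reindex: "bij g \<Longrightarrow> act g {c. (\<lambda>i. c (\<rho> i)) \<in> X} = {c. (\<lambda>i. c (\<rho> i)) \<in> act g X}"
  by (auto simp: mem_act)

lemma act_Union: "act g (\<Union>F) = (\<Union>X\<in>F. act g X)"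
  unfolding act_def by blast


section \<open>Ultrafilters\<close>

definition fip :: "'b set set \<Rightarrow> bool" where
  "fip F \<longleftrightarrow> (\<forall>F0. finite F0 \<longrightarrow> F0 \<subseteq> F \<longrightarrow> \<Inter>F0 \<noteq> {})"

text \<open>Closure under supersets and intersections follows: a missing set would have its
  complement in \<open>U\<close>, against \<open>fip\<close>. All sets are decided, definable or
  not, which is what lets \<open>U\<close> contain the set of assignments with values in a
  model.\<close>

definition ultra :: "'b set set \<Rightarrow> bool" where
  "ultra U \<longleftrightarrow> fip U \<and> (\<forall>X. X \<in> U \<or> - X \<in> U)"

lemma fip_insert:
  assumes "fip U" "\<not> fip (insert X U)"
  obtains F where "finite F" "F \<subseteq> U" "\<Inter>F \<inter> X = {}"
proof -
  obtain F where F: "finite F" "F \<subseteq> insert X U" "\<Inter>F = {}" using assms(2) by (auto simp: fip_def)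
  then have "\<Inter>(F - {X}) \<inter> X = {}" by blast
  moreover have "finite (F - {X})" "F - {X} \<subseteq> U" using F by auto
  ultimately show ?thesis using that by blast
qed

lemma ultra_extend:
  assumes "fip F"
  obtains U where "ultra U" "F \<subseteq> U"
proof -
  let ?A = "{U. F \<subseteq> U \<and> fip U}"
  have "\<exists>U\<in>?A. \<forall>V\<in>?A. U \<subseteq> V \<longrightarrow> V = U"
  proof (rule subset_Zorn_nonempty)
    show "?A \<noteq> {}" using assms by blast
  next
    fix C assume C: "C \<noteq> {}" "subset.chain ?A C"
    have "fip (\<Union>C)"
      unfolding fip_def
    proof (intro allI impI)
      fix F0 assume F0: "finite F0" "F0 \<subseteq> \<Union>C"
      obtain U where "U \<in> C" "F0 \<subseteq> U"
        using finite_subset_Union_chain[OF F0 C] by metis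
      then show "\<Inter>F0 \<noteq> {}" using C(2) F0(1) by (auto simp: fip_def subset_chain_def)
    qed
    moreover have "F \<subseteq> \<Union>C" using C by (fastforce simp: subset_chain_def)
    ultimately show "\<Union>C \<in> ?A" by blast
  qed
  then obtain U where "U \<in> ?A" and max': "\<forall>V\<in>?A. U \<subseteq> V \<longrightarrow> V = U" ..
  then have U: "F \<subseteq> U" "fip U" by simp_all
  have max: "V = U" if "F \<subseteq> V" "fip V" "U \<subseteq> V" for V
    using max' that by simp
  have "X \<in> U \<or> - X \<in> U" for X
  proof (rule ccontr)
    assume n: "\<not> (X \<in> U \<or> - X \<in> U)"
    have "\<not> fip (insert X U)" "\<not> fip (insert (- X) U)"
      using max[of "insert X U"] max[of "insert (- X) U"] U(1) n by blast+
    then obtain F1 F2 where "finite F1" "F1 \<subseteq> U" "\<Inter>F1 \<inter> X = {}" "finite F2" "F2 \<subseteq> U" "\<Inter>F2 \<inter> - X = {}"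
      using fip_insert[OF U(2)] by metis
    then have "finite (F1 \<union> F2)" "F1 \<union> F2 \<subseteq> U" "\<Inter>(F1 \<union> F2) = {}" by (simp, simp, blast)
    then show False using U(2) by (auto simp: fip_def)
  qed
  then show ?thesis using that U by (auto simp: ultra_def)
qed

lemma ultra_Inter:
  assumes "ultra U" "finite F" "F \<subseteq> U" "\<Inter>F \<subseteq> X"
  shows "X \<in> U"
proof (rule ccontr)
  assume "X \<notin> U"
  then have "insert (- X) F \<subseteq> U" "finite (insert (- X) F)" using assms by (auto simp: ultra_def)
  moreover have "\<Inter>(insert (- X) F) = {}" using assms(4) by auto
  ultimately show False using assms(1) by (auto simp: ultra_def fip_def)
qed

lemma ultra_superset: "ultra U \<Longrightarrow> X \<in> U \<Longrightarrow> X \<subseteq> Y \<Longrightarrow> Y \<in> U"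
  using ultra_Inter[of U "{X}" Y] by simp

lemma ultra_Int: "ultra U \<Longrightarrow> X \<in> U \<Longrightarrow> Y \<in> U \<Longrightarrow> X \<inter> Y \<in> U"
  using ultra_Inter[of U "{X, Y}" "X \<inter> Y"] by simp

lemma ultra_nonempty: "ultra U \<Longrightarrow> X \<in> U \<Longrightarrow> X \<noteq> {}"
  unfolding ultra_def fip_def by (metis Inter_insert Inter_empty finite.simps inf_top.right_neutral insert_subset empty_subsetI)

lemma ultra_Compl: "ultra U \<Longrightarrow> - X \<in> U \<longleftrightarrow> X \<notin> U"
  using ultra_nonempty[of U "X \<inter> - X"] ultra_Int[of U X "- X"] by (auto simp: ultra_def)

lemma ultra_Union: "ultra U \<Longrightarrow> finite F \<Longrightarrow> X \<in> U \<Longrightarrow> X \<subseteq> \<Union>F \<Longrightarrow> \<exists>Y\<in>F. Y \<in> U"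
proof (rule ccontr)
  assume *: "ultra U" "finite F" "X \<in> U" "X \<subseteq> \<Union>F" "\<not> (\<exists>Y\<in>F. Y \<in> U)"
  then have "insert X (uminus ` F) \<subseteq> U" by (auto simp: ultra_Compl)
  then have "{} \<in> U" using * by (intro ultra_Inter[of U "insert X (uminus ` F)"]) auto
  then show False using *(1) ultra_nonempty by blast
qed

lemma ultra_vimage: "ultra U \<Longrightarrow> ultra {X. f -` X \<in> U}"
  unfolding ultra_def fip_def
proof (intro conjI allI impI)
  fix F0 assume U: "(\<forall>F0. finite F0 \<longrightarrow> F0 \<subseteq> U \<longrightarrow> \<Inter>F0 \<noteq> {}) \<and> (\<forall>X. X \<in> U \<or> - X \<in> U)"
    and F0: "finite F0" "F0 \<subseteq> {X. f -` X \<in> U}"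
  then have "\<Inter>((\<lambda>X. f -` X) ` F0) \<noteq> {}" by (metis (mono_tags, lifting) finite_imageI image_subset_iff mem_Collect_eq subsetD)
  then show "\<Inter>F0 \<noteq> {}" by auto
qed (auto simp: vimage_Compl)


section \<open>Saturation and homogeneity\<close>

locale monster_model =
  fixes L :: "('f, 'r) lang" and \<kappa> :: "'k rel" and M :: "('f, 'r, 'a) interp"
  assumes monster: "monster L \<kappa> M"
begin

section \<open>Closure properties of small sets\<close>

definition small :: "'z set \<Rightarrow> bool" where
  "small X \<longleftrightarrow> |X| <o \<kappa>"

lemma card_order_\<kappa>: "Card_order \<kappa>" and uncountable_\<kappa>: "natLeq <o \<kappa>"
  using monster by (simp_all add: monster_def)

lemma infinite_\<kappa>: "\<not> finite (Field \<kappa>)"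
  using cinfinite_mono[OF ordLess_imp_ordLeq[OF uncountable_\<kappa>] natLeq_cinfinite]
  by (simp add: cinfinite_def)

lemma small_ordLeq: "|X| \<le>o |Y| \<Longrightarrow> small Y \<Longrightarrow> small X"
  unfolding small_def by (rule ordLeq_ordLess_trans)

lemma small_subset: "X \<subseteq> Y \<Longrightarrow> small Y \<Longrightarrow> small X"
  by (rule small_ordLeq[OF card_of_mono1])

lemma small_image: "small X \<Longrightarrow> small (f ` X)"
  by (rule small_ordLeq[OF card_of_image])

lemma small_nat: "small (X :: nat set)"
proof (rule small_subset)
  show "small (UNIV :: nat set)"
    unfolding small_def using card_of_nat uncountable_\<kappa> by (rule ordIso_ordLess_trans)
qed simp

lemma small_range: "small (range (f :: nat \<Rightarrow> 'z))"
  by (rule small_image[OF small_nat])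

lemma small_finite:
  fixes X :: "'z set"
  assumes "finite X"
  shows "small X"
proof -
  obtain f :: "'z \<Rightarrow> nat" where "inj_on f X"
    using finite_imp_inj_to_nat_seg[OF assms] by metis
  then have "|X| \<le>o |UNIV :: nat set|" by (meson card_of_ordLeq subset_UNIV)
  then show ?thesis using small_nat by (rule small_ordLeq)
qed

lemma small_Un: "small X \<Longrightarrow> small Y \<Longrightarrow> small (X \<union> Y)"
  unfolding small_def by (rule card_of_Un_ordLess_infinite_Field[OF infinite_\<kappa> card_order_\<kappa>])

lemma small_Plus: "small X \<Longrightarrow> small Y \<Longrightarrow> small (X <+> Y)"
  unfolding small_def by (rule card_of_Plus_ordLess_infinite_Field[OF infinite_\<kappa> card_order_\<kappa>])

lemma small_nat_Times: "small X \<Longrightarrow> small ((UNIV :: nat set) \<times> X)"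
proof -
  assume X: "small X"
  let ?Z = "(UNIV :: nat set) <+> X"
  have inf: "\<not> finite (Field |?Z| )" by (simp add: finite_Plus_iff Field_card_of)
  have "|UNIV :: nat set| \<le>o |?Z|" "|X| \<le>o |?Z|" by (rule card_of_Plus1, rule card_of_Plus2)
  then have "|(UNIV :: nat set) \<times> X| \<le>o |?Z|"
    by (rule card_of_Times_ordLeq_infinite_Field[OF inf]) (rule card_of_Card_order)
  then show ?thesis using small_Plus[OF small_nat X] by (rule small_ordLeq)
qed

lemma saturated_unit:
  assumes "G \<subseteq> Def L M (UNIV :: unit set) B" "small B" "fip G"
  shows "\<exists>z. \<forall>Y\<in>G. (\<lambda>_. z) \<in> Y"
proof -
  let ?p = "{\<phi> \<in> formulas L (UNIV :: unit set) B. {c. holds M c \<phi>} \<in> G}"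
  have "fin_sat M ?p"
    unfolding fin_sat_def
  proof (intro allI impI)
    fix \<Phi> assume \<Phi>: "finite \<Phi> \<and> \<Phi> \<subseteq> ?p"
    let ?F = "(\<lambda>\<phi>. {c. holds M c \<phi>}) ` \<Phi>"
    have "finite ?F" "?F \<subseteq> G" using \<Phi> by auto
    then have "\<Inter>?F \<noteq> {}" using assms(3) by (simp add: fip_def)
    then obtain c where "c \<in> \<Inter>?F" by blast
    then show "\<exists>c. \<forall>\<phi>\<in>\<Phi>. holds M c \<phi>" by (intro exI[where x = c]) simp
  qed
  then have p: "|B| <o \<kappa> \<and> ?p \<subseteq> formulas L (UNIV :: unit set) B \<and> fin_sat M ?p"
    using assms(2) by (auto simp: small_def)
  have "saturated L \<kappa> M" using monster by (simp add: monster_def)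
  from this[unfolded saturated_def, rule_format, OF p]
  obtain c where c: "\<forall>\<phi>\<in>?p. holds M c \<phi>" ..
  have "(\<lambda>_. c ()) \<in> Y" if "Y \<in> G" for Y
  proof -
    have "Y \<in> Def L M UNIV B" using that assms(1) by blast
    then obtain \<phi> where "\<phi> \<in> formulas L UNIV B" "Y = {c. holds M c \<phi>}" by (rule DefE)
    then have "c \<in> Y" using c that by simp
    moreover have "(\<lambda>_. c ()) = c" by (rule ext) simp
    ultimately show ?thesis by simp
  qed
  then show ?thesis by blast
qed

lemma finite_has_max:
  assumes "finite J" "J \<noteq> {}" "well_order_on UNIV r"
  shows "\<exists>j\<in>J. \<forall>k\<in>J. (k, j) \<in> r"
  using assms(1,2)
proof (induction J rule: finite_ne_induct)
  case (singleton x)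
  then show ?case using assms(3) by (auto simp: order_on_defs refl_on_def)
next
  case (insert x J)
  then obtain j where j: "j \<in> J" "\<forall>k\<in>J. (k, j) \<in> r" by blast
  have x: "(x, x) \<in> r" using assms(3) by (auto simp: order_on_defs refl_on_def)
  moreover have "(x, j) \<in> r \<or> (j, x) \<in> r"
    using assms(3) x by (cases "x = j") (auto simp: order_on_defs total_on_def)
  moreover have "trans r" using assms(3) by (simp add: order_on_defs)
  ultimately show ?case using j by (metis insert_iff transD)
qed

text \<open>The coordinates are chosen along a well-order, each one realising the trace of a fixed
  ultrafilter over the coordinates chosen before.\<close>

theorem saturation:
  fixes F :: "('x \<Rightarrow> 'a) set set"
  assumes "F \<subseteq> Def L M I B" "small I" "small B" "fip F"
  shows "\<Inter>F \<noteq> {}"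
proof -
  obtain U where U: "ultra U" "F \<subseteq> U" using ultra_extend[OF assms(4)] by blast
  obtain r :: "'x rel" where r: "well_order_on UNIV r" using well_order_on by blast
  let ?s = "r - Id"
  have wf: "wf ?s" using r by (simp add: well_order_on_def)
  have tr: "trans r" and re: "\<And>i. (i, i) \<in> r" and anti: "\<And>i j. (i, j) \<in> r \<Longrightarrow> (j, i) \<in> r \<Longrightarrow> i = j"
    using r by (auto simp: order_on_defs refl_on_def antisym_def)
  define le where "le i = {j \<in> I. (j, i) \<in> r}" for i
  define step where
    "step f i = (SOME z. \<forall>X\<in>U \<inter> Def L M (le i) B. f(i := z) \<in> X)" for f :: "'x \<Rightarrow> 'a" and i
  define c where "c = wfrec ?s step"
  have c_eq: "c i = step (cut c ?s i) i" for i
    unfolding c_def by (rule wfrec[OF wf])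
  have cut: "(cut c ?s i)(i := z) \<in> X \<longleftrightarrow> c(i := z) \<in> X" if "X \<in> Def L M (le i) B" for i z X
    by (rule Def_cong[OF that]) (auto simp: cut_def le_def)
  \<comment> \<open>A set with finite support is settled at the greatest coordinate \<open>j\<close>
    of that support, which then lies in \<open>le j\<close>. With empty support, one point of the
    set makes every assignment a member.\<close>
  have glue: "c \<in> X"
    if X: "X \<in> U \<inter> Def L M J B" and J: "\<And>j. j \<in> J \<Longrightarrow> \<forall>X\<in>U \<inter> Def L M (le j) B. c \<in> X" "J \<subseteq> I" for X J
  proof -
    from X have "X \<in> Def L M J B" by simp
    then obtain J0 B0 where J0: "finite J0" "J0 \<subseteq> J" "B0 \<subseteq> B" "X \<in> Def L M J0 B0"
      by (rule Def_finite)
    show ?thesis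
    proof (cases "J0 = {}")
      case True
      obtain c' where "c' \<in> X" using X ultra_nonempty[OF U(1)] by blast
      then show ?thesis using Def_cong[OF J0(4), of c' c] True by simp
    next
      case False
      then obtain j where j: "j \<in> J0" "\<forall>k\<in>J0. (k, j) \<in> r" using finite_has_max[OF J0(1) _ r] by blast
      then have "J0 \<subseteq> le j" using J0(2) J(2) by (auto simp: le_def)
      then have "X \<in> Def L M (le j) B" using J0(3) by (rule Def_mono[OF J0(4)])
      then show ?thesis using J(1)[of j] X j(1) J0(2) by blast
    qed
  qed
  have R: "i \<in> I \<longrightarrow> (\<forall>X\<in>U \<inter> Def L M (le i) B. c \<in> X)" for i
  proof (induction i rule: wf_induct_rule[OF wf])
    case (1 i)
    show ?case
    proof
      assume i: "i \<in> I"
      let ?T = "U \<inter> Def L M (le i) B"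
      let ?f = "\<lambda>X. {u :: unit \<Rightarrow> 'a. c(i := u ()) \<in> X}"
      have "?f X \<in> Def L M UNIV (B \<union> c ` I)" if "X \<in> ?T" for X
      proof -
        have "{u. (\<lambda>k. case_sum u id (if k = i then Inl () else Inr (c k))) \<in> X}
            \<in> Def L M UNIV (B \<union> c ` I)"
          by (rule Def_subst[of X L M "le i" B]) (use that in \<open>auto simp: le_def\<close>)
        moreover have "(\<lambda>k. case_sum u id (if k = i then Inl () else Inr (c k))) = c(i := u ())" for u
          by (rule ext) simp
        ultimately show ?thesis by simp
      qed
      moreover have "small (B \<union> c ` I)" using assms(2,3) by (intro small_Un small_image)
      moreover have "fip (?f ` ?T)"
        unfolding fip_def
      proof (intro allI impI)
        fix G0 assume "finite G0" "G0 \<subseteq> ?f ` ?T"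
        then obtain T0 where T0: "T0 \<subseteq> ?T" "finite T0" "G0 = ?f ` T0" by (meson finite_subset_image)
        \<comment> \<open>Projecting away coordinate \<open>i\<close> gives a set of
          \<open>U\<close> that involves only earlier coordinates, so \<open>c\<close> belongs to it
          by induction. The witness of the projection is a value for \<open>i\<close>.\<close>
        let ?X = "\<Inter>T0"
        have "?X \<in> Def L M (le i) B" using T0 by (intro Def_Inter) auto
        then have d: "{c. \<exists>z. c(i := z) \<in> ?X} \<in> Def L M (le i - {i}) B" by (rule Def_ex1)
        have "?X \<in> U" using T0 by (intro ultra_Inter[OF U(1), of T0]) auto
        moreover have "?X \<subseteq> {c. \<exists>z. c(i := z) \<in> ?X}"
        proof
          fix c assume "c \<in> ?X"
          then have "c(i := c i) \<in> ?X" by simp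
          then show "c \<in> {c. \<exists>z. c(i := z) \<in> ?X}" by blast
        qed
        ultimately have "{c. \<exists>z. c(i := z) \<in> ?X} \<in> U" by (rule ultra_superset[OF U(1)])
        with d have "c \<in> {c. \<exists>z. c(i := z) \<in> ?X}"
          by (intro glue[of _ "le i - {i}"]) (use 1 in \<open>auto simp: le_def\<close>)
        then obtain z where "c(i := z) \<in> ?X" by blast
        then have "(\<lambda>_. z) \<in> \<Inter>G0" unfolding T0(3) by simp
        then show "\<Inter>G0 \<noteq> {}" by blast
      qed
      ultimately obtain z where z: "\<forall>Y\<in>?f ` ?T. (\<lambda>_. z) \<in> Y"
        using saturated_unit[of "?f ` ?T" "B \<union> c ` I"] by blast
      then have "\<forall>X\<in>?T. (cut c ?s i)(i := z) \<in> X" using cut by simp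
      then have "\<forall>X\<in>?T. (cut c ?s i)(i := c i) \<in> X"
        unfolding c_eq[of i] step_def by (rule someI)
      then show "\<forall>X\<in>?T. c \<in> X" using cut by simp
    qed
  qed
  have "c \<in> X" if "X \<in> F" for X
    by (rule glue[of X I]) (use that U(2) assms(1) R in auto)
  then show ?thesis by blast
qed

text \<open>Strong homogeneity speaks of maps on elements, whereas tuples may repeat entries.
  Sending \<open>c i\<close> to \<open>c' i\<close> is well defined and fixes \<open>B\<close>,
  because equations between coordinates, or with parameters, are definable themselves.\<close>

lemma homogeneity:
  fixes c c' :: "'x \<Rightarrow> 'a"
  assumes "small I" "small B" "\<And>X. X \<in> Def L M I B \<Longrightarrow> c \<in> X \<Longrightarrow> c' \<in> X"
  shows "\<exists>g\<in>Aut L M B. \<forall>i\<in>I. g (c i) = c' i"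
proof -
  let ?E = "B \<union> c ` I"
  define pick where "pick e = (SOME i. i \<in> I \<and> c i = e)" for e
  have pick: "pick (c i) \<in> I \<and> c (pick (c i)) = c i" if "i \<in> I" for i
    unfolding pick_def by (rule someI[of _ i]) (simp add: that)
  define \<sigma> where "\<sigma> e = (if e \<in> B then Inr e else Inl (pick e))" for e
  define h where "h e = case_sum c' id (\<sigma> e)" for e
  have iff: "c \<in> X \<longleftrightarrow> c' \<in> X" if "X \<in> Def L M I B" for X
    using assms(3)[OF that] assms(3)[OF Def_Compl[OF that]] by auto
  have "holds M h \<phi> \<longleftrightarrow> holds M id \<phi>" if "\<phi> \<in> formulas L ?E {}" for \<phi> :: "('f, 'r, 'a + 'a) fm"
  proof -
    have X: "{v. holds M v \<phi>} \<in> Def L M ?E {}" using that by (rule Def_formula)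
    have "{v. (\<lambda>e. case_sum v id (\<sigma> e)) \<in> {v. holds M v \<phi>}} \<in> Def L M I B"
      by (rule Def_subst[OF X]) (use pick in \<open>auto simp: \<sigma>_def\<close>)
    from iff[OF this] have "holds M h \<phi> \<longleftrightarrow> holds M (\<lambda>e. case_sum c id (\<sigma> e)) \<phi>"
      by (simp add: h_def[abs_def])
    also have "\<dots> \<longleftrightarrow> holds M id \<phi>"
    proof -
      have "case_sum c id (\<sigma> e) = id e" if "e \<in> ?E" for e using that pick by (auto simp: \<sigma>_def)
      from Def_cong[OF X, of "\<lambda>e. case_sum c id (\<sigma> e)" id, OF this] show ?thesis
        unfolding mem_Collect_eq .
    qed
    finally show ?thesis .
  qed
  then have "tp L M ?E h {} = tp L M ?E id {}" by (auto simp: tp_def)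
  moreover have "small ?E" using assms(1,2) by (intro small_Un small_image)
  ultimately have E: "|?E| <o \<kappa> \<and> tp L M ?E h {} = tp L M ?E id {}" by (simp add: small_def)
  have "strongly_homogeneous L \<kappa> M" using monster by (simp add: monster_def)
  from this[unfolded strongly_homogeneous_def, rule_format, OF E]
  obtain g where g: "automorphism L M g" "\<And>e. e \<in> ?E \<Longrightarrow> g e = h e" by blast
  have "g b = b" if "b \<in> B" for b using g(2)[of b] that by (simp add: h_def \<sigma>_def)
  then have "g \<in> Aut L M B" using g(1) by (simp add: Aut_def)
  moreover have "g (c i) = c' i" if i: "i \<in> I" for i
  proof (cases "c i \<in> B")
    case True
    have "c' \<in> {v. v i = c i}" by (rule assms(3)[OF Def_eq_param[OF i True]]) simp
    then show ?thesis using g(2)[of "c i"] True by (simp add: h_def \<sigma>_def)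
  next
    case False
    have "c' \<in> {v. v i = v (pick (c i))}" by (rule assms(3)[OF Def_eq]) (use i pick in auto)
    then show ?thesis using g(2)[of "c i"] False i by (simp add: h_def \<sigma>_def)
  qed
  ultimately show ?thesis by blast
qed

end


section \<open>Small elementary substructures\<close>

text \<open>Every formula is the output of a program for a stack machine. This bounds the number of formulas
  by the number of programs.\<close>

datatype ('f, 'r, 'v) token =
  TBVar nat | TFVar 'v | TApp 'f nat | TEq | TRel 'r nat | TNeg | TConj | TExi

fun exec ::
  "('f, 'r, 'v) token \<Rightarrow> ('f, 'v) tm list \<times> ('f, 'r, 'v) fm list \<Rightarrow> ('f, 'v) tm list \<times> ('f, 'r, 'v) fm list"
where
  "exec (TBVar i) (ts, ps) = (BVar i # ts, ps)"
| "exec (TFVar x) (ts, ps) = (FVar x # ts, ps)"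
| "exec (TApp f n) (ts, ps) = (App f (take n ts) # drop n ts, ps)"
| "exec TEq (ts, ps) = (drop 2 ts, Eq (ts ! 0) (ts ! 1) # ps)"
| "exec (TRel r n) (ts, ps) = (drop n ts, Rel r (take n ts) # ps)"
| "exec TNeg (ts, ps) = (ts, Neg (hd ps) # tl ps)"
| "exec TConj (ts, ps) = (ts, Conj (ps ! 0) (ps ! 1) # drop 2 ps)"
| "exec TExi (ts, ps) = (ts, Exi (hd ps) # tl ps)"

definition tokens :: "('f, 'r) lang \<Rightarrow> 'v set \<Rightarrow> ('f, 'r, 'v) token set" where
  "tokens L V = range TBVar \<union> TFVar ` V \<union> case_prod TApp ` Funs L \<union> case_prod TRel ` Rels L \<union>
     {TEq, TNeg, TConj, TExi}"

lemma tokens_tm_list: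
  assumes "\<And>t. t \<in> set us \<Longrightarrow> \<exists>xs\<in>lists (tokens L V). \<forall>ts ps. fold exec xs (ts, ps) = (t # ts, ps)"
  shows "\<exists>xs\<in>lists (tokens L V). \<forall>ts ps. fold exec xs (ts, ps) = (us @ ts, ps)"
  using assms
proof (induction us)
  case Nil
  show ?case by (rule bexI[of _ "[]"]) simp_all
next
  case (Cons u us)
  then obtain xs ys where "xs \<in> lists (tokens L V)" "\<forall>ts ps. fold exec xs (ts, ps) = (us @ ts, ps)"
    "ys \<in> lists (tokens L V)" "\<forall>ts ps. fold exec ys (ts, ps) = (u # ts, ps)"
    by (metis list.set_intros)
  then show ?case by (intro bexI[of _ "xs @ ys"]) simp_all
qed

lemma tokens_tm:
  "wf_tm L n t \<Longrightarrow> tm_vars t \<subseteq> V \<Longrightarrow>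
    \<exists>xs\<in>lists (tokens L V). \<forall>ts (ps :: ('f, 'r, 'v) fm list). fold exec xs (ts, ps) = (t # ts, ps)"
proof (induction t)
  case (BVar i)
  show ?case by (rule bexI[of _ "[TBVar i]"]) (auto simp: tokens_def)
next
  case (FVar x)
  then show ?case by (intro bexI[of _ "[TFVar x]"]) (auto simp: tokens_def)
next
  case (App f us)
  have "\<exists>xs\<in>lists (tokens L V). \<forall>ts (ps :: ('f, 'r, 'v) fm list). fold exec xs (ts, ps) = (us @ ts, ps)"
    by (rule tokens_tm_list) (use App in \<open>auto simp: list_all_iff\<close>)
  then obtain xs where "xs \<in> lists (tokens L V)"
    "\<forall>ts (ps :: ('f, 'r, 'v) fm list). fold exec xs (ts, ps) = (us @ ts, ps)" by blast
  moreover have "TApp f (length us) \<in> tokens L V" using App.prems(1) by (force simp: tokens_def)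
  ultimately show ?case by (intro bexI[of _ "xs @ [TApp f (length us)]"]) simp_all
qed

lemma tokens_fm:
  fixes \<phi> :: "('f, 'r, 'v) fm"
  shows "wf_fm L n \<phi> \<Longrightarrow> fm_vars \<phi> \<subseteq> V \<Longrightarrow>
    \<exists>xs\<in>lists (tokens L V). \<forall>ts ps. fold exec xs (ts, ps) = (ts, \<phi> # ps)"
proof (induction \<phi> arbitrary: n)
  case (Eq s t)
  have "\<exists>xs\<in>lists (tokens L V). \<forall>ts (ps :: ('f, 'r, 'v) fm list). fold exec xs (ts, ps) = ([s, t] @ ts, ps)"
    by (rule tokens_tm_list) (use Eq tokens_tm[of L n _ V] in auto)
  then obtain xs where "xs \<in> lists (tokens L V)"
    "\<forall>ts (ps :: ('f, 'r, 'v) fm list). fold exec xs (ts, ps) = ([s, t] @ ts, ps)" by blast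
  then show ?case by (intro bexI[of _ "xs @ [TEq]"]) (simp_all add: tokens_def)
next
  case (Rel r us)
  have "\<exists>xs\<in>lists (tokens L V). \<forall>ts (ps :: ('f, 'r, 'v) fm list). fold exec xs (ts, ps) = (us @ ts, ps)"
  proof (rule tokens_tm_list)
    fix t assume "t \<in> set us"
    then have "wf_tm L n t" "tm_vars t \<subseteq> V" using Rel by (auto simp: list_all_iff)
    then show "\<exists>xs\<in>lists (tokens L V). \<forall>ts (ps :: ('f, 'r, 'v) fm list). fold exec xs (ts, ps) = (t # ts, ps)"
      by (rule tokens_tm)
  qed
  then obtain xs where "xs \<in> lists (tokens L V)"
    "\<forall>ts (ps :: ('f, 'r, 'v) fm list). fold exec xs (ts, ps) = (us @ ts, ps)" by blast
  moreover have "TRel r (length us) \<in> tokens L V" using Rel.prems(1) by (force simp: tokens_def)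
  ultimately show ?case by (intro bexI[of _ "xs @ [TRel r (length us)]"]) simp_all
next
  case (Neg \<phi>)
  then obtain xs where "xs \<in> lists (tokens L V)" "\<forall>ts ps. fold exec xs (ts, ps) = (ts, \<phi> # ps)"
    by (metis fm.set(3) wf_fm.simps(3))
  then show ?case by (intro bexI[of _ "xs @ [TNeg]"]) (simp_all add: tokens_def)
next
  case (Conj \<phi> \<psi>)
  have "\<exists>xs\<in>lists (tokens L V). \<forall>ts ps. fold exec xs (ts, ps) = (ts, \<phi> # ps)"
    "\<exists>xs\<in>lists (tokens L V). \<forall>ts ps. fold exec xs (ts, ps) = (ts, \<psi> # ps)"
    using Conj by auto
  then obtain xs ys where "xs \<in> lists (tokens L V)" "\<forall>ts ps. fold exec xs (ts, ps) = (ts, \<phi> # ps)"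
    "ys \<in> lists (tokens L V)" "\<forall>ts ps. fold exec ys (ts, ps) = (ts, \<psi> # ps)" by blast
  \<comment> \<open>The second conjunct is pushed first, so that the first one is on top when
    \<open>TConj\<close> reads positions 0 and 1.\<close>
  then show ?case by (intro bexI[of _ "ys @ xs @ [TConj]"]) (simp_all add: tokens_def)
next
  case (Exi \<phi>)
  then obtain xs where "xs \<in> lists (tokens L V)" "\<forall>ts ps. fold exec xs (ts, ps) = (ts, \<phi> # ps)"
    by (metis fm.set(5) wf_fm.simps(5))
  then show ?case by (intro bexI[of _ "xs @ [TExi]"]) (simp_all add: tokens_def)
qed

section \<open>Counting definable sets\<close>

lemma card_of_lists_ordLeq:
  assumes Z: "infinite Z" and T: "|T| \<le>o |Z|"
  shows "|lists T| \<le>o |Z|"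
proof -
  have inf: "\<not> finite (Field |Z| )" using Z by (simp add: Field_card_of)
  have n: "|{xs \<in> lists T. length xs = n}| \<le>o |Z|" for n
  proof (induction n)
    case 0
    have "{xs \<in> lists T. length xs = 0} = {[]}" by auto
    then show ?case using Z by (metis card_of_singl_ordLeq finite.emptyI)
  next
    case (Suc n)
    have "{xs \<in> lists T. length xs = Suc n} \<subseteq> case_prod (#) ` (T \<times> {xs \<in> lists T. length xs = n})"
      by (auto simp: length_Suc_conv image_iff)
    then have "|{xs \<in> lists T. length xs = Suc n}| \<le>o |T \<times> {xs \<in> lists T. length xs = n}|"
      by (meson card_of_image card_of_mono1 ordLeq_transitive)
    also have "|T \<times> {xs \<in> lists T. length xs = n}| \<le>o |Z|"
      by (rule card_of_Times_ordLeq_infinite_Field[OF inf T Suc]) (rule card_of_Card_order)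
    finally show ?case .
  qed
  have "|UNIV :: nat set| \<le>o |Z|" using Z infinite_iff_card_of_nat by blast
  then have "|\<Union>n. {xs \<in> lists T. length xs = n}| \<le>o |Z|"
    by (rule card_of_UNION_ordLeq_infinite[OF Z]) (use n in blast)
  moreover have "(\<Union>n. {xs \<in> lists T. length xs = n}) = lists T" by auto
  ultimately show ?thesis by simp
qed

lemma card_of_Un_ordLeq:
  assumes "infinite Z" "|X| \<le>o |Z|" "|Y| \<le>o |Z|"
  shows "|X \<union> Y| \<le>o |Z|"
  by (rule card_of_Un_ordLeq_infinite_Field[of "|Z|"]) (use assms in \<open>simp_all only: card_of_card_order_on Field_card_of not_False_eq_True\<close>)

lemma card_of_image_ordLeq: "|X| \<le>o |Z| \<Longrightarrow> |f ` X| \<le>o |Z|"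
  by (rule ordLeq_transitive[OF card_of_image])

lemma card_of_Def_ordLeq:
  fixes L :: "('f, 'r) lang" and B :: "'a set" and I :: "'x set"
  assumes Z: "infinite Z" and "|Funs L| \<le>o |Z|" "|Rels L| \<le>o |Z|" "|B| \<le>o |Z|" "finite I"
  shows "|Def L M I B| \<le>o |Z|"
proof -
  let ?V = "Inl ` I \<union> Inr ` B"
  have nat: "|UNIV :: nat set| \<le>o |Z|" using Z infinite_iff_card_of_nat by blast
  have fin: "|X| \<le>o |Z|" if "finite X" for X :: "'z set"
    using that Z by (metis card_of_Well_order card_of_ordLeq_finite ordLeq_total)
  have "|tokens L ?V| \<le>o |Z|"
    unfolding tokens_def
    by (intro card_of_Un_ordLeq[OF Z] card_of_image_ordLeq nat assms(2-4) fin) (use assms(5) in auto)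
  then have "|lists (tokens L ?V)| \<le>o |Z|" by (rule card_of_lists_ordLeq[OF Z])
  moreover have "formulas L I B \<subseteq> (\<lambda>xs. hd (snd (fold exec xs ([], [])))) ` lists (tokens L ?V)"
  proof
    fix \<phi> :: "('f, 'r, 'x + 'a) fm" assume "\<phi> \<in> formulas L I B"
    then obtain xs where "xs \<in> lists (tokens L ?V)" "fold exec xs ([], []) = ([], [\<phi>])"
      using tokens_fm[of L 0 \<phi> ?V] by (auto simp: formulas_def)
    then show "\<phi> \<in> (\<lambda>xs. hd (snd (fold exec xs ([], [])))) ` lists (tokens L ?V)"
      by (intro image_eqI[of _ _ xs]) simp_all
  qed
  ultimately have "|formulas L I B| \<le>o |Z|"
    by (meson card_of_image_ordLeq card_of_mono1 ordLeq_transitive)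
  moreover have "Def L M I B = (\<lambda>\<phi>. {c. holds M c \<phi>}) ` formulas L I B" by (auto simp: Def_def)
  ultimately show ?thesis by (simp add: card_of_image_ordLeq)
qed

context monster_model
begin

text \<open>The Tarski--Vaught criterion for \<open>N\<close> to be an elementary substructure.\<close>

definition mdl :: "'a set \<Rightarrow> bool" where
  "mdl N \<longleftrightarrow> (\<forall>Y\<in>Def L M (UNIV :: unit set) N. Y \<noteq> {} \<longrightarrow> (\<exists>z\<in>N. (\<lambda>_. z) \<in> Y))"

lemma Loewenheim_Skolem:
  assumes "small A"
  obtains N where "A \<subseteq> N" "small N" "mdl N"
proof -
  let ?Z = "(Funs L <+> Rels L) <+> (A <+> (UNIV :: nat set))"
  have inf: "infinite ?Z" by (simp add: finite_Plus_iff)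
  have sZ: "small ?Z"
    using monster assms by (intro small_Plus small_nat) (simp_all add: small_def monster_def)
  have Fun: "|Funs L| \<le>o |?Z|" and Rel: "|Rels L| \<le>o |?Z|" and A: "|A| \<le>o |?Z|"
    and nat: "|UNIV :: nat set| \<le>o |?Z|"
    by (meson card_of_Plus1 card_of_Plus2 ordLeq_transitive)+
  define wit where "wit B = (\<lambda>Y. SOME z. (\<lambda>_. z) \<in> Y) ` Def L M (UNIV :: unit set) B" for B
  define K where "K = rec_nat A (\<lambda>_ B. B \<union> wit B)"
  have K0: "K 0 = A" and KS: "K (Suc n) = K n \<union> wit (K n)" for n by (simp_all add: K_def)
  have mono: "K m \<subseteq> K n" if "m \<le> n" for m n by (rule lift_Suc_mono_le[OF _ that]) (auto simp: KS)
  have "|K n| \<le>o |?Z|" for n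
  proof (induction n)
    case (Suc n)
    then show ?case unfolding KS wit_def
      by (intro card_of_Un_ordLeq[OF inf] card_of_image_ordLeq card_of_Def_ordLeq[OF inf] Fun Rel) simp_all
  qed (simp add: K0 A)
  then have "|\<Union>n. K n| \<le>o |?Z|" by (intro card_of_UNION_ordLeq_infinite[OF inf nat]) simp
  then have "small (\<Union>n. K n)" using sZ by (rule small_ordLeq)
  moreover have "mdl (\<Union>n. K n)"
    unfolding mdl_def
  proof (intro ballI impI)
    fix Y :: "(unit \<Rightarrow> 'a) set" assume Y: "Y \<in> Def L M UNIV (\<Union>n. K n)" "Y \<noteq> {}"
    from Y(1) obtain I0 :: "unit set" and B0
      where B0: "finite B0" "B0 \<subseteq> (\<Union>n. K n)" "Y \<in> Def L M I0 B0"
      by (rule Def_finite) 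
    have "\<exists>n. B0 \<subseteq> K n"
      using B0(1,2)
    proof (induction B0 rule: finite_induct)
      case (insert x F)
      then obtain n m where "F \<subseteq> K n" "x \<in> K m" by auto
      then show ?case using mono[of n "max m n"] mono[of m "max m n"] by (intro exI[of _ "max m n"]) auto
    qed simp
    then obtain n where "B0 \<subseteq> K n" ..
    then have Yn: "Y \<in> Def L M UNIV (K n)" by (intro Def_mono[OF B0(3)]) simp_all
    obtain u where "u \<in> Y" using Y(2) by blast
    moreover have "u = (\<lambda>_. u ())" by (rule ext) simp
    ultimately have "(\<lambda>_. SOME z. (\<lambda>_. z) \<in> Y) \<in> Y" by (metis someI)
    moreover have "(SOME z. (\<lambda>_. z) \<in> Y) \<in> K (Suc n)" using Yn by (auto simp: KS wit_def)
    ultimately show "\<exists>z\<in>\<Union>n. K n. (\<lambda>_. z) \<in> Y" by blast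
  qed
  moreover have "A \<subseteq> (\<Union>n. K n)" using K0 by blast
  ultimately show ?thesis using that by blast
qed

lemma mdl_nonempty: "mdl N \<Longrightarrow> N \<noteq> {}"
  unfolding mdl_def using Def_UNIV[of L M "UNIV :: unit set" N] by blast

text \<open>Choosing the coordinates successively reduces to one variable; outside the finite
  support any element of \<open>N\<close> will do. This is the source of coheirs: what is consistent
  and definable over \<open>N\<close> is satisfied inside \<open>N\<close>.\<close>

lemma mdl_point:
  fixes X :: "('x \<Rightarrow> 'a) set"
  assumes N: "mdl N" and X: "X \<in> Def L M I N" "X \<noteq> {}"
  shows "\<exists>c\<in>X. range c \<subseteq> N"
proof -
  have fin: "\<exists>c\<in>X. c ` I \<subseteq> N" if "finite I" "X \<in> Def L M I N" "X \<noteq> {}" for I and X :: "('x \<Rightarrow> 'a) set"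
    using that
  proof (induction I arbitrary: X rule: finite_induct)
    case (insert i I)
    have "{c. \<exists>z. c(i := z) \<in> X} \<in> Def L M I N"
      using Def_ex1[OF insert.prems(1), of i] by (rule Def_mono) auto
    moreover have "{c. \<exists>z. c(i := z) \<in> X} \<noteq> {}"
    proof -
      obtain c where "c(i := c i) \<in> X" using insert.prems(2) by auto
      then show ?thesis by blast
    qed
    ultimately obtain c z where c: "c ` I \<subseteq> N" "c(i := z) \<in> X" using insert.IH by blast
    have "{u. (\<lambda>k. case_sum u id (if k = i then Inl () else Inr (c k))) \<in> X} \<in> Def L M UNIV N"
      by (rule Def_subst[OF insert.prems(1)]) (use c(1) in auto)
    moreover have *: "(\<lambda>k. case_sum u id (if k = i then Inl () else Inr (c k))) = c(i := u ())" for u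
      by (rule ext) simp
    ultimately have "{u. c(i := u ()) \<in> X} \<in> Def L M UNIV N" by simp
    moreover have "(\<lambda>_. z) \<in> {u. c(i := u ()) \<in> X}" using c(2) by simp
    ultimately obtain z' where "z' \<in> N" "c(i := z') \<in> X" using N unfolding mdl_def by fastforce
    then show ?case using c(1) insert.hyps by (intro bexI[of _ "c(i := z')"]) auto
  qed auto
  obtain I0 B0 where I0: "finite I0" "B0 \<subseteq> N" "X \<in> Def L M I0 B0" using X(1) by (rule Def_finite)
  then have "X \<in> Def L M I0 N" by (intro Def_mono[OF I0(3)]) simp_all
  from fin[OF I0(1) this X(2)] obtain c where c: "c \<in> X" "c ` I0 \<subseteq> N" by blast
  obtain n where n: "n \<in> N" using mdl_nonempty[OF N] by blast
  have "(\<lambda>i. if i \<in> I0 then c i else n) \<in> X" using c(1) by (subst Def_cong[OF I0(3), of _ c]) simp_all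
  then show ?thesis using n c(2) by (intro bexI[of _ "\<lambda>i. if i \<in> I0 then c i else n"]) auto
qed

lemma mdl_image:
  assumes g: "automorphism L M g" and N: "mdl N"
  shows "mdl (g ` N)"
  unfolding mdl_def
proof (intro ballI impI)
  fix Y :: "(unit \<Rightarrow> 'a) set" assume Y: "Y \<in> Def L M UNIV (g ` N)" "Y \<noteq> {}"
  have b: "bij g" by (rule automorphism_bij[OF g])
  have "act (inv g) Y \<in> Def L M UNIV (inv g ` g ` N)" by (rule Def_act[OF automorphism_inv[OF g] Y(1)])
  moreover have "inv g ` g ` N = N" using b by (simp add: bij_is_inj image_image)
  moreover have "act (inv g) Y \<noteq> {}" using Y(2) by (simp add: act_def)
  ultimately obtain z where "z \<in> N" "(\<lambda>_. z) \<in> act (inv g) Y" using N unfolding mdl_def by metis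
  then show "\<exists>z\<in>g ` N. (\<lambda>_. z) \<in> Y"
    using mem_act[OF bij_imp_bij_inv[OF b], of "\<lambda>_. z" Y] b by (auto simp: inv_inv_eq)
qed

section \<open>The Tarski-Vaught criterion is equivalent to being an elementary substructure\<close>

lemma mdl_sat_on:
  assumes N: "mdl N"
  shows "wf_fm L n \<phi> \<Longrightarrow> length e = n \<Longrightarrow> set e \<subseteq> N \<Longrightarrow> range v \<subseteq> N \<Longrightarrow>
    sat_on M N e v \<phi> = sat_on M UNIV e v \<phi>"
proof (induction \<phi> arbitrary: n e)
  case (Exi \<phi>)
  have IH: "sat_on M N (x # e) v \<phi> = sat_on M UNIV (x # e) v \<phi>" if "x \<in> N" for x
    using Exi.prems that by (intro Exi.IH[of "Suc n"]) auto
  let ?\<beta> = "case_nat (Inr (Inl ())) (\<lambda>i. Inr (Inr (e ! i))) :: nat \<Rightarrow> nat + (unit + 'a)"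
    and ?\<xi> = "\<lambda>x. Inr (Inr (v x)) :: nat + (unit + 'a)"
  let ?\<psi> = "subst_fm ?\<beta> ?\<xi> \<phi>"
  have wf: "wf_fm L (Suc n) \<phi>" using Exi.prems(1) by simp
  have "wf_fm L 0 ?\<psi>" by (rule wf_fm_subst[OF wf]) (auto split: nat.splits)
  moreover have "fm_vars ?\<psi> \<subseteq> Inl ` UNIV \<union> Inr ` N"
  proof
    fix y assume "y \<in> fm_vars ?\<psi>"
    then have "Inr y \<in> ?\<beta> ` {..<Suc n} \<union> ?\<xi> ` fm_vars \<phi>"
      using fm_vars_subst[OF wf, of ?\<beta> ?\<xi>] by blast
    then show "y \<in> Inl ` UNIV \<union> Inr ` N"
    proof
      assume "Inr y \<in> ?\<beta> ` {..<Suc n}"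
      then obtain i where i: "i < Suc n" "Inr y = ?\<beta> i" by auto
      then show ?thesis using Exi.prems(2,3) by (cases i) (simp_all add: subset_iff)
    qed (use Exi.prems(4) in auto)
  qed
  ultimately have \<psi>: "?\<psi> \<in> formulas L (UNIV :: unit set) N" by (simp add: formulas_def)
  have h: "holds M u ?\<psi> = sat_on M UNIV (u () # e) v \<phi>" for u
    unfolding holds_def sat_def
  proof (rule sat_on_subst[OF wf])
    fix i assume "i < Suc n"
    show "atom_val [] (case_sum u id) (?\<beta> i) = (u () # e) ! i" by (cases i) simp_all
  qed simp
  have "(\<exists>x. sat_on M UNIV (x # e) v \<phi>) \<longrightarrow> (\<exists>x\<in>N. sat_on M UNIV (x # e) v \<phi>)"
  proof
    assume "\<exists>x. sat_on M UNIV (x # e) v \<phi>"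
    then obtain x where "sat_on M UNIV (x # e) v \<phi>" ..
    then have "(\<lambda>_. x) \<in> {u. holds M u ?\<psi>}" using h by simp
    then have "{u. holds M u ?\<psi>} \<noteq> {}" by blast
    with N[unfolded mdl_def, rule_format, OF Def_formula[OF \<psi>, of M]]
    obtain z where "z \<in> N" "(\<lambda>_. z) \<in> {u. holds M u ?\<psi>}" by metis
    then show "\<exists>x\<in>N. sat_on M UNIV (x # e) v \<phi>" using h by auto
  qed
  then show ?case using IH by auto
qed auto

lemma mdl_elem_substructure:
  assumes N: "mdl N"
  shows "elem_substructure L M N"
proof -
  have "fun_int M f xs \<in> N" if f: "(f, length xs) \<in> Funs L" "set xs \<subseteq> N" for f xs
  proof -
    let ?\<phi> = "Eq (FVar (Inl ())) (App f (map (\<lambda>x. FVar (Inr x)) xs))"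
    have "?\<phi> \<in> formulas L UNIV N" using f by (auto simp: formulas_def list_all_iff)
    then have "{u. holds M u ?\<phi>} \<in> Def L M UNIV N" by (rule Def_formula)
    moreover have "{u. holds M u ?\<phi>} = {u. u () = fun_int M f xs}"
      by (simp add: holds_def sat_def comp_def)
    ultimately show ?thesis using N unfolding mdl_def by fastforce
  qed
  moreover have "sat_on M N [] v \<phi> = sat_on M UNIV [] v \<phi>"
    if "wf_fm L 0 \<phi>" "range v \<subseteq> N" for \<phi> :: "('f, 'r, nat) fm" and v
    by (rule mdl_sat_on[OF N that(1)]) (use that(2) in simp_all)
  ultimately show ?thesis using mdl_nonempty[OF N] unfolding elem_substructure_def by blast
qed

lemma elem_substructure_mdl:
  assumes N: "elem_substructure L M N"
  shows "mdl N"
  unfolding mdl_def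
proof (intro ballI impI)
  fix Y :: "(unit \<Rightarrow> 'a) set" assume Y: "Y \<in> Def L M UNIV N" "Y \<noteq> {}"
  obtain n0 where n0: "n0 \<in> N" using N by (auto simp: elem_substructure_def)
  obtain I0 :: "unit set" and B0 where B0: "finite B0" "B0 \<subseteq> N" "Y \<in> Def L M I0 B0"
    using Y(1) by (rule Def_finite)
  obtain \<phi> where \<phi>: "\<phi> \<in> formulas L I0 B0" "Y = {c. holds M c \<phi>}" using B0(3) by (rule DefE)
  obtain \<rho> :: "'a \<Rightarrow> nat" where \<rho>: "inj_on \<rho> B0" using B0(1) finite_imp_inj_to_nat_seg by metis
  \<comment> \<open>\<open>elem_substructure\<close> tests formulas in variables of type
    \<open>nat\<close>. Variable 0 takes the unknown and \<open>Suc (\<rho> b)\<close> the parameter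
    \<open>b\<close>; \<open>?v z\<close> assigns these values, with default \<open>n0\<close> in
    \<open>N\<close>.\<close>
  let ?f = "case_sum (\<lambda>_. 0) (\<lambda>b. Suc (\<rho> b)) :: unit + 'a \<Rightarrow> nat"
  let ?\<psi> = "map_fm ?f \<phi>"
  let ?v = "\<lambda>z. case_nat z (\<lambda>n. if n \<in> \<rho> ` B0 then inv_into B0 \<rho> n else n0)"
  let ?\<xi> = "\<lambda>n. if n = 0 then Inl 0 else Inr n"
  let ?\<chi> = "Exi (subst_fm (\<lambda>_. Inl 0) ?\<xi> ?\<psi>)"
  have wf: "wf_fm L 0 ?\<psi>" using \<phi>(1) by (simp add: wf_fm_map formulas_def)
  have wf': "wf_fm L 0 ?\<chi>" using wf by (auto intro!: wf_fm_subst split: if_splits)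
  have rng: "range (?v z) \<subseteq> N" if "z \<in> N" for z
    using that n0 B0(2) by (auto split: nat.split simp: subset_iff inv_into_into)
  have \<chi>: "sat_on M W [] (?v n0) ?\<chi> = (\<exists>z\<in>W. sat_on M W [] (?v z) ?\<psi>)" for W
  proof -
    have "sat_on M W [z] (?v n0) (subst_fm (\<lambda>_. Inl 0) ?\<xi> ?\<psi>) = sat_on M W [] (?v z) ?\<psi>" for z
      by (rule sat_on_subst[OF wf]) (auto split: nat.split)
    then show ?thesis by (simp only: sat_on.simps)
  qed
  have \<psi>: "sat_on M UNIV [] (?v z) ?\<psi> = holds M (\<lambda>_. z) \<phi>" for z
    unfolding holds_def sat_def sat_on_map
  proof (rule sat_on_cong)
    fix x assume "x \<in> fm_vars \<phi>"
    then have "x \<in> Inl ` I0 \<union> Inr ` B0" using \<phi>(1) unfolding formulas_def by blast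
    then show "(?v z \<circ> ?f) x = case_sum (\<lambda>_. z) id x" using \<rho> by auto
  qed
  have el: "sat_on M N [] v \<theta> = sat_on M UNIV [] v \<theta>"
    if "wf_fm L 0 \<theta>" "range v \<subseteq> N" for \<theta> :: "('f, 'r, nat) fm" and v
    using N that unfolding elem_substructure_def by blast
  obtain u where "u \<in> Y" using Y(2) by blast
  moreover have "u = (\<lambda>_. u ())" by (rule ext) simp
  ultimately have "holds M (\<lambda>_. u ()) \<phi>" using \<phi>(2) by simp
  then have "sat_on M UNIV [] (?v n0) ?\<chi>" unfolding \<chi> using \<psi> by blast
  then have "sat_on M N [] (?v n0) ?\<chi>" using el[OF wf' rng[OF n0]] by blast
  then obtain z where z: "z \<in> N" "sat_on M N [] (?v z) ?\<psi>" unfolding \<chi> by blast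
  then have "holds M (\<lambda>_. z) \<phi>" using el[OF wf rng[OF z(1)]] \<psi> by blast
  then show "\<exists>z\<in>N. (\<lambda>_. z) \<in> Y" using z(1) \<phi>(2) by blast
qed

end


section \<open>Dividing, forking and realisations\<close>

lemma finite_subset_image_Un:
  assumes "finite F" "F \<subseteq> f ` A \<union> B"
  obtains A0 where "finite A0" "A0 \<subseteq> A" "F \<subseteq> f ` A0 \<union> B"
proof -
  have "finite (F - B)" "F - B \<subseteq> f ` A" using assms by auto
  then obtain A0 where "A0 \<subseteq> A" "finite A0" "F - B = f ` A0" by (meson finite_subset_image)
  then show ?thesis using that[of A0] by blast
qed

lemma fip_Un_uminus:
  assumes "\<And>P0 Q0. finite P0 \<Longrightarrow> P0 \<subseteq> P \<Longrightarrow> finite Q0 \<Longrightarrow> Q0 \<subseteq> Q \<Longrightarrow> \<not> \<Inter>P0 \<subseteq> \<Union>Q0"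
  shows "fip (P \<union> uminus ` Q)"
  unfolding fip_def
proof (intro allI impI)
  fix F assume F: "finite F" "F \<subseteq> P \<union> uminus ` Q"
  then have "F \<subseteq> uminus ` Q \<union> P" by blast
  then obtain Q0 where Q0: "finite Q0" "Q0 \<subseteq> Q" "F \<subseteq> uminus ` Q0 \<union> P"
    using F(1) finite_subset_image_Un by metis
  have "\<not> \<Inter>(F \<inter> P) \<subseteq> \<Union>Q0" using F(1) Q0 by (intro assms) auto
  then obtain x where "x \<in> \<Inter>(F \<inter> P)" "x \<notin> \<Union>Q0" by blast
  then have "x \<in> \<Inter>F" using Q0(3) by blast
  then show "\<Inter>F \<noteq> {}" by blast
qed

lemma Def_ex_fibs:
  fixes W :: "('x + 'y \<Rightarrow> 'a) set" and \<tau> :: "nat \<Rightarrow> 'y \<Rightarrow> 'z"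
  assumes W: "W \<in> Def L M (I <+> J) B" and S: "finite S" and \<tau>: "\<And>i j. i \<in> S \<Longrightarrow> j \<in> J \<Longrightarrow> \<tau> i j \<in> K"
  shows "{v. \<exists>c. \<forall>i\<in>S. c \<in> fib W (\<lambda>j. v (\<tau> i j))} \<in> Def L M K B"
proof -
  let ?R = "\<lambda>i. {u :: 'z + 'x \<Rightarrow> 'a. (\<lambda>x. u (Inr x)) \<in> fib W (\<lambda>j. u (Inl (\<tau> i j)))}"
  have "?R i \<in> Def L M (K <+> I) B" if "i \<in> S" for i
  proof -
    have "{u :: 'z + 'x \<Rightarrow> 'a. (\<lambda>x. case_sum u id (case_sum (\<lambda>x. Inl (Inr x)) (\<lambda>j. Inl (Inl (\<tau> i j))) x)) \<in> W}
        \<in> Def L M (K <+> I) B"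
      by (rule Def_subst[OF W]) (use \<tau> that in auto)
    moreover have "(\<lambda>x. case_sum u id (case_sum (\<lambda>x. Inl (Inr x)) (\<lambda>j. Inl (Inl (\<tau> i j))) x)) =
        case_sum (\<lambda>x. u (Inr x)) (\<lambda>j. u (Inl (\<tau> i j)))" for u :: "'z + 'x \<Rightarrow> 'a"
      by (rule ext) (simp split: sum.split)
    ultimately show ?thesis by (simp add: mem_fib)
  qed
  then have "(\<Inter>i\<in>S. ?R i) \<in> Def L M (K <+> I) B" by (rule Def_INT[OF S])
  from Def_ex[OF this] show ?thesis by simp
qed

context monster_model
begin

text \<open>By homogeneity, realisations of a type over \<open>A\<close> are images under
  automorphisms fixing \<open>A\<close>. The bound \<open>k\<close> is kept visible because the rows
  required in \<open>Kim_lemma\<close>, taken over varying sets, must all be inconsistent for the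
  same \<open>k\<close>.\<close>

definition sdivk :: "nat \<Rightarrow> 'a set \<Rightarrow> ('x \<Rightarrow> 'a) set \<Rightarrow> bool" where
  "sdivk k A X \<longleftrightarrow> (\<exists>g :: nat \<Rightarrow> 'a \<Rightarrow> 'a. (\<forall>i. g i \<in> Aut L M A) \<and>
     (\<forall>S. finite S \<and> card S = k \<longrightarrow> (\<Inter>i\<in>S. act (g i) X) = {}))"

definition sdiv :: "'a set \<Rightarrow> ('x \<Rightarrow> 'a) set \<Rightarrow> bool" where
  "sdiv A X \<longleftrightarrow> (\<exists>k. sdivk k A X)"

definition sforks :: "'a set \<Rightarrow> 'x set \<Rightarrow> ('x \<Rightarrow> 'a) set \<Rightarrow> bool" where
  "sforks A I X \<longleftrightarrow> (\<exists>F. finite F \<and> F \<subseteq> Def L M I UNIV \<and> (\<forall>Y\<in>F. sdiv A Y) \<and> X \<subseteq> \<Union>F)"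

definition nonforking :: "'a set \<Rightarrow> 'x set \<Rightarrow> ('x \<Rightarrow> 'a) \<Rightarrow> 'a set \<Rightarrow> bool" where
  "nonforking A I a B \<longleftrightarrow> (\<forall>X\<in>Def L M I B. a \<in> X \<longrightarrow> \<not> sforks A I X)"

lemma sdivkI:
  fixes g :: "nat \<Rightarrow> 'a \<Rightarrow> 'a"
  shows "(\<And>i. g i \<in> Aut L M A) \<Longrightarrow> (\<And>S. finite S \<Longrightarrow> card S = k \<Longrightarrow> (\<Inter>i\<in>S. act (g i) X) = {}) \<Longrightarrow> sdivk k A X"
  unfolding sdivk_def by (intro exI[of _ g]) simp

lemma sdivkE:
  assumes "sdivk k A X"
  obtains g :: "nat \<Rightarrow> 'a \<Rightarrow> 'a" where "\<forall>i. g i \<in> Aut L M A"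
    "\<forall>S. finite S \<longrightarrow> card S = k \<longrightarrow> (\<Inter>i\<in>S. act (g i) X) = {}"
proof -
  from assms[unfolded sdivk_def] obtain g :: "nat \<Rightarrow> 'a \<Rightarrow> 'a"
    where "(\<forall>i. g i \<in> Aut L M A) \<and> (\<forall>S. finite S \<and> card S = k \<longrightarrow> (\<Inter>i\<in>S. act (g i) X) = {})" ..
  then show ?thesis using that[of g] by simp
qed

lemma sforksI:
  "finite F \<Longrightarrow> F \<subseteq> Def L M I UNIV \<Longrightarrow> (\<And>Y. Y \<in> F \<Longrightarrow> sdiv A Y) \<Longrightarrow> X \<subseteq> \<Union>F \<Longrightarrow> sforks A I X"
  unfolding sforks_def by (intro exI[of _ F]) simp

lemma sforksE:
  assumes "sforks A I X"
  obtains F where "finite F" "F \<subseteq> Def L M I UNIV" "\<forall>Y\<in>F. sdiv A Y" "X \<subseteq> \<Union>F"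
proof -
  from assms[unfolded sforks_def] obtain F
    where "finite F \<and> F \<subseteq> Def L M I UNIV \<and> (\<forall>Y\<in>F. sdiv A Y) \<and> X \<subseteq> \<Union>F" ..
  then show ?thesis using that[of F] by simp
qed

lemma sdivk_mono_base: "sdivk k B X \<Longrightarrow> A \<subseteq> B \<Longrightarrow> sdivk k A X"
  unfolding sdivk_def using Aut_mono[of A B L M] by blast

lemma sdivk_subset:
  assumes "sdivk k A X" "Y \<subseteq> X"
  shows "sdivk k A Y"
proof -
  obtain g :: "nat \<Rightarrow> 'a \<Rightarrow> 'a" where g0: "\<forall>i. g i \<in> Aut L M A" "\<forall>S. finite S \<longrightarrow> card S = k \<longrightarrow> (\<Inter>i\<in>S. act (g i) X) = {}"
    using assms(1) by (rule sdivkE)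
  note g = g0(1)[rule_format] g0(2)[rule_format]
  show ?thesis
  proof (rule sdivkI[OF g(1)])
    fix S :: "nat set" assume "finite S" "card S = k"
    moreover have "(\<Inter>i\<in>S. act (g i) Y) \<subseteq> (\<Inter>i\<in>S. act (g i) X)"
      using act_mono[OF assms(2)] by (intro INF_mono) blast
    ultimately show "(\<Inter>i\<in>S. act (g i) Y) = {}" using g(2) by (metis subset_empty)
  qed
qed

lemma sdivk_act:
  assumes f: "f \<in> Aut L M A" and X: "sdivk k A X"
  shows "sdivk k A (act f X)"
proof -
  obtain g :: "nat \<Rightarrow> 'a \<Rightarrow> 'a" where g0: "\<forall>i. g i \<in> Aut L M A" "\<forall>S. finite S \<longrightarrow> card S = k \<longrightarrow> (\<Inter>i\<in>S. act (g i) X) = {}"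
    using X by (rule sdivkE)
  note g = g0(1)[rule_format] g0(2)[rule_format]
  have "inv f \<circ> f = id" using Aut_bij[OF f] by (simp add: bij_is_inj)
  then have "act (g i \<circ> inv f) (act f X) = act (g i) X" for i
    by (metis act_act comp_assoc comp_id)
  then show ?thesis
    using g by (intro sdivkI[of "\<lambda>i. g i \<circ> inv f"]) (simp_all add: Aut_comp Aut_inv[OF f])
qed

lemma sdivk_reindex:
  assumes "sdivk k A X"
  shows "sdivk k A {c. (\<lambda>i. c (\<rho> i)) \<in> X}"
proof -
  obtain g :: "nat \<Rightarrow> 'a \<Rightarrow> 'a" where g0: "\<forall>i. g i \<in> Aut L M A" "\<forall>S. finite S \<longrightarrow> card S = k \<longrightarrow> (\<Inter>i\<in>S. act (g i) X) = {}"
    using assms by (rule sdivkE)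
  note g = g0(1)[rule_format] g0(2)[rule_format]
  have eq: "(\<Inter>i\<in>S. act (g i) {c. (\<lambda>i. c (\<rho> i)) \<in> X}) = {c. (\<lambda>i. c (\<rho> i)) \<in> (\<Inter>i\<in>S. act (g i) X)}" for S
    by (auto simp: act_reindex[OF Aut_bij[OF g(1)]])
  show ?thesis
  proof (rule sdivkI[of g])
    fix S :: "nat set" assume "finite S" "card S = k"
    from g(2)[OF this] show "(\<Inter>i\<in>S. act (g i) {c. (\<lambda>i. c (\<rho> i)) \<in> X}) = {}"
      unfolding eq by simp
  qed (rule g(1))
qed

lemma sdiv_UNIV: "\<not> sdiv A (UNIV :: ('x \<Rightarrow> 'a) set)"
proof
  assume "sdiv A (UNIV :: ('x \<Rightarrow> 'a) set)"
  then obtain k where "sdivk k A (UNIV :: ('x \<Rightarrow> 'a) set)" unfolding sdiv_def ..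
  then obtain g :: "nat \<Rightarrow> 'a \<Rightarrow> 'a" where g0: "\<forall>i. g i \<in> Aut L M A"
    "\<forall>S. finite S \<longrightarrow> card S = k \<longrightarrow> (\<Inter>i\<in>S. act (g i) (UNIV :: ('x \<Rightarrow> 'a) set)) = {}"
    by (rule sdivkE)
  note g = g0(1)[rule_format] g0(2)[rule_format]
  have "act (g i) (UNIV :: ('x \<Rightarrow> 'a) set) = UNIV" for i
    using mem_act[OF Aut_bij[OF g(1)]] by blast
  then show False using g(2)[of "{..<k}"] by simp
qed

lemma sforks_subset: "sforks A I X \<Longrightarrow> Y \<subseteq> X \<Longrightarrow> sforks A I Y"
  by (erule sforksE, rule sforksI) auto

lemma sforks_mono: "sforks A I X \<Longrightarrow> I \<subseteq> J \<Longrightarrow> sforks A J X"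
proof (erule sforksE)
  fix F assume "I \<subseteq> J" "finite F" "F \<subseteq> Def L M I UNIV" "\<forall>Y\<in>F. sdiv A Y" "X \<subseteq> \<Union>F"
  moreover from this have "F \<subseteq> Def L M J UNIV" by (intro subsetI Def_mono[of _ L M I UNIV J UNIV]) auto
  ultimately show ?thesis by (intro sforksI[of F]) simp_all
qed

lemma sdiv_imp_sforks: "X \<in> Def L M I UNIV \<Longrightarrow> sdiv A X \<Longrightarrow> sforks A I X"
  by (rule sforksI[of "{X}"]) simp_all

lemma sforks_Union:
  assumes "finite F" "\<And>X. X \<in> F \<Longrightarrow> sforks A I X"
  shows "sforks A I (\<Union>F)"
  using assms
proof (induction F rule: finite_induct)
  case empty
  show ?case by (rule sforksI[of "{}"]) simp_all
next
  case (insert X F)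
  have "sforks A I X" "sforks A I (\<Union>F)" using insert by simp_all
  obtain G where G: "finite G" "G \<subseteq> Def L M I UNIV" "\<forall>Y\<in>G. sdiv A Y" "X \<subseteq> \<Union>G"
    using \<open>sforks A I X\<close> by (rule sforksE)
  obtain G' where G': "finite G'" "G' \<subseteq> Def L M I UNIV" "\<forall>Y\<in>G'. sdiv A Y" "\<Union>F \<subseteq> \<Union>G'"
    using \<open>sforks A I (\<Union>F)\<close> by (rule sforksE)
  show ?case by (rule sforksI[of "G \<union> G'"]) (use G G' in auto)
qed

lemma sforks_reindex:
  assumes "sforks A I X"
  shows "sforks A (\<rho> ` I) {c. (\<lambda>i. c (\<rho> i)) \<in> X}"
proof -
  obtain F where F: "finite F" "F \<subseteq> Def L M I UNIV" "\<forall>Y\<in>F. sdiv A Y" "X \<subseteq> \<Union>F"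
    using assms by (rule sforksE)
  let ?f = "\<lambda>Y. {c. (\<lambda>i. c (\<rho> i)) \<in> Y}"
  show ?thesis
  proof (rule sforksI)
    show "finite (?f ` F)" using F(1) by simp
    show "{c. (\<lambda>i. c (\<rho> i)) \<in> X} \<subseteq> \<Union>(?f ` F)" using F(4) by auto
    show "?f ` F \<subseteq> Def L M (\<rho> ` I) UNIV" using F(2) Def_reindex by fast
    fix Y assume "Y \<in> ?f ` F"
    then obtain Z where Z: "Z \<in> F" "Y = ?f Z" by blast
    then obtain k where "sdivk k A Z" using F(3) unfolding sdiv_def by blast
    then show "sdiv A Y" unfolding Z(2) sdiv_def by (intro exI[of _ k] sdivk_reindex)
  qed
qed

text \<open>Compactness: non-forking says precisely that finitely many conditions of the type do not
  imply a finite disjunction of dividing formulas.\<close>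

lemma nonforking_ultra:
  assumes "nonforking A I a B"
  obtains U where "ultra U" "\<And>X. X \<in> Def L M I B \<Longrightarrow> a \<in> X \<Longrightarrow> X \<in> U"
    "\<And>X. X \<in> Def L M I UNIV \<Longrightarrow> sdiv A X \<Longrightarrow> X \<notin> U"
proof -
  let ?P = "{X \<in> Def L M I B. a \<in> X}" and ?Q = "{X \<in> Def L M I UNIV. sdiv A X}"
  have "fip (?P \<union> uminus ` ?Q)"
  proof (rule fip_Un_uminus)
    fix P Q assume P: "finite P" "P \<subseteq> ?P" and Q: "finite Q" "Q \<subseteq> ?Q"
    have "\<Inter>P \<in> Def L M I B" "a \<in> \<Inter>P" using P by (auto intro: Def_Inter)
    then have "\<not> sforks A I (\<Inter>P)" using assms unfolding nonforking_def by blast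
    moreover have "sforks A I (\<Inter>P)" if "\<Inter>P \<subseteq> \<Union>Q"
      by (rule sforksI[OF Q(1) _ _ that]) (use Q(2) in auto)
    ultimately show "\<not> \<Inter>P \<subseteq> \<Union>Q" by blast
  qed
  then obtain U where U: "ultra U" "?P \<union> uminus ` ?Q \<subseteq> U" by (rule ultra_extend)
  then show ?thesis using that[of U] ultra_Compl[OF U(1)] by blast
qed

lemma ultra_not_sforks:
  assumes "ultra U" "\<And>X. X \<in> Def L M I UNIV \<Longrightarrow> sdiv A X \<Longrightarrow> X \<notin> U" "X \<in> U"
  shows "\<not> sforks A I X"
proof
  assume "sforks A I X"
  then obtain F where F: "finite F" "F \<subseteq> Def L M I UNIV" "\<forall>Y\<in>F. sdiv A Y" "X \<subseteq> \<Union>F"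
    by (rule sforksE)
  then obtain Y where "Y \<in> F" "Y \<in> U" using ultra_Union[OF assms(1) F(1) assms(3) F(4)] by blast
  then show False using assms(2) F by blast
qed

section \<open>Realisations of ultrafilters over small sets\<close>

definition realizes :: "('x \<Rightarrow> 'a) set set \<Rightarrow> 'x set \<Rightarrow> 'a set \<Rightarrow> ('x \<Rightarrow> 'a) \<Rightarrow> bool" where
  "realizes U I B c \<longleftrightarrow> (\<forall>X\<in>Def L M I B. X \<in> U \<longrightarrow> c \<in> X)"

lemma realizes_iff:
  "ultra U \<Longrightarrow> realizes U I B c \<Longrightarrow> X \<in> Def L M I B \<Longrightarrow> c \<in> X \<longleftrightarrow> X \<in> U"
  unfolding realizes_def using Def_Compl[of X L M I B] ultra_Compl[of U X] by blast

lemma realizes_exists: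
  assumes "ultra U" "small I" "small B"
  obtains c where "realizes U I B c"
proof -
  have "\<Inter>(U \<inter> Def L M I B) \<noteq> {}"
  proof (rule saturation)
    show "fip (U \<inter> Def L M I B)" using assms(1) unfolding ultra_def fip_def by blast
  qed (use assms in auto)
  then show ?thesis using that unfolding realizes_def by blast
qed

lemma realizes_mono: "realizes U I C c \<Longrightarrow> B \<subseteq> C \<Longrightarrow> realizes U I B c"
  unfolding realizes_def using Def_mono[of _ L M I B I C] by blast

lemma realizes_cong:
  assumes "realizes U I B c" "\<And>X. X \<in> Def L M I B \<Longrightarrow> c \<in> X \<Longrightarrow> c' \<in> X"
  shows "realizes U I B c'"
  using assms unfolding realizes_def by blast

text \<open>If \<open>tp(e/Ad)\<close> contains nothing dividing over \<open>A\<close>, then a sequence witnessing that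
  \<open>W(x, d)\<close> divides over \<open>A\<close> can be chosen inside \<open>tp(d/Ae)\<close>.\<close>

lemma sdivk_transfer:
  fixes X :: "('x \<Rightarrow> 'a) set" and d :: "nat \<Rightarrow> 'a" and e :: "'z \<Rightarrow> 'a"
  assumes A: "small A" and E: "small E" and X: "X \<in> Def L M I (A \<union> range d)" and div: "sdivk k A X"
    and nd: "\<And>Y. Y \<in> Def L M E (A \<union> range d) \<Longrightarrow> e \<in> Y \<Longrightarrow> \<not> sdiv A Y"
  shows "sdivk k (A \<union> e ` E) X"
proof -
  obtain W where W: "W \<in> Def L M (I <+> (UNIV :: nat set)) A" "X = fib W d"
    using Def_params[OF X] .
  obtain g :: "nat \<Rightarrow> 'a \<Rightarrow> 'a" where g0: "\<forall>i. g i \<in> Aut L M A" "\<forall>S. finite S \<longrightarrow> card S = k \<longrightarrow> (\<Inter>i\<in>S. act (g i) X) = {}"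
    using div by (rule sdivkE)
  note g = g0(1)[rule_format] and gS = g0(2)[rule_format]
  \<comment> \<open>The unknowns are one copy of \<open>e\<close> and countably many rows in place
    of \<open>d\<close>. \<open>?F\<close> says that each row together with the copy has the type of
    \<open>e\<close> and \<open>d\<close> over \<open>A\<close>, and that the instances along the
    rows are \<open>k\<close>-inconsistent.\<close>
  let ?K = "E <+> (UNIV :: (nat \<times> nat) set)"
  let ?V = "\<lambda>(V, i). {v :: 'z + nat \<times> nat \<Rightarrow> 'a. case_sum (\<lambda>z. v (Inl z)) (\<lambda>j. v (Inr (i, j))) \<in> V}"
  let ?P = "{V \<in> Def L M (E <+> (UNIV :: nat set)) A. case_sum e d \<in> V}"
  let ?Q = "\<lambda>S. {v :: 'z + nat \<times> nat \<Rightarrow> 'a. \<exists>c. \<forall>i\<in>S. c \<in> fib W (\<lambda>j. v (Inr (i, j)))}"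
  let ?F = "?V ` (?P \<times> UNIV) \<union> {- ?Q S |S. finite S \<and> card S = k}"
  have "?V (V, i) \<in> Def L M ?K A" if "V \<in> ?P" for V i
  proof -
    let ?\<sigma> = "case_sum (\<lambda>z. Inl (Inl z)) (\<lambda>j. Inl (Inr (i, j)))"
    have "{v :: 'z + nat \<times> nat \<Rightarrow> 'a. (\<lambda>x. case_sum v id (?\<sigma> x)) \<in> V} \<in> Def L M ?K A"
      by (rule Def_subst[of V L M "E <+> UNIV" A]) (use that in auto)
    moreover have "(\<lambda>x. case_sum v id (?\<sigma> x)) = case_sum (\<lambda>z. v (Inl z)) (\<lambda>j. v (Inr (i, j)))"
      for v :: "'z + nat \<times> nat \<Rightarrow> 'a"
      by (rule ext) (simp split: sum.split)
    ultimately show ?thesis by simp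
  qed
  moreover have "- ?Q S \<in> Def L M ?K A" if "finite S" for S
    by (intro Def_Compl Def_ex_fibs[OF W(1) that]) (simp add: InrI)
  ultimately have "?F \<subseteq> Def L M ?K A" by auto
  moreover have "small (UNIV :: (nat \<times> nat) set)"
    using small_nat_Times[OF small_nat, of UNIV] by (simp add: UNIV_Times_UNIV)
  then have "small ?K" by (rule small_Plus[OF E])
  moreover have "fip ?F"
    unfolding fip_def
  proof (intro allI impI)
    fix F0 assume F0: "finite F0" "F0 \<subseteq> ?F"
    obtain T where T: "finite T" "T \<subseteq> ?P \<times> UNIV" "F0 \<subseteq> ?V ` T \<union> {- ?Q S |S. finite S \<and> card S = k}"
      using F0 by (rule finite_subset_image_Un)
    let ?P0 = "fst ` T"
    \<comment> \<open>\<open>n\<close> bounds the rows mentioned in \<open>T\<close>. The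
      conjunction of the conditions, taken at \<open>d\<close>, does not divide and so is not
      \<open>n\<close>-inconsistent along \<open>g\<close>: some \<open>n\<close> translates have a
      common point, which serves as the copy of \<open>e\<close>.\<close>
    obtain n where n: "\<And>V i. (V, i) \<in> T \<Longrightarrow> i < n"
      using finite_nat_set_iff_bounded[of "snd ` T"] T(1) by force
    let ?Z = "\<Inter>?P0"
    have Z: "?Z \<in> Def L M (E <+> UNIV) A" "case_sum e d \<in> ?Z"
      using T(1,2) by (auto intro!: Def_Inter)
    let ?Y = "fib ?Z d"
    have "?Y \<in> Def L M E (A \<union> range d)" using Z(1) by (rule Def_fib)
    moreover have "e \<in> ?Y" using Z(2) by (simp add: mem_fib)
    ultimately have "\<not> sdivk n A ?Y" using nd unfolding sdiv_def by blast
    then obtain S e' where S: "finite S" "card S = n" "e' \<in> (\<Inter>i\<in>S. act (g i) ?Y)"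
      using sdivkI[of g A n ?Y, OF g] by blast
    obtain s0 where s0: "bij_betw s0 {..<n} S"
      using S(1,2) by (metis card_lessThan finite_lessThan finite_same_card_bij)
    \<comment> \<open>Inconsistency has to be checked for rows from \<open>n\<close> on as well, so
      \<open>s\<close> is continued injectively with values above \<open>S\<close>.\<close>
    define s where "s i = (if i < n then s0 i else Suc (Max (insert 0 S) + i))" for i
    have big: "j \<le> Max (insert 0 S)" if "j \<in> S" for j using that S(1) by simp
    have sS: "s i \<in> S" if "i < n" for i using s0 that by (auto simp: s_def bij_betw_def)
    have inj: "inj s"
    proof (rule injI)
      fix i j assume eq: "s i = s j"
      show "i = j"
      proof (cases "i < n"; cases "j < n")
        assume "i < n" "j < n"
        then show ?thesis using eq s0 by (auto simp: s_def bij_betw_def inj_on_def)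
      next
        assume "i < n" "\<not> j < n"
        then show ?thesis using eq big[OF sS, of i] by (simp add: s_def)
      next
        assume "\<not> i < n" "j < n"
        then show ?thesis using eq big[OF sS, of j] by (simp add: s_def)
      next
        assume "\<not> i < n" "\<not> j < n"
        then show ?thesis using eq by (simp add: s_def)
      qed
    qed
    let ?v = "case_sum e' (\<lambda>(i, j). g (s i) (d j))"
    have "?v \<in> ?V (V, i)" if Vi: "(V, i) \<in> T" for V i
    proof -
      have "e' \<in> act (g (s i)) ?Y" using S(3) sS[OF n[OF Vi]] by blast
      then have "e' \<in> fib ?Z (\<lambda>j. g (s i) (d j))" using act_fib[OF g Z(1)] by simp
      then show ?thesis using Vi by (auto simp: mem_fib)
    qed
    moreover have "?v \<in> - ?Q S'" if S': "finite S'" "card S' = k" for S'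
    proof
      assume "?v \<in> ?Q S'"
      then obtain c where "\<forall>i\<in>S'. c \<in> fib W (\<lambda>j. g (s i) (d j))" by auto
      then have "c \<in> (\<Inter>i\<in>s ` S'. act (g i) X)" using act_fib[OF g W(1)] W(2) by simp
      moreover have "card (s ` S') = k" using S' inj by (metis card_image inj_on_subset subset_UNIV)
      ultimately show False using gS[of "s ` S'"] S'(1) by blast
    qed
    ultimately have "?v \<in> X" if "X \<in> F0" for X
      using subsetD[OF T(3) that] by (elim UnE imageE) (auto simp del: Compl_iff)
    then have "?v \<in> \<Inter>F0" by blast
    then show "\<Inter>F0 \<noteq> {}" by blast
  qed
  ultimately have "\<Inter>?F \<noteq> {}" by (rule saturation[OF _ _ A])
  then obtain v where v: "v \<in> \<Inter>?F" by blast
  define e' where "e' z = v (Inl z)" for z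
  define d' where "d' i j = v (Inr (i, j))" for i j
  have "\<exists>f\<in>Aut L M A. \<forall>x\<in>E <+> UNIV. f (case_sum e d x) = case_sum e' (d' i) x" for i
  proof (rule homogeneity[OF small_Plus[OF E small_nat] A])
    fix V assume "V \<in> Def L M (E <+> UNIV) A" "case_sum e d \<in> V"
    then have "?V (V, i) \<in> ?F" by blast
    then have "v \<in> ?V (V, i)" using v by blast
    then show "case_sum e' (d' i) \<in> V" by (simp add: e'_def[abs_def] d'_def[abs_def])
  qed
  then obtain f where f: "\<And>i. f i \<in> Aut L M A"
    "\<And>i x. x \<in> E <+> UNIV \<Longrightarrow> f i (case_sum e d x) = case_sum e' (d' i) x" by metis
  have fe: "f i (e z) = e' z" if "z \<in> E" for i z using f(2)[of "Inl z" i] that by auto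
  have fd: "f i (d j) = d' i j" for i j using f(2)[of "Inr j" i] by auto
  have b: "bij (f i)" for i using Aut_bij[OF f(1)] .
  \<comment> \<open>All \<open>f i\<close> send \<open>e\<close> to the same tuple
    \<open>e'\<close>, so undoing \<open>f 0\<close> afterwards gives automorphisms fixing
    \<open>e\<close>.\<close>
  define h where "h i = inv (f 0) \<circ> f i" for i
  have "h i \<in> Aut L M A" for i unfolding h_def by (intro Aut_comp Aut_inv f(1))
  moreover have "h i (e z) = e z" if "z \<in> E" for i z
    using fe[OF that, of i] fe[OF that, of 0] b by (simp add: h_def bij_is_inj inv_f_eq)
  ultimately have "h i \<in> Aut L M (A \<union> e ` E)" for i by (auto simp: Aut_def)
  moreover have "(\<Inter>i\<in>S. act (h i) X) = {}" if S: "finite S" "card S = k" for S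
  proof (rule ccontr)
    assume "(\<Inter>i\<in>S. act (h i) X) \<noteq> {}"
    then obtain c where c: "\<And>i. i \<in> S \<Longrightarrow> c \<in> act (h i) X" by blast
    have "(\<lambda>x. f 0 (c x)) \<in> fib W (d' i)" if "i \<in> S" for i
    proof -
      have "(\<lambda>x. f 0 (c x)) \<in> act (f 0) (act (h i) X)" using c[OF that] by (auto simp: act_def)
      moreover have "f 0 \<circ> h i = f i" using b by (auto simp: h_def fun_eq_iff bij_is_surj surj_f_inv_f)
      ultimately have "(\<lambda>x. f 0 (c x)) \<in> act (f i) (fib W d)" by (simp add: act_act W(2))
      then show ?thesis using act_fib[OF f(1) W(1), of i d] by (simp add: fd)
    qed
    then have "v \<in> ?Q S" by (auto simp: d'_def[abs_def])
    moreover have "- ?Q S \<in> ?F" using S by blast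
    then have "v \<in> - ?Q S" by (rule InterD[OF v])
    ultimately show False by blast
  qed
  ultimately show ?thesis by (rule sdivkI)
qed

section \<open>Morley sequences of invariant types\<close>


definition invariant :: "'a set \<Rightarrow> ('x \<Rightarrow> 'a) set set \<Rightarrow> bool" where
  "invariant N U \<longleftrightarrow> ultra U \<and> (\<forall>f\<in>Aut L M N. \<forall>X\<in>Def L M UNIV UNIV. X \<in> U \<longrightarrow> act f X \<in> U)"

lemma invariantD:
  "invariant N U \<Longrightarrow> ultra U"
  "invariant N U \<Longrightarrow> f \<in> Aut L M N \<Longrightarrow> X \<in> Def L M UNIV UNIV \<Longrightarrow> X \<in> U \<Longrightarrow> act f X \<in> U"
  unfolding invariant_def by simp_all

text \<open>The head of the list is the first element of the Morley sequence.\<close>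

primrec mor :: "(nat \<Rightarrow> 'a) set set \<Rightarrow> 'a set \<Rightarrow> (nat \<Rightarrow> 'a) list \<Rightarrow> bool" where
  "mor U B [] = True"
| "mor U B (c # s) = (realizes U UNIV B c \<and> mor U (B \<union> range c) s)"

lemma mor_mono: "mor U C s \<Longrightarrow> B \<subseteq> C \<Longrightarrow> mor U B s"
proof (induction s arbitrary: B C)
  case (Cons c s)
  have c: "realizes U UNIV C c" and s: "mor U (C \<union> range c) s" using Cons.prems(1) by simp_all
  have "mor U (B \<union> range c) s" using Cons.prems(2) by (intro Cons.IH[OF s]) blast
  moreover have "realizes U UNIV B c" using c Cons.prems(2) by (rule realizes_mono)
  ultimately show ?case by simp
qed simp

lemma mor_subseq:
  assumes "subseq t s" "mor U B s"
  shows "mor U B t"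
  using assms
proof (induction t s arbitrary: B rule: list_emb.induct)
  case (list_emb_Cons xs ys y)
  then show ?case using mor_mono[of U "B \<union> range y" ys B] by simp
qed simp_all

lemma realizes_act:
  assumes U: "invariant N U" and f: "f \<in> Aut L M N" and c: "realizes U UNIV B c"
  shows "realizes U UNIV (f ` B) (\<lambda>i. f (c i))"
  unfolding realizes_def
proof (intro ballI impI)
  fix X assume X: "X \<in> Def L M UNIV (f ` B)" "X \<in> U"
  have b: "bij f" by (rule Aut_bij[OF f])
  have "act (inv f) X \<in> Def L M UNIV (inv f ` f ` B)"
    by (rule Def_act[OF automorphism_inv[OF AutD(1)[OF f]] X(1)])
  moreover have "inv f ` f ` B = B" using b by (simp add: bij_is_inj image_image)
  moreover have "act (inv f) X \<in> U"
    by (rule invariantD(2)[OF U Aut_inv[OF f] Def_mono[OF X(1)] X(2)]) simp_all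
  ultimately have "c \<in> act (inv f) X" using c unfolding realizes_def by metis
  then show "(\<lambda>i. f (c i)) \<in> X"
    unfolding mem_act[OF bij_imp_bij_inv[OF b]] using b by (simp add: inv_inv_eq)
qed

lemma mor_act:
  assumes U: "invariant N U" and f: "f \<in> Aut L M N"
  shows "mor U B s \<Longrightarrow> mor U (f ` B) (map (\<lambda>c i. f (c i)) s)"
proof (induction s arbitrary: B)
  case (Cons c s)
  have "mor U (f ` (B \<union> range c)) (map (\<lambda>c i. f (c i)) s)" using Cons by simp
  moreover have "f ` (B \<union> range c) = f ` B \<union> range (\<lambda>i. f (c i))" by (simp add: image_Un image_image)
  ultimately show ?case using Cons.prems realizes_act[OF U f, of B c] by simp
qed simp

text \<open>One direction of back and forth: invariance carries the condition on the next element
  along \<open>g\<close>, and homogeneity over the image of \<open>B\<close> corrects its value.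
  Both \<open>B\<close> and \<open>g\<close> vary in the induction because each element joins the
  base of the later ones.\<close>

lemma mor_unique_aux:
  assumes U: "invariant N U"
  shows "small B \<Longrightarrow> N \<subseteq> B \<Longrightarrow> g \<in> Aut L M N \<Longrightarrow> mor U B s \<Longrightarrow> mor U (g ` B) t \<Longrightarrow>
    length s = length t \<Longrightarrow>
    \<exists>f\<in>Aut L M N. map (\<lambda>c i. f (c i)) s = t \<and> (\<forall>b\<in>B. f b = g b)"
proof (induction s arbitrary: B g t)
  case (Cons c s)
  then obtain c' t' where t: "t = c' # t'" "length s = length t'" by (cases t) auto
  have gc: "realizes U UNIV (g ` B) (\<lambda>i. g (c i))"
    using realizes_act[OF U Cons.prems(3), of B c] Cons.prems(4) by simp
  have c': "realizes U UNIV (g ` B) c'" using Cons.prems(5) t(1) by simp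
  have "\<exists>h\<in>Aut L M (g ` B). \<forall>i\<in>UNIV. h (g (c i)) = c' i"
  proof (rule homogeneity[OF small_nat small_image[OF Cons.prems(1)]])
    fix X assume "X \<in> Def L M UNIV (g ` B)" "(\<lambda>i. g (c i)) \<in> X"
    then show "c' \<in> X"
      using realizes_iff[OF invariantD(1)[OF U] gc] realizes_iff[OF invariantD(1)[OF U] c'] by blast
  qed
  then obtain h where h: "h \<in> Aut L M (g ` B)" "\<And>i. h (g (c i)) = c' i" by blast
  have NgB: "N \<subseteq> g ` B"
  proof
    fix n assume "n \<in> N"
    then have "g n = n" "n \<in> B" using AutD(2)[OF Cons.prems(3)] Cons.prems(2) by auto
    then show "n \<in> g ` B" by (metis imageI)
  qed
  have hg: "h \<circ> g \<in> Aut L M N" using h(1) Aut_mono[OF NgB] Cons.prems(3) by (blast intro: Aut_comp)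
  have hgB: "(h \<circ> g) b = g b" if "b \<in> B" for b using AutD(2)[OF h(1)] that by simp
  have "(h \<circ> g) ` (B \<union> range c) = g ` B \<union> range c'"
  proof -
    have "(h \<circ> g) ` B = g ` B" by (rule image_cong[OF refl hgB])
    moreover have "(h \<circ> g) ` range c = range c'" using h(2) by (simp add: image_image)
    ultimately show ?thesis by (simp only: image_Un)
  qed
  then have "\<exists>f\<in>Aut L M N. map (\<lambda>c i. f (c i)) s = t' \<and> (\<forall>b\<in>B \<union> range c. f b = (h \<circ> g) b)"
    using Cons.prems t small_range[of c]
    by (intro Cons.IH[OF _ _ hg]) (auto intro: small_Un[OF Cons.prems(1)])
  then obtain f where f: "f \<in> Aut L M N" "map (\<lambda>c i. f (c i)) s = t'"
    "\<And>b. b \<in> B \<union> range c \<Longrightarrow> f b = (h \<circ> g) b" by blast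
  have "(\<lambda>i. f (c i)) = c'" using f(3) h(2) by auto
  then show ?case using f t(1) hgB by (intro bexI[OF _ f(1)]) auto
qed auto

lemma mor_unique:
  assumes "invariant N U" "small N" "mor U N s" "mor U N t" "length s = length t"
  obtains f where "f \<in> Aut L M N" "map (\<lambda>c i. f (c i)) s = t"
  using mor_unique_aux[OF assms(1,2) order_refl Aut_id assms(3), of t] assms(4,5) by auto

lemma mor_exists:
  assumes "ultra U" "small B"
  obtains m :: "nat \<Rightarrow> nat \<Rightarrow> 'a" where "\<And>n. mor U B (map m [0..<n])"
proof -
  define F where "F C = (SOME c. realizes U UNIV C c)" for C
  define C where "C = rec_nat B (\<lambda>_ C. C \<union> range (F C))"
  have C0: "C 0 = B" and CS: "C (Suc i) = C i \<union> range (F (C i))" for i by (simp_all add: C_def)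
  have sm: "small (C i)" for i by (induction i) (simp_all add: C0 CS assms(2) small_Un small_range)
  have F: "realizes U UNIV (C i) (F (C i))" for i
  proof -
    obtain c where "realizes U UNIV (C i) c" by (rule realizes_exists[OF assms(1) small_nat sm])
    then show ?thesis unfolding F_def by (rule someI[of "realizes U UNIV (C i)"])
  qed
  have "mor U (C i) (map (\<lambda>i. F (C i)) [i..<i + n])" for i n
  proof (induction n arbitrary: i)
    case (Suc n)
    have "[i..<i + Suc n] = i # [Suc i..<Suc i + n]" by (simp add: upt_conv_Cons)
    then show ?case using F[of i] Suc[of "Suc i"] by (simp only: list.map mor.simps CS simp_thms)
  qed simp
  from this[of 0] show ?thesis using that[of "\<lambda>i. F (C i)"] by (simp add: C0)
qed


section \<open>Dependence and Morley sequences\<close>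

text \<open>Compactness turns finite shattering into shattering of the whole sequence. In
  \<open>has_IP\<close> the sequence comes first and the points that cut it second, so the variables
  of \<open>W\<close> change sides; those on the left in its finite support are renamed to
  numbers.\<close>

lemma not_shattered:
  fixes W :: "('x + nat \<Rightarrow> 'a) set" and m :: "nat \<Rightarrow> nat \<Rightarrow> 'a"
  assumes dep: "dependent L M" and W: "W \<in> Def L M (I <+> UNIV) {}"
    and shat: "\<And>n S. \<exists>x. \<forall>j<n. x \<in> fib W (m j) \<longleftrightarrow> j \<in> S"
  shows False
proof -
  obtain K0 B0 where K0: "finite K0" "K0 \<subseteq> I <+> UNIV" "B0 \<subseteq> {}" "W \<in> Def L M K0 B0"
    using W by (rule Def_finite)
  define I0 where "I0 = {x. Inl x \<in> K0}"
  have fin: "finite I0" using finite_vimageI[OF K0(1) inj_Inl] by (simp add: I0_def vimage_def)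
  have "K0 \<subseteq> I0 <+> UNIV"
  proof
    fix x assume "x \<in> K0"
    then show "x \<in> I0 <+> UNIV" by (cases x) (auto simp: I0_def)
  qed
  then have W0: "W \<in> Def L M (I0 <+> UNIV) {}" by (rule Def_mono[OF K0(4) _ K0(3)])
  let ?B = "range (\<lambda>(i, j). m i j)"
  have smB: "small ?B"
    using small_image[OF small_nat_Times[OF small_nat, of UNIV]] by (simp add: UNIV_Times_UNIV)
  have "\<exists>x. \<forall>j. x \<in> fib W (m j) \<longleftrightarrow> j \<in> S" for S
  proof -
    let ?f = "\<lambda>j. if j \<in> S then fib W (m j) else - fib W (m j)"
    have "fib W (m j) \<in> Def L M I0 ?B" for j
      by (rule Def_mono[OF Def_fib[OF W0]]) auto
    then have "?f j \<in> Def L M I0 ?B" for j by (cases "j \<in> S") (simp_all only: if_True if_False Def_Compl)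
    then have "range ?f \<subseteq> Def L M I0 ?B" by blast
    moreover have "fip (range ?f)"
      unfolding fip_def
    proof (intro allI impI)
      fix F0 assume "finite F0" "F0 \<subseteq> range ?f"
      then obtain J where J: "finite J" "F0 = ?f ` J" by (meson finite_subset_image)
      obtain n where n: "\<forall>j\<in>J. j < n" using J(1) unfolding finite_nat_set_iff_bounded ..
      obtain x where "\<forall>j<n. x \<in> fib W (m j) \<longleftrightarrow> j \<in> S" using shat by blast
      then have "x \<in> \<Inter>F0" using n by (auto simp: J(2))
      then show "\<Inter>F0 \<noteq> {}" by blast
    qed
    ultimately have "\<Inter>(range ?f) \<noteq> {}" using small_finite[OF fin] smB by (intro saturation)
    then obtain x where x: "\<And>j. x \<in> ?f j" by blast
    have "x \<in> fib W (m j) \<longleftrightarrow> j \<in> S" for j using x[of j] by (cases "j \<in> S") auto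
    then show ?thesis by blast
  qed
  then obtain xS where xS: "\<And>S j. xS S \<in> fib W (m j) \<longleftrightarrow> j \<in> S" by metis
  obtain \<phi> where \<phi>: "\<phi> \<in> formulas L (I0 <+> UNIV) {}" "W = {v. holds M v \<phi>}" using W0 by (rule DefE)
  obtain \<rho> :: "'x \<Rightarrow> nat" where \<rho>: "inj_on \<rho> I0" using finite_imp_inj_to_nat_seg[OF fin] by metis
  let ?f = "case_sum (case_sum (\<lambda>x. Inr (\<rho> x)) Inl) (\<lambda>_. Inl 0) :: ('x + nat) + 'a \<Rightarrow> nat + nat"
  let ?y = "\<lambda>S n. xS S (inv_into I0 \<rho> n)"
  have "sat M (case_sum (m i) (?y S)) (map_fm ?f \<phi>) \<longleftrightarrow> i \<in> S" for i S
  proof -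
    have "sat M (case_sum (m i) (?y S)) (map_fm ?f \<phi>) =
        sat_on M UNIV [] (case_sum (m i) (?y S) \<circ> ?f) \<phi>"
      by (simp only: sat_def sat_on_map)
    also have "\<dots> = sat_on M UNIV [] (case_sum (case_sum (xS S) (m i)) id) \<phi>"
    proof (rule sat_on_cong)
      fix z assume "z \<in> fm_vars \<phi>"
      then have "z \<in> Inl ` (I0 <+> UNIV)" using \<phi>(1) unfolding formulas_def by blast
      then show "(case_sum (m i) (?y S) \<circ> ?f) z = case_sum (case_sum (xS S) (m i)) id z"
        using \<rho> by auto
    qed
    also have "\<dots> \<longleftrightarrow> xS S \<in> fib W (m i)" by (simp add: mem_fib \<phi>(2) holds_def sat_def)
    finally show ?thesis by (simp only: xS)
  qed
  then have "has_IP M (map_fm ?f \<phi>)"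
    unfolding has_IP_def by (intro exI[of _ m] exI[of _ ?y] allI)
  moreover have "wf_fm L 0 (map_fm ?f \<phi>)" using \<phi>(1) by (simp add: wf_fm_map formulas_def)
  ultimately show False using dep unfolding dependent_def by blast
qed

text \<open>Taking the first member of the j-th pair if j is in S and the second otherwise gives a
  Morley sequence, hence a conjugate of the initial segment of one fixed sequence \<open>m\<close>.
  The image of \<open>x\<close> cuts that segment exactly in S, so arbitrarily long alternation
  would shatter \<open>m\<close>.\<close>

lemma no_alternation:
  fixes W :: "('x + nat \<Rightarrow> 'a) set"
  assumes dep: "dependent L M" and N: "small N" and U: "invariant N U"
    and W: "W \<in> Def L M (I <+> UNIV) {}"
    and alt: "\<And>n. \<exists>x ps. length ps = n \<and> (\<forall>(u, v)\<in>set ps. x \<in> fib W u \<and> x \<notin> fib W v) \<and>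
      (\<forall>bs. length bs = n \<longrightarrow> mor U N (map2 (\<lambda>(u, v) b. if b then u else v) ps bs))"
  shows False
proof -
  obtain m :: "nat \<Rightarrow> nat \<Rightarrow> 'a" where m: "\<And>n. mor U N (map m [0..<n])"
    using mor_exists[OF invariantD(1)[OF U] N] by blast
  show False
  proof (rule not_shattered[OF dep W])
    fix n S
    obtain x ps where ps: "length ps = n" "\<And>u v. (u, v) \<in> set ps \<Longrightarrow> x \<in> fib W u \<and> x \<notin> fib W v"
      "\<And>bs. length bs = n \<Longrightarrow> mor U N (map2 (\<lambda>(u, v) b. if b then u else v) ps bs)"
      using alt[of n] by blast
    let ?bs = "map (\<lambda>i. i \<in> S) [0..<n]"
    let ?ts = "map2 (\<lambda>(u, v) b. if b then u else v) ps ?bs"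
    have "mor U N ?ts" by (rule ps(3)) simp
    then obtain f where f: "f \<in> Aut L M N" "map (\<lambda>c i. f (c i)) ?ts = map m [0..<n]"
      using mor_unique[OF U N, of ?ts "map m [0..<n]"] m ps(1) by auto
    have "(\<lambda>i. f (x i)) \<in> fib W (m j) \<longleftrightarrow> j \<in> S" if j: "j < n" for j
    proof -
      have "m j = map (\<lambda>c i. f (c i)) ?ts ! j" using f(2) j by simp
      also have "\<dots> = (\<lambda>i. f ((?ts ! j) i))" using j ps(1) by simp
      finally have mj: "m j = (\<lambda>i. f ((?ts ! j) i))" .
      obtain u v where uv: "ps ! j = (u, v)" by fastforce
      then have "?ts ! j = (if j \<in> S then u else v)" using j ps(1) by simp
      moreover have "(u, v) \<in> set ps" using uv j ps(1) by (metis nth_mem)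
      ultimately have "x \<in> fib W (?ts ! j) \<longleftrightarrow> j \<in> S" using ps(2) by simp
      moreover have "f \<in> Aut L M {}" using f(1) Aut_mono[of "{}" N L M] by blast
      then have "fib W (m j) = act f (fib W (?ts ! j))" using act_fib[OF _ W] mj by metis
      ultimately show ?thesis using mem_act_image[OF bij_is_inj[OF Aut_bij[OF f(1)]]] by blast
    qed
    then show "\<exists>x. \<forall>j<n. x \<in> fib W (m j) \<longleftrightarrow> j \<in> S" by blast
  qed
qed

abbreviation incons :: "nat \<Rightarrow> ('x + nat \<Rightarrow> 'a) set \<Rightarrow> (nat \<Rightarrow> nat \<Rightarrow> 'a) \<Rightarrow> bool" where
  "incons k W h \<equiv> (\<forall>S. finite S \<longrightarrow> card S = k \<longrightarrow> (\<Inter>i\<in>S. fib W (h i)) = {})"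

text \<open>Stack the rows \<open>h\<close> on top of each other. A common point \<open>x\<close> of the instances along the first
  column lies outside some instance in every row, by \<open>k\<close>-inconsistency, and every choice of one
  entry per row is a Morley sequence: \<open>W\<close> would alternate.\<close>

lemma Kim_lemma:
  fixes W :: "('x + nat \<Rightarrow> 'a) set"
  assumes dep: "dependent L M" and N: "small N" and U: "invariant N U"
    and W: "W \<in> Def L M (I <+> UNIV) {}"
    and rows: "\<And>B. small B \<Longrightarrow> N \<subseteq> B \<Longrightarrow> \<exists>h. (\<forall>i. realizes U UNIV B (h i)) \<and> incons k W h"
  shows "\<exists>n. \<forall>s. mor U N s \<longrightarrow> length s = n \<longrightarrow> (\<Inter>c\<in>set s. fib W c) = {}"
proof (rule ccontr)
  assume *: "\<not> ?thesis"
  \<comment> \<open>Morley sequences of equal length are conjugate over \<open>N\<close>, so a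
    common point along one of them provides one along each.\<close>
  have con: "\<exists>x. \<forall>c\<in>set t. x \<in> fib W c" if t: "mor U N t" for t
  proof -
    from * obtain s where s: "mor U N s" "length s = length t" "(\<Inter>c\<in>set s. fib W c) \<noteq> {}" by blast
    then obtain x where x: "\<And>c. c \<in> set s \<Longrightarrow> x \<in> fib W c" by blast
    obtain f where f: "f \<in> Aut L M N" "map (\<lambda>c i. f (c i)) s = t"
      using mor_unique[OF U N s(1) t s(2)] .
    have f0: "f \<in> Aut L M {}" using f(1) Aut_mono[of "{}" N L M] by blast
    have "(\<lambda>i. f (x i)) \<in> fib W c" if "c \<in> set t" for c
    proof -
      have "c \<in> (\<lambda>c i. f (c i)) ` set s" using that unfolding f(2)[symmetric] by simp
      then obtain c0 where c0: "c0 \<in> set s" "c = (\<lambda>i. f (c0 i))" by blast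
      then have "(\<lambda>i. f (x i)) \<in> act f (fib W c0)" using x by (auto simp: act_def)
      then show ?thesis using act_fib[OF f0 W, of c0] c0(2) by simp
    qed
    then show ?thesis by blast
  qed
  \<comment> \<open>Each row realises \<open>U\<close> over all earlier rows entirely, so selecting
    one entry per row gives a Morley sequence whatever the selection.\<close>
  have stack: "\<exists>rs. length rs = n \<and> (\<forall>h\<in>set rs. incons k W h) \<and>
      (\<forall>ts. list_all2 (\<lambda>t h. t \<in> range h) ts rs \<longrightarrow> mor U B ts)" if "small B" "N \<subseteq> B" for n B
    using that
  proof (induction n arbitrary: B)
    case 0
    show ?case by (rule exI[of _ "[]"]) simp
  next
    case (Suc n)
    obtain h where h: "\<And>i. realizes U UNIV B (h i)" "incons k W h" using rows[OF Suc.prems] by blast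
    let ?B = "B \<union> range (\<lambda>(i, j). h i j)"
    have "small (range (\<lambda>(i, j). h i j))"
      using small_image[OF small_nat_Times[OF small_nat, of UNIV]] by (simp add: UNIV_Times_UNIV)
    then have "small ?B" "N \<subseteq> ?B" using Suc.prems by (auto intro: small_Un)
    from Suc.IH[OF this] obtain rs where "length rs = n \<and> (\<forall>h\<in>set rs. incons k W h) \<and>
      (\<forall>ts. list_all2 (\<lambda>t h. t \<in> range h) ts rs \<longrightarrow> mor U ?B ts)" ..
    then have rs: "length rs = n" "\<forall>h\<in>set rs. incons k W h"
      "\<And>ts. list_all2 (\<lambda>t h. t \<in> range h) ts rs \<Longrightarrow> mor U ?B ts" by simp_all
    have "mor U B ts" if ts: "list_all2 (\<lambda>t h. t \<in> range h) ts (h # rs)" for ts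
    proof -
      obtain t ts' where t: "ts = t # ts'" "t \<in> range h" "list_all2 (\<lambda>t h. t \<in> range h) ts' rs"
        using ts by (auto simp: list_all2_Cons2)
      have "B \<union> range t \<subseteq> ?B" using t(2) by auto
      then have "mor U (B \<union> range t) ts'" by (rule mor_mono[OF rs(3)[OF t(3)]])
      then show ?thesis using t(1,2) h(1) by auto
    qed
    then show ?case using rs(1,2) h(2) by (intro exI[of _ "h # rs"]) simp
  qed
  show False
  proof (rule no_alternation[OF dep N U W])
    fix n
    from stack[OF N order_refl, of n] obtain rs where rs': "length rs = n \<and> (\<forall>h\<in>set rs. incons k W h) \<and>
      (\<forall>ts. list_all2 (\<lambda>t h. t \<in> range h) ts rs \<longrightarrow> mor U N ts)" ..
    then have rs: "length rs = n" "\<And>h. h \<in> set rs \<Longrightarrow> incons k W h"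
      "\<And>ts. list_all2 (\<lambda>t h. t \<in> range h) ts rs \<Longrightarrow> mor U N ts" by simp_all
    have "mor U N (map (\<lambda>h. h 0) rs)" by (rule rs(3)) (simp add: list_all2_conv_all_nth)
    from con[OF this] obtain x where x: "\<And>h. h \<in> set rs \<Longrightarrow> x \<in> fib W (h 0)" by auto
    have "\<exists>i. x \<notin> fib W (h i)" if "h \<in> set rs" for h
    proof -
      have "(\<Inter>i\<in>{..<k}. fib W (h i)) = {}" using rs(2)[OF that] by simp
      then show ?thesis by blast
    qed
    then obtain j where j: "\<And>h. h \<in> set rs \<Longrightarrow> x \<notin> fib W (h (j h))" by metis
    let ?ps = "map (\<lambda>h. (h 0, h (j h))) rs"
    have "mor U N (map2 (\<lambda>(u, v) b. if b then u else v) ?ps bs)" if "length bs = n" for bs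
      by (rule rs(3)) (use that rs(1) in \<open>simp add: list_all2_conv_all_nth\<close>)
    then show "\<exists>x ps. length ps = n \<and> (\<forall>(u, v)\<in>set ps. x \<in> fib W u \<and> x \<notin> fib W v) \<and>
      (\<forall>bs. length bs = n \<longrightarrow> mor U N (map2 (\<lambda>(u, v) b. if b then u else v) ps bs))"
      using x j rs(1) by (intro exI[of _ x] exI[of _ ?ps]) auto
  qed
qed


section \<open>Coheirs\<close>

lemma coheir_exists:
  fixes d :: "'x \<Rightarrow> 'a"
  assumes N: "mdl N"
  obtains U where "ultra U" "{c. range c \<subseteq> N} \<in> U" "\<And>X. X \<in> Def L M UNIV N \<Longrightarrow> d \<in> X \<Longrightarrow> X \<in> U"
proof -
  let ?P = "{X \<in> Def L M UNIV N. d \<in> X}"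
  have "fip (insert {c. range c \<subseteq> N} ?P)"
    unfolding fip_def
  proof (intro allI impI)
    fix F0 assume F0: "finite F0" "F0 \<subseteq> insert {c. range c \<subseteq> N} ?P"
    then have "\<Inter>(F0 \<inter> ?P) \<in> Def L M UNIV N" "d \<in> \<Inter>(F0 \<inter> ?P)" by (auto intro!: Def_Inter)
    then obtain c where "c \<in> \<Inter>(F0 \<inter> ?P)" "range c \<subseteq> N" using mdl_point[OF N] by blast
    then have "c \<in> \<Inter>F0" using F0(2) by blast
    then show "\<Inter>F0 \<noteq> {}" by blast
  qed
  then obtain U where "ultra U" "insert {c. range c \<subseteq> N} ?P \<subseteq> U" by (rule ultra_extend)
  then show ?thesis using that[of U] by blast
qed

text \<open>Automorphisms over \<open>N\<close> fix every assignment with values in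
  \<open>N\<close>, so \<open>X\<close> and its translate agree on a member of
  \<open>U\<close>.\<close>

lemma coheir_invariant:
  fixes U :: "('x \<Rightarrow> 'a) set set"
  assumes U: "ultra U" "{c. range c \<subseteq> N} \<in> U"
  shows "invariant N U"
  unfolding invariant_def
proof (intro conjI ballI impI)
  fix f and X :: "('x \<Rightarrow> 'a) set" assume f: "f \<in> Aut L M N" and X: "X \<in> U"
  have "X \<inter> {c. range c \<subseteq> N} \<subseteq> act f X"
  proof
    fix c assume c: "c \<in> X \<inter> {c. range c \<subseteq> N}"
    then have "(\<lambda>i. f (c i)) = c" using AutD(2)[OF f] by (intro ext) (simp add: image_subset_iff)
    then show "c \<in> act f X" using c unfolding act_def by (intro image_eqI[where x = c]) simp_all
  qed
  then show "act f X \<in> U" by (rule ultra_superset[OF U(1) ultra_Int[OF U(1) X U(2)]])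
qed (rule U(1))

text \<open>A point of \<open>X\<close> with values in \<open>N\<close> lies in all translates of
  \<open>X\<close> over \<open>N\<close> at once.\<close>

lemma coheir_not_sdiv:
  fixes U :: "('x \<Rightarrow> 'a) set set"
  assumes U: "ultra U" "{c. range c \<subseteq> N} \<in> U" and X: "sdiv N X"
  shows "X \<notin> U"
proof
  assume "X \<in> U"
  then have "X \<inter> {c. range c \<subseteq> N} \<in> U" by (rule ultra_Int[OF U(1) _ U(2)])
  then obtain c where c: "c \<in> X" "range c \<subseteq> N" using ultra_nonempty[OF U(1)] by blast
  obtain k where "sdivk k N X" using X unfolding sdiv_def ..
  then obtain g :: "nat \<Rightarrow> 'a \<Rightarrow> 'a" where g: "\<forall>i. g i \<in> Aut L M N"
    "\<forall>S. finite S \<longrightarrow> card S = k \<longrightarrow> (\<Inter>i\<in>S. act (g i) X) = {}" by (rule sdivkE)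
  have "c \<in> act (g i) X" for i
  proof -
    have "(\<lambda>j. g i (c j)) = c"
      using AutD(2)[OF g(1)[rule_format]] c(2) by (intro ext) (simp add: image_subset_iff)
    then show ?thesis using c(1) unfolding act_def by (intro image_eqI[where x = c]) simp_all
  qed
  then have "c \<in> (\<Inter>i\<in>{..<k}. act (g i) X)" by blast
  then show False using g(2)[rule_format, of "{..<k}"] by simp
qed

text \<open>The ultrafilter \<open>V\<close> lives on sequences of tuples; all coordinates of such a sequence have the
  same trace on the definable sets. It exists by the pigeonhole principle, applied to a long finite
  sequence in \<open>N\<close>.\<close>

lemma dividing_coheir:
  fixes W :: "('x + nat \<Rightarrow> 'a) set" and d :: "nat \<Rightarrow> 'a"
  assumes N: "mdl N" "small N" and W: "W \<in> Def L M (I <+> UNIV) {}" and div: "sdivk k N (fib W d)"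
  obtains U where "invariant N U" "\<And>X. X \<in> Def L M UNIV N \<Longrightarrow> d \<in> X \<Longrightarrow> X \<in> U"
    "\<And>B. small B \<Longrightarrow> N \<subseteq> B \<Longrightarrow> \<exists>h. (\<forall>i. realizes U UNIV B (h i)) \<and> incons k W h"
proof -
  obtain g :: "nat \<Rightarrow> 'a \<Rightarrow> 'a" where g0: "\<forall>i. g i \<in> Aut L M N"
    "\<forall>S. finite S \<longrightarrow> card S = k \<longrightarrow> (\<Inter>i\<in>S. act (g i) (fib W d)) = {}" using div by (rule sdivkE)
  note g = g0(1)[rule_format] and gS = g0(2)[rule_format]
  have g_empty: "g i \<in> Aut L M {}" for i using g Aut_mono[of "{}" N L M] by blast
  let ?c = "\<lambda>(v :: nat \<times> nat \<Rightarrow> 'a) i j. v (i, j)"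
  let ?V = "\<lambda>i X. {v. ?c v i \<in> X}"
  let ?Q = "\<lambda>S. {v :: nat \<times> nat \<Rightarrow> 'a. \<exists>c. \<forall>i\<in>S. c \<in> fib W (?c v i)}"
  let ?E = "\<lambda>(X, i). {v. ?c v i \<in> X \<longleftrightarrow> ?c v 0 \<in> X}"
  let ?P = "{X \<in> Def L M UNIV N. d \<in> X}"
  let ?Qs = "{- ?Q S |S. finite S \<and> card S = k}"
  \<comment> \<open>Four requirements on the rows: each satisfies the type of \<open>d\<close> over
    \<open>N\<close>; all have the same trace on the definable sets; the instances along them are
    \<open>k\<close>-inconsistent; all entries lie in \<open>N\<close>. The last one makes the trace
    of a row a coheir.\<close>
  let ?F = "case_prod (\<lambda>X i. ?V i X) ` (?P \<times> UNIV) \<union> (?E ` (Def L M UNIV UNIV \<times> UNIV) \<union>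
    (?Qs \<union> {{v. range v \<subseteq> N}}))"
  have V_Def: "?V i X \<in> Def L M ({i} \<times> UNIV) B" if "X \<in> Def L M UNIV B" for i X B
  proof -
    have "{v. (\<lambda>j. v (i, j)) \<in> X} \<in> Def L M (Pair i ` UNIV) B" using Def_reindex[OF that] .
    then show ?thesis by (rule Def_mono) auto
  qed
  have Q_Def: "?Q S \<in> Def L M UNIV {}" if "finite S" for S
    by (rule Def_ex_fibs[OF W that]) simp
  have "fip ?F"
    unfolding fip_def
  proof (intro allI impI)
    fix F0 assume F0: "finite F0" "F0 \<subseteq> ?F"
    obtain T where T: "finite T" "T \<subseteq> ?P \<times> UNIV"
      "F0 \<subseteq> case_prod (\<lambda>X i. ?V i X) ` T \<union> (?E ` (Def L M UNIV UNIV \<times> UNIV) \<union> (?Qs \<union> {{v. range v \<subseteq> N}}))"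
      using F0 by (rule finite_subset_image_Un)
    have "F0 \<subseteq> ?E ` (Def L M UNIV UNIV \<times> UNIV) \<union>
        (case_prod (\<lambda>X i. ?V i X) ` T \<union> (?Qs \<union> {{v. range v \<subseteq> N}}))"
      using T(3) by (subst Un_left_commute)
    with F0(1) obtain T' where T': "finite T'" "T' \<subseteq> Def L M UNIV UNIV \<times> UNIV"
      "F0 \<subseteq> ?E ` T' \<union> (case_prod (\<lambda>X i. ?V i X) ` T \<union> (?Qs \<union> {{v. range v \<subseteq> N}}))"
      by (rule finite_subset_image_Un)
    define Qf where "Qf = (\<Union>S\<in>{S. finite S \<and> card S = k \<and> - ?Q S \<in> F0}. {- ?Q S})"
    have Qfin: "finite Qf" using F0(1) by (rule finite_subset[rotated]) (auto simp: Qf_def)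
    have "\<forall>Y\<in>Qf. \<exists>S. finite S \<and> card S = k \<and> Y = - ?Q S" unfolding Qf_def by blast
    from bchoice[OF this] obtain SY
      where SY': "\<forall>Y\<in>Qf. finite (SY Y) \<and> card (SY Y) = k \<and> Y = - ?Q (SY Y)" ..
    note SY = SY'[rule_format]
    have "finite (snd ` T \<union> (snd ` T' \<union> {0}) \<union> (\<Union>Y\<in>Qf. SY Y))" using T(1) T'(1) Qfin SY by auto
    then obtain n where n': "\<forall>i\<in>snd ` T \<union> (snd ` T' \<union> {0}) \<union> (\<Union>Y\<in>Qf. SY Y). i < n"
      unfolding finite_nat_set_iff_bounded ..
    note n = n'[rule_format]
    let ?Xs = "fst ` T'"
    \<comment> \<open>A row determines the subset of \<open>?Xs\<close> of those sets that contain
      it, so among \<open>n * 2 ^ card ?Xs\<close> rows some \<open>n\<close> have the same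
      pattern.\<close>
    let ?K = "n * 2 ^ card ?Xs"
    let ?Z = "\<Inter>(fst ` T)"
    have Z: "?Z \<in> Def L M UNIV N" "d \<in> ?Z" using T(1,2) by (auto intro!: Def_Inter)
    let ?R = "(\<Inter>i\<in>{..<?K}. ?V i ?Z) \<inter> (\<Inter>S\<in>{S. S \<subseteq> {..<?K} \<and> card S = k}. - ?Q S)"
    have R_Def: "?R \<in> Def L M UNIV N"
    proof (intro Def_Int Def_INT)
      show "?V i ?Z \<in> Def L M UNIV N" for i by (rule Def_mono[OF V_Def[OF Z(1)]]) simp_all
      show "finite {S. S \<subseteq> {..<?K} \<and> card S = k}" by simp
      show "- ?Q S \<in> Def L M UNIV N" if "S \<in> {S. S \<subseteq> {..<?K} \<and> card S = k}" for S
        by (rule Def_mono[OF Def_Compl[OF Q_Def]]) (use that finite_subset in auto)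
    qed simp
    \<comment> \<open>The translates of \<open>d\<close> need not lie in \<open>N\<close>. What is
      required of finitely many of them is definable over \<open>N\<close>, however, and is
      therefore realised by rows \<open>v\<close> in \<open>N\<close>.\<close>
    have "(\<lambda>(i, j). g i (d j)) \<in> ?R"
    proof
      show "(\<lambda>(i, j). g i (d j)) \<in> (\<Inter>i\<in>{..<?K}. ?V i ?Z)"
        using Aut_mem_iff[OF g Z(1)] Z(2) by auto
      show "(\<lambda>(i, j). g i (d j)) \<in> (\<Inter>S\<in>{S. S \<subseteq> {..<?K} \<and> card S = k}. - ?Q S)"
      proof (intro INT_I ComplI)
        fix S assume S: "S \<in> {S. S \<subseteq> {..<?K} \<and> card S = k}" "(\<lambda>(i, j). g i (d j)) \<in> ?Q S"
        from S(2) obtain c where "\<forall>i\<in>S. c \<in> fib W (\<lambda>j. g i (d j))" unfolding mem_Collect_eq prod.case ..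
        then have "c \<in> (\<Inter>i\<in>S. act (g i) (fib W d))" using act_fib[OF g_empty W] by simp
        moreover have "finite S" "card S = k" using S(1) finite_subset by auto
        ultimately show False using gS[of S] by simp
      qed
    qed
    then have "?R \<noteq> {}" by (metis empty_iff)
    from mdl_point[OF N(1) R_Def this] obtain v where v: "v \<in> ?R" "range v \<subseteq> N" by (rule bexE)
    let ?pat = "\<lambda>i. {X \<in> ?Xs. ?c v i \<in> X}"
    have finXs: "finite ?Xs" using T'(1) by simp
    have "\<exists>p\<in>Pow ?Xs. card (?pat -` {p} \<inter> {..<?K}) * card (Pow ?Xs) \<ge> card {..<?K}"
      by (rule pigeonhole_card) (use finXs in auto)
    then obtain p where p: "card (?pat -` {p} \<inter> {..<?K}) * card (Pow ?Xs) \<ge> card {..<?K}" by blast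
    have "n \<le> card (?pat -` {p} \<inter> {..<?K})" using p finXs by (simp add: card_Pow)
    then obtain J where J: "J \<subseteq> ?pat -` {p} \<inter> {..<?K}" "card J = n" "finite J"
      by (meson obtain_subset_with_card_n)
    obtain s where s: "bij_betw s {..<n} J"
      using J(2,3) by (metis card_lessThan finite_lessThan finite_same_card_bij)
    have sJ: "s i \<in> J" if "i < n" for i using s that by (auto simp: bij_betw_def)
    \<comment> \<open>The row numbers occurring in the selected conditions are below
      \<open>n\<close>; the remaining rows only have to take values in \<open>N\<close>.\<close>
    define w where "w = (\<lambda>(i, j). if i < n then v (s i, j) else v (0, j))"
    have wc: "?c w i = ?c v (s i)" if "i < n" for i using that by (auto simp: w_def)
    have "w \<in> Y" if Y: "Y \<in> F0" for Y
    proof -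
      have "Y \<in> ?E ` T' \<union> (case_prod (\<lambda>X i. ?V i X) ` T \<union> (?Qs \<union> {{v. range v \<subseteq> N}}))"
        using T'(3) Y by (rule subsetD)
      then consider X i where "(X, i) \<in> T'" "Y = ?E (X, i)" | X i where "(X, i) \<in> T" "Y = ?V i X"
        | "Y \<in> ?Qs" | "Y = {v. range v \<subseteq> N}" by auto
      then show ?thesis
      proof cases
        case (1 X i)
        have "i \<in> snd ` T'" using 1(1) by (rule image_eqI[rotated]) simp
        then have "i < n" "0 < n" using n[of i] n[of 0] by simp_all
        moreover have "X \<in> ?Xs" using 1(1) by (rule image_eqI[rotated]) simp
        moreover have "?pat (s i) = p" "?pat (s 0) = p" using J(1) sJ \<open>i < n\<close> \<open>0 < n\<close> by auto
        ultimately have "?c v (s i) \<in> X \<longleftrightarrow> ?c v (s 0) \<in> X" by blast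
        then show ?thesis using 1(2) wc[OF \<open>i < n\<close>] wc[OF \<open>0 < n\<close>] by simp
      next
        case (2 X i)
        have "i \<in> snd ` T" using 2(1) by (rule image_eqI[rotated]) simp
        then have "i < n" using n[of i] by simp
        have "s i < ?K" using sJ[OF \<open>i < n\<close>] J(1) by auto
        then have "?c v (s i) \<in> ?Z" using v(1) by auto
        then have "?c v (s i) \<in> X" using 2(1) by force
        then show ?thesis using 2(2) wc[OF \<open>i < n\<close>] by simp
      next
        case 3
        then have "Y \<in> Qf" using Y unfolding Qf_def by auto
        have "\<exists>S. finite S \<and> card S = k \<and> Y = - ?Q S \<and> (\<forall>i\<in>S. i < n)"
          using SY[OF \<open>Y \<in> Qf\<close>] n \<open>Y \<in> Qf\<close> by (intro exI[of _ "SY Y"] conjI ballI) (elim conjE, assumption, blast+)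
        then obtain S where S: "finite S" "card S = k" "Y = - ?Q S" "\<forall>i\<in>S. i < n" by (elim exE conjE)
        have "inj_on s S" using s S(4) by (auto simp: bij_betw_def inj_on_def)
        then have "card (s ` S) = k" using S(2) by (simp add: card_image)
        moreover have "s ` S \<subseteq> {..<?K}" using sJ S(4) J(1) by blast
        ultimately have "v \<in> - ?Q (s ` S)" using v(1) by blast
        moreover have "w \<in> ?Q S \<longleftrightarrow> v \<in> ?Q (s ` S)" using wc S(4) by simp
        ultimately show ?thesis unfolding S(3) by blast
      next
        case 4
        then show ?thesis using v(2) by (auto simp: w_def)
      qed
    qed
    then show "\<Inter>F0 \<noteq> {}" by blast
  qed
  then obtain V where V: "ultra V" "?F \<subseteq> V" by (rule ultra_extend)
  define U where "U = {X. ?V 0 X \<in> V}"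
  have U_ultra: "ultra U"
    using ultra_vimage[OF V(1), of "\<lambda>v. ?c v 0"] by (simp add: U_def vimage_def)
  have "{v. range v \<subseteq> N} \<in> V" using V(2) by blast
  then have "{c. range c \<subseteq> N} \<in> U"
    unfolding U_def by (auto intro: ultra_superset[OF V(1)])
  then have inv: "invariant N U" by (rule coheir_invariant[OF U_ultra])
  have dU: "X \<in> U" if "X \<in> Def L M UNIV N" "d \<in> X" for X
  proof -
    have "?V 0 X \<in> ?F" using that by (intro UnI1 image_eqI[of _ _ "(X, 0)"]) auto
    then have "?V 0 X \<in> V" by (rule subsetD[OF V(2)])
    then show ?thesis by (simp add: U_def)
  qed
  have rows: "\<exists>h. (\<forall>i. realizes U UNIV B (h i)) \<and> incons k W h" if B: "small B" "N \<subseteq> B" for B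
  proof -
    have "small (UNIV :: (nat \<times> nat) set)"
      using small_nat_Times[OF small_nat, of UNIV] by (simp add: UNIV_Times_UNIV)
    then obtain v where v: "realizes V UNIV B v" by (rule realizes_exists[OF V(1) _ B(1)])
    have r: "realizes U UNIV B (?c v i)" for i
      unfolding realizes_def
    proof (intro ballI impI)
      fix X assume X: "X \<in> Def L M UNIV B" "X \<in> U"
      have "X \<in> Def L M UNIV UNIV" by (rule Def_mono[OF X(1)]) simp_all
      then have "?E (X, i) \<in> ?F" by (intro UnI2 UnI1 image_eqI[of _ _ "(X, i)"]) auto
      then have "?E (X, i) \<in> V" by (rule subsetD[OF V(2)])
      moreover have "?V 0 X \<in> V" using X(2) unfolding U_def by simp
      ultimately have "?E (X, i) \<inter> ?V 0 X \<in> V" by (rule ultra_Int[OF V(1)])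
      then have "?V i X \<in> V" by (rule ultra_superset[OF V(1)]) auto
      moreover have "?V i X \<in> Def L M UNIV B" by (rule Def_mono[OF V_Def[OF X(1)]]) simp_all
      ultimately have "v \<in> ?V i X" using v unfolding realizes_def by blast
      then show "?c v i \<in> X" by simp
    qed
    have ic: "incons k W (?c v)"
    proof (intro allI impI)
      fix S :: "nat set" assume S: "finite S" "card S = k"
      have "- ?Q S \<in> ?F" using S by blast
      then have "- ?Q S \<in> V" by (rule subsetD[OF V(2)])
      moreover have "- ?Q S \<in> Def L M UNIV B" by (rule Def_mono[OF Def_Compl[OF Q_Def[OF S(1)]]]) simp_all
      ultimately have "v \<in> - ?Q S" by (intro v[unfolded realizes_def, rule_format])
      then have no: "\<nexists>c. \<forall>i\<in>S. c \<in> fib W (?c v i)" by (simp only: Compl_iff mem_Collect_eq not_False_eq_True)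
      show "(\<Inter>i\<in>S. fib W (?c v i)) = {}"
      proof (rule equals0I)
        fix c assume "c \<in> (\<Inter>i\<in>S. fib W (?c v i))"
        then have "\<forall>i\<in>S. c \<in> fib W (?c v i)" by (simp only: INT_iff)
        then show False using no by (elim notE, intro exI)
      qed
    qed
    show ?thesis by (rule exI[of _ "?c v"], rule conjI, rule allI, rule r, rule ic)
  qed
  show ?thesis
  proof (rule that[of U])
    show "invariant N U" by (rule inv)
    show "X \<in> U" if "X \<in> Def L M UNIV N" "d \<in> X" for X by (rule dU[OF that])
    show "\<exists>h. (\<forall>i. realizes U UNIV B (h i)) \<and> incons k W h" if "small B" "N \<subseteq> B" for B
      by (rule rows[OF that])
  qed
qed


section \<open>Forking implies quasi-dividing over models\<close>

lemma enumerate_params: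
  fixes F :: "('x \<Rightarrow> 'a) set set"
  assumes "finite F" "F \<subseteq> Def L M I UNIV"
  obtains d :: "nat \<Rightarrow> 'a" where "F \<subseteq> Def L M I (range d)"
proof -
  have "\<exists>B. finite B \<and> X \<in> Def L M I B" if "X \<in> F" for X
  proof -
    have "X \<in> Def L M I UNIV" using that assms(2) by blast
    then obtain I0 B0 where "finite B0" "I0 \<subseteq> I" "X \<in> Def L M I0 B0" by (rule Def_finite)
    then show ?thesis using Def_mono[of X L M I0 B0 I B0] by blast
  qed
  then obtain B where B: "\<And>X. X \<in> F \<Longrightarrow> finite (B X) \<and> X \<in> Def L M I (B X)" by metis
  let ?C = "insert undefined (\<Union>(B ` F))"
  have "finite ?C" using assms(1) B by simp
  then have r: "range (from_nat_into ?C) = ?C" by (intro range_from_nat_into countable_finite) simp_all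
  have "X \<in> Def L M I (range (from_nat_into ?C))" if "X \<in> F" for X
    unfolding r by (rule Def_mono[of X L M I "B X"]) (use B[OF that] that in auto)
  then show ?thesis using that by blast
qed

lemma Def_range_fib:
  fixes X :: "('x \<Rightarrow> 'a) set" and d :: "nat \<Rightarrow> 'a"
  assumes "X \<in> Def L M I (range d)"
  obtains W where "W \<in> Def L M (I <+> UNIV) {}" "X = fib W d"
proof -
  have "X \<in> Def L M I ({} \<union> d ` UNIV)" using assms by simp
  then show ?thesis by (rule Def_params) (rule that)
qed

lemma Aut_image: "f \<in> Aut L M N \<Longrightarrow> f ` N = N"
  using AutD(2)[of f L M N] by auto

lemma Aut_empty: "f \<in> Aut L M B \<Longrightarrow> f \<in> Aut L M {}"
  using Aut_mono[of "{}" B L M] by blast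

lemma realizes_type:
  assumes U: "ultra U" "\<And>X. X \<in> Def L M I N \<Longrightarrow> d \<in> X \<Longrightarrow> X \<in> U"
  shows "realizes U I N d"
  unfolding realizes_def using U(2)[OF Def_Compl] ultra_Compl[OF U(1)] by blast

text \<open>A tree argument: below every Morley sequence \<open>s\<close> of \<open>U l\<^sub>0\<close> found so far, a copy of the set
  constructed for the other colours is inserted, each element of which prolongs \<open>s\<close> to a longer Morley
  sequence of \<open>U l\<^sub>0\<close>.\<close>

lemma Morley_colouring:
  fixes U :: "'l \<Rightarrow> (nat \<Rightarrow> 'a) set set" and d :: "nat \<Rightarrow> 'a"
  assumes N: "small N" and "finite Ls" and inv: "\<And>l. l \<in> Ls \<Longrightarrow> invariant N (U l)"
    and tp: "\<And>l X. l \<in> Ls \<Longrightarrow> X \<in> Def L M UNIV N \<Longrightarrow> d \<in> X \<Longrightarrow> X \<in> U l"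
  shows "\<exists>F. finite F \<and> (\<forall>z\<in>F. \<exists>g\<in>Aut L M N. z = (\<lambda>i. g (d i))) \<and>
    (\<forall>Z. F \<subseteq> \<Union>(Z ` Ls) \<longrightarrow> (\<exists>l\<in>Ls. \<exists>s. mor (U l) N s \<and> length s = n l \<and> set s \<subseteq> Z l))"
  using assms(2) inv tp
proof (induction Ls rule: finite_induct)
  case empty
  have "\<exists>g\<in>Aut L M N. d = (\<lambda>i. g (d i))" by (rule bexI[OF _ Aut_id]) simp
  then show ?case by (intro exI[of _ "{d}"]) simp
next
  case (insert l0 Ls)
  note inv = insert.prems(1) and tp = insert.prems(2)
  let ?conj = "\<lambda>z. \<exists>g\<in>Aut L M N. z = (\<lambda>i. g (d i))"
  let ?P = "\<lambda>l Z. \<exists>s. mor (U l) N s \<and> length s = n l \<and> set s \<subseteq> Z l"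
  have "\<exists>F. finite F \<and> (\<forall>z\<in>F. ?conj z) \<and> (\<forall>Z. F \<subseteq> \<Union>(Z ` Ls) \<longrightarrow> (\<exists>l\<in>Ls. ?P l Z))"
    by (rule insert.IH) (use inv tp in simp_all)
  then obtain F1 where F1': "finite F1" "\<forall>z\<in>F1. ?conj z"
    "\<forall>Z. F1 \<subseteq> \<Union>(Z ` Ls) \<longrightarrow> (\<exists>l\<in>Ls. ?P l Z)" by (elim exE conjE)
  note F1 = F1'(1) F1'(2)[rule_format] F1'(3)[rule_format]
  have inv0: "invariant N (U l0)" by (rule inv) simp
  have z_real: "realizes (U l0) UNIV N z" if "?conj z" for z
  proof -
    obtain g where g: "g \<in> Aut L M N" "z = (\<lambda>i. g (d i))" using \<open>?conj z\<close> by (rule bexE)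
    have "realizes (U l0) UNIV N d"
      by (rule realizes_type[OF invariantD(1)[OF inv0]]) (rule tp, simp_all)
    then show ?thesis using realizes_act[OF inv0 g(1), of N d] Aut_image[OF g(1)] g(2) by simp
  qed
  \<comment> \<open>A Morley sequence \<open>?t\<close> over \<open>N\<close> and all of
    \<open>F1\<close> can be preceded by any element of \<open>F1\<close>, since each of them
    realises \<open>U l0\<close> over \<open>N\<close>. The automorphism taking \<open>?t\<close> to
    \<open>s\<close> carries this over to \<open>s\<close>.\<close>
  have copy: "\<exists>f\<in>Aut L M N. \<forall>z\<in>F1. mor (U l0) N ((\<lambda>i. f (z i)) # s)" if s: "mor (U l0) N s" for s
  proof -
    let ?B = "N \<union> (\<Union>z\<in>F1. range z)"
    have "small (\<Union>z\<in>F1. range z)"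
    proof -
      obtain e :: "nat \<Rightarrow> nat \<Rightarrow> 'a" where e: "F1 \<subseteq> range e"
        using subset_range_from_nat_into[OF countable_finite[OF F1(1)]] by blast
      have "(\<Union>z\<in>F1. range z) \<subseteq> (\<lambda>(i, j). e i j) ` (UNIV \<times> UNIV)" using e by fastforce
      moreover have "small ((\<lambda>(i, j). e i j) ` (UNIV \<times> UNIV))"
        by (rule small_image[OF small_nat_Times[OF small_nat]])
      ultimately show ?thesis by (rule small_subset)
    qed
    then have "small ?B" by (rule small_Un[OF N])
    then obtain m :: "nat \<Rightarrow> nat \<Rightarrow> 'a" where m: "\<And>n. mor (U l0) ?B (map m [0..<n])"
      by (rule mor_exists[OF invariantD(1)[OF inv0]]) blast
    let ?t = "map m [0..<length s]"
    have t: "mor (U l0) N ?t" by (rule mor_mono[OF m]) simp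
    obtain f where f: "f \<in> Aut L M N" "map (\<lambda>c i. f (c i)) ?t = s"
      using mor_unique[OF inv0 N t s] by auto
    have "mor (U l0) N ((\<lambda>i. f (z i)) # s)" if z: "z \<in> F1" for z
    proof -
      have "mor (U l0) (N \<union> range z) ?t" by (rule mor_mono[OF m]) (use z in auto)
      then have "mor (U l0) N (z # ?t)" using z_real[OF F1(2)[OF z]] by simp
      then have "mor (U l0) (f ` N) (map (\<lambda>c i. f (c i)) (z # ?t))" by (rule mor_act[OF inv0 f(1)])
      then show ?thesis unfolding Aut_image[OF f(1)] by (simp only: list.map(2) f(2))
    qed
    then show ?thesis using f(1) by blast
  qed
  have "\<exists>F. finite F \<and> (\<forall>z\<in>F. ?conj z) \<and> (\<forall>Z. F \<subseteq> \<Union>(Z ` insert l0 Ls) \<longrightarrow>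
      (\<exists>l\<in>Ls. ?P l Z) \<or> (\<exists>s. mor (U l0) N s \<and> length s = k \<and> set s \<subseteq> Z l0))" for k
  proof (induction k)
    case 0
    show ?case by (intro exI[of _ "{}"] conjI allI impI disjI2 exI[of _ "[]"]) simp_all
  next
    case (Suc k)
    then obtain F where F': "finite F" "\<forall>z\<in>F. ?conj z"
      "\<forall>Z. F \<subseteq> \<Union>(Z ` insert l0 Ls) \<longrightarrow>
        (\<exists>l\<in>Ls. ?P l Z) \<or> (\<exists>s. mor (U l0) N s \<and> length s = k \<and> set s \<subseteq> Z l0)"
      by (elim exE conjE)
    note F = F'(1) F'(2)[rule_format] F'(3)[rule_format]
    let ?T = "{s. set s \<subseteq> F \<and> length s = k}"
    have finT: "finite ?T" by (rule finite_lists_length_eq[OF F(1)])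
    have "\<forall>s. \<exists>f. mor (U l0) N s \<longrightarrow> f \<in> Aut L M N \<and> (\<forall>z\<in>F1. mor (U l0) N ((\<lambda>i. f (z i)) # s))"
      using copy by blast
    from choice[OF this] obtain f
      where f': "\<forall>s. mor (U l0) N s \<longrightarrow> f s \<in> Aut L M N \<and> (\<forall>z\<in>F1. mor (U l0) N ((\<lambda>i. f s (z i)) # s))" ..
    have f: "f s \<in> Aut L M N" "z \<in> F1 \<Longrightarrow> mor (U l0) N ((\<lambda>i. f s (z i)) # s)" if "mor (U l0) N s" for s z
      using f' that by simp_all
    let ?X = "\<lambda>s. (\<lambda>z i. f s (z i)) ` F1"
    let ?T' = "{s \<in> ?T. mor (U l0) N s}"
    let ?F = "F \<union> (\<Union>s\<in>?T'. ?X s)"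
    have "finite ?T'" by (rule finite_subset[OF _ finT]) blast
    then have "finite ?F" using F(1) F1(1) by blast
    moreover have "?conj z" if "z \<in> ?F" for z
      using that
    proof
      assume "z \<in> (\<Union>s\<in>?T'. ?X s)"
      then obtain s z1 where s: "mor (U l0) N s" "z1 \<in> F1" "z = (\<lambda>i. f s (z1 i))" by blast
      obtain g where g: "g \<in> Aut L M N" "z1 = (\<lambda>i. g (d i))" using F1(2)[OF s(2)] by (rule bexE)
      show ?thesis by (rule bexI[OF _ Aut_comp[OF f(1)[OF s(1)] g(1)]]) (simp add: s(3) g(2))
    qed (rule F(2))
    moreover have "(\<exists>l\<in>Ls. ?P l Z) \<or> (\<exists>s. mor (U l0) N s \<and> length s = Suc k \<and> set s \<subseteq> Z l0)"
      if Z: "?F \<subseteq> \<Union>(Z ` insert l0 Ls)" for Z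
    proof -
      \<comment> \<open>Intersecting the colour classes with \<open>F\<close> makes the sequence
        found a list over \<open>F\<close>, and for each such list a copy of \<open>F1\<close> was
        inserted.\<close>
      have "F \<subseteq> \<Union>((\<lambda>l. Z l \<inter> F) ` insert l0 Ls)" using Z by blast
      from F(3)[OF this] show ?thesis
      proof
        assume "\<exists>l\<in>Ls. ?P l (\<lambda>l. Z l \<inter> F)"
        then show ?thesis by blast
      next
        assume "\<exists>s. mor (U l0) N s \<and> length s = k \<and> set s \<subseteq> Z l0 \<inter> F"
        then obtain s where s: "mor (U l0) N s" "length s = k" "set s \<subseteq> Z l0" "set s \<subseteq> F" by blast
        then have sT: "s \<in> ?T'" by simp
        show ?thesis
        proof (cases "\<exists>z\<in>F1. (\<lambda>i. f s (z i)) \<in> Z l0")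
          case True
          then obtain z where z: "z \<in> F1" "(\<lambda>i. f s (z i)) \<in> Z l0" by (rule bexE)
          have "mor (U l0) N ((\<lambda>i. f s (z i)) # s)" by (rule f(2)[OF s(1) z(1)])
          then show ?thesis using s z by (intro disjI2 exI[of _ "(\<lambda>i. f s (z i)) # s"]) simp
        next
          case False
          \<comment> \<open>No element of the copy has colour \<open>l0\<close>, so the colouring
            pulled back to \<open>F1\<close> uses the other colours only. The Morley sequence found
            there is pushed forward by \<open>f s\<close>.\<close>
          let ?Z = "\<lambda>l. {z. (\<lambda>i. f s (z i)) \<in> Z l}"
          have "F1 \<subseteq> \<Union>(?Z ` Ls)"
          proof
            fix z assume z: "z \<in> F1"
            then have "(\<lambda>i. f s (z i)) \<in> \<Union>(Z ` insert l0 Ls)" using Z sT by blast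
            then show "z \<in> \<Union>(?Z ` Ls)" using False z by auto
          qed
          from F1(3)[OF this] obtain l t where t: "l \<in> Ls" "mor (U l) N t" "length t = n l" "set t \<subseteq> ?Z l"
            by blast
          have invl: "invariant N (U l)" by (rule inv) (simp add: t(1))
          have "mor (U l) (f s ` N) (map (\<lambda>c i. f s (c i)) t)" by (rule mor_act[OF invl f(1)[OF s(1)] t(2)])
          then have "mor (U l) N (map (\<lambda>c i. f s (c i)) t)" unfolding Aut_image[OF f(1)[OF s(1)]] .
          moreover have "set (map (\<lambda>c i. f s (c i)) t) \<subseteq> Z l" using t(4) by auto
          ultimately have "?P l Z" using t(3) by (intro exI[of _ "map (\<lambda>c i. f s (c i)) t"]) simp
          then show ?thesis using t(1) by blast
        qed
      qed
    qed
    ultimately show ?case by (intro exI[of _ ?F]) blast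
  qed
  from this[of "n l0"] obtain F where F: "finite F" "\<forall>z\<in>F. ?conj z"
    "\<forall>Z. F \<subseteq> \<Union>(Z ` insert l0 Ls) \<longrightarrow>
      (\<exists>l\<in>Ls. ?P l Z) \<or> (\<exists>s. mor (U l0) N s \<and> length s = n l0 \<and> set s \<subseteq> Z l0)" by (elim exE conjE)
  show ?case
  proof (intro exI[of _ F] conjI allI impI)
    fix Z assume "F \<subseteq> \<Union>(Z ` insert l0 Ls)"
    from F(3)[rule_format, OF this] show "\<exists>l\<in>insert l0 Ls. ?P l Z"
    proof
      assume "\<exists>l\<in>Ls. ?P l Z"
      then show ?thesis by (auto simp del: ex_simps)
    next
      assume "\<exists>s. mor (U l0) N s \<and> length s = n l0 \<and> set s \<subseteq> Z l0"
      then show ?thesis by (intro bexI[of _ l0]) simp_all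
    qed
  qed (rule F(1), rule F(2))
qed

text \<open>A common point of the conjugates colours each conjugate of \<open>d\<close> by a
  disjunct whose instance contains the point. Some colour then contains a Morley sequence long
  enough to make its disjunct inconsistent. Listing the parameters of all disjuncts in the single
  tuple \<open>d\<close> makes all the coheirs extend the same type, as the colouring
  requires.\<close>

lemma model_forking_quasi_divides:
  fixes X :: "('x \<Rightarrow> 'a) set"
  assumes dep: "dependent L M" and N: "mdl N" "small N" and X: "sforks N I X"
  shows "\<exists>G. finite G \<and> G \<subseteq> Aut L M N \<and> (\<Inter>g\<in>G. act g X) = {}"
proof -
  obtain F where F: "finite F" "F \<subseteq> Def L M I UNIV" "\<forall>Y\<in>F. sdiv N Y" "X \<subseteq> \<Union>F"
    using X by (rule sforksE)
  obtain d :: "nat \<Rightarrow> 'a" where d: "F \<subseteq> Def L M I (range d)" using enumerate_params[OF F(1,2)] .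
  have "\<exists>W U n. W \<in> Def L M (I <+> UNIV) {} \<and> Y = fib W d \<and> invariant N U \<and>
      (\<forall>X\<in>Def L M UNIV N. d \<in> X \<longrightarrow> X \<in> U) \<and>
      (\<forall>s. mor U N s \<longrightarrow> length s = n \<longrightarrow> (\<Inter>c\<in>set s. fib W c) = {})" if Y: "Y \<in> F" for Y
  proof -
    have "Y \<in> Def L M I (range d)" using d Y by (rule subsetD)
    then obtain W where W: "W \<in> Def L M (I <+> UNIV) {}" "Y = fib W d" by (rule Def_range_fib)
    obtain k where k: "sdivk k N (fib W d)" using F(3) Y W(2) unfolding sdiv_def by blast
    obtain U where U: "invariant N U" "\<And>X. X \<in> Def L M UNIV N \<Longrightarrow> d \<in> X \<Longrightarrow> X \<in> U"
      "\<And>B. small B \<Longrightarrow> N \<subseteq> B \<Longrightarrow> \<exists>h. (\<forall>i. realizes U UNIV B (h i)) \<and> incons k W h"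
      by (rule dividing_coheir[OF N W(1) k]) (rule that)
    obtain n where "\<forall>s. mor U N s \<longrightarrow> length s = n \<longrightarrow> (\<Inter>c\<in>set s. fib W c) = {}"
      using Kim_lemma[OF dep N(2) U(1) W(1) U(3)] by blast
    then show ?thesis using W U(1,2) by (intro exI[of _ W] exI[of _ U] exI[of _ n]) simp
  qed
  then have "\<forall>Y\<in>F. \<exists>t. case t of (W, U, n) \<Rightarrow> W \<in> Def L M (I <+> UNIV) {} \<and> Y = fib W d \<and> invariant N U \<and>
      (\<forall>X\<in>Def L M UNIV N. d \<in> X \<longrightarrow> X \<in> U) \<and>
      (\<forall>s. mor U N s \<longrightarrow> length s = n \<longrightarrow> (\<Inter>c\<in>set s. fib W c) = {})" by simp
  from bchoice[OF this] obtain t where t: "\<forall>Y\<in>F. case t Y of (W, U, n) \<Rightarrow>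
      W \<in> Def L M (I <+> UNIV) {} \<and> Y = fib W d \<and> invariant N U \<and>
      (\<forall>X\<in>Def L M UNIV N. d \<in> X \<longrightarrow> X \<in> U) \<and>
      (\<forall>s. mor U N s \<longrightarrow> length s = n \<longrightarrow> (\<Inter>c\<in>set s. fib W c) = {})" ..
  define W U n where "W Y = fst (t Y)" and "U Y = fst (snd (t Y))" and "n Y = snd (snd (t Y))" for Y
  have W: "W Y \<in> Def L M (I <+> UNIV) {}" "Y = fib (W Y) d" and U: "invariant N (U Y)"
    "\<And>X. X \<in> Def L M UNIV N \<Longrightarrow> d \<in> X \<Longrightarrow> X \<in> U Y"
    and n: "\<And>s. mor (U Y) N s \<Longrightarrow> length s = n Y \<Longrightarrow> (\<Inter>c\<in>set s. fib (W Y) c) = {}" if "Y \<in> F" for Y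
    using t[rule_format, OF that] by (simp_all only: W_def U_def n_def case_prod_beta simp_thms)
  obtain Fz where Fz: "finite Fz" "\<forall>z\<in>Fz. \<exists>g\<in>Aut L M N. z = (\<lambda>i. g (d i))"
    "\<forall>Z. Fz \<subseteq> \<Union>(Z ` F) \<longrightarrow> (\<exists>Y\<in>F. \<exists>s. mor (U Y) N s \<and> length s = n Y \<and> set s \<subseteq> Z Y)"
    using Morley_colouring[OF N(2) F(1), of U d n] U by blast
  from bchoice[of Fz "\<lambda>z g. g \<in> Aut L M N \<and> z = (\<lambda>i. g (d i))"] Fz(2)
  obtain g where g: "\<forall>z\<in>Fz. g z \<in> Aut L M N \<and> z = (\<lambda>i. g z (d i))" by blast
  have "(\<Inter>h\<in>g ` Fz. act h X) = {}"
  proof (rule equals0I)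
    fix x assume x: "x \<in> (\<Inter>h\<in>g ` Fz. act h X)"
    let ?Z = "\<lambda>Y. {z. x \<in> fib (W Y) z}"
    have "Fz \<subseteq> \<Union>(?Z ` F)"
    proof
      fix z assume z: "z \<in> Fz"
      then have "x \<in> act (g z) X" using x by blast
      then have "x \<in> (\<Union>Y\<in>F. act (g z) Y)" using act_mono[OF F(4), of "g z"] unfolding act_Union by blast
      then obtain Y where Y: "Y \<in> F" "x \<in> act (g z) Y" by blast
      have "g z \<in> Aut L M {}" using g z by (intro Aut_empty) blast
      then have "act (g z) (fib (W Y) d) = fib (W Y) (\<lambda>i. g z (d i))" by (rule act_fib[OF _ W(1)[OF Y(1)]])
      then have "x \<in> fib (W Y) (\<lambda>i. g z (d i))" using Y(2) W(2)[OF Y(1)] by (metis (no_types))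
      moreover have "z = (\<lambda>i. g z (d i))" using g z by blast
      ultimately have "x \<in> fib (W Y) z" by (metis (no_types))
      then show "z \<in> \<Union>(?Z ` F)" using Y(1) by blast
    qed
    from Fz(3)[rule_format, OF this] obtain Y s where
      s: "Y \<in> F" "mor (U Y) N s" "length s = n Y" "set s \<subseteq> ?Z Y" by blast
    then have "x \<in> (\<Inter>c\<in>set s. fib (W Y) c)" by blast
    then show False using n[OF s(1-3)] by simp
  qed
  moreover have "g ` Fz \<subseteq> Aut L M N" using g by blast
  ultimately show ?thesis using Fz(1) by (intro exI[of _ "g ` Fz"]) simp
qed


section \<open>Lascar invariance of non-forking types\<close>

lemma subseq_upt:
  assumes "sorted_wrt (<) js" "\<And>j. j \<in> set js \<Longrightarrow> j < n"
  shows "subseq js [0..<n]"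
proof -
  have "js = filter (\<lambda>i. i \<in> set js) [0..<n]"
  proof (rule sorted_distinct_set_unique)
    show "sorted js" "distinct js" using assms(1) by (simp_all add: strict_sorted_iff)
    show "set js = set (filter (\<lambda>i. i \<in> set js) [0..<n])" using assms(2) by auto
  qed (simp_all add: sorted_wrt_filter)
  then show ?thesis by (metis subseq_filter_left)
qed

lemma mor_strict_sorted:
  assumes m: "\<And>n. mor U B (map m [0..<n])" and "sorted_wrt (<) js"
  shows "mor U B (map m js)"
proof -
  obtain n where "\<forall>j\<in>set js. j < n" using finite_set[of js] unfolding finite_nat_set_iff_bounded ..
  then have "subseq js [0..<n]" using assms(2) by (intro subseq_upt) simp_all
  then show ?thesis by (intro mor_subseq[OF subseq_map m])
qed

text \<open>Otherwise "W(x, m 0) and not W(x, m 1)" belongs to \<open>U\<close>, hence does not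
  divide over \<open>A\<close>. For every n, some n of its conjugates along the consecutive pairs of
  \<open>m\<close> then have a common point, and this point alternates on n pairs.\<close>

lemma Lascar_step:
  fixes W :: "('x + nat \<Rightarrow> 'a) set" and m :: "nat \<Rightarrow> nat \<Rightarrow> 'a"
  assumes dep: "dependent L M" and N: "small N" "A \<subseteq> N" and V: "invariant N V"
    and W: "W \<in> Def L M (I <+> UNIV) {}"
    and U: "ultra U" "\<And>X. X \<in> Def L M I UNIV \<Longrightarrow> sdiv A X \<Longrightarrow> X \<notin> U"
    and m: "\<And>n. mor V N (map m [0..<n])" and W0: "fib W (m 0) \<in> U"
  shows "fib W (m 1) \<in> U"
proof (rule ccontr)
  assume "fib W (m 1) \<notin> U"
  let ?Y = "fib W (m 0) \<inter> - fib W (m 1)"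
  have "?Y \<in> U" using W0 \<open>fib W (m 1) \<notin> U\<close> U(1) by (intro ultra_Int) (simp_all add: ultra_Compl)
  have fD: "fib W c \<in> Def L M I UNIV" for c by (rule Def_mono[OF Def_fib[OF W]]) simp_all
  have "?Y \<in> Def L M I UNIV" by (intro Def_Int Def_Compl fD)
  then have nd: "\<not> sdiv A ?Y" using U(2) \<open>?Y \<in> U\<close> by blast
  have "\<exists>g\<in>Aut L M N. (\<lambda>j. g (m 0 j)) = m (2 * i) \<and> (\<lambda>j. g (m 1 j)) = m (2 * i + 1)" for i
  proof -
    have "mor V N (map m [0, 1])" "mor V N (map m [2 * i, 2 * i + 1])"
      by (rule mor_strict_sorted[OF m]; simp)+
    then obtain g where "g \<in> Aut L M N" "map (\<lambda>c j. g (c j)) (map m [0, 1]) = map m [2 * i, 2 * i + 1]"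
      by (rule mor_unique[OF V N(1)]) simp_all
    then show ?thesis by (intro bexI[of _ g]) simp_all
  qed
  then obtain g where g: "\<And>i. g i \<in> Aut L M N" "\<And>i. (\<lambda>j. g i (m 0 j)) = m (2 * i)"
    "\<And>i. (\<lambda>j. g i (m 1 j)) = m (2 * i + 1)" by metis
  have gY: "x \<in> act (g i) ?Y \<longleftrightarrow> x \<in> fib W (m (2 * i)) \<and> x \<notin> fib W (m (2 * i + 1))" for x i
  proof -
    have b: "bij (g i)" by (rule Aut_bij[OF g(1)])
    have "x \<in> act (g i) (fib W c) \<longleftrightarrow> x \<in> fib W (\<lambda>j. g i (c j))" for c
      using act_fib[OF Aut_empty[OF g(1)] W] by simp
    from this[of "m 0"] this[of "m 1"] show ?thesis by (simp add: mem_act[OF b] g(2) g(3)[unfolded One_nat_def])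
  qed
  show False
  proof (rule no_alternation[OF dep N(1) V W])
    fix n
    have "\<not> sdivk n A ?Y" using nd unfolding sdiv_def by blast
    moreover have "g i \<in> Aut L M A" for i using g(1) Aut_mono[OF N(2)] by blast
    ultimately have "\<exists>S. finite S \<and> card S = n \<and> (\<Inter>i\<in>S. act (g i) ?Y) \<noteq> {}"
      using sdivkI[of g A n ?Y] by blast
    then obtain S x where S: "finite S" "card S = n" "x \<in> (\<Inter>i\<in>S. act (g i) ?Y)" by blast
    let ?l = "sorted_list_of_set S"
    have l: "set ?l = S" "length ?l = n" "sorted_wrt (<) ?l" using S(1,2) by simp_all
    let ?ps = "map (\<lambda>i. (m (2 * i), m (2 * i + 1))) ?l"
    have "length ?ps = n" using l(2) by simp
    moreover have "\<forall>(u, v)\<in>set ?ps. x \<in> fib W u \<and> x \<notin> fib W v"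
      using S(3) gY l(1) by auto
    moreover have "mor V N (map2 (\<lambda>(u, v) b. if b then u else v) ?ps bs)" if bs: "length bs = n" for bs
    proof -
      \<comment> \<open>Whichever member of each pair is selected, the indices increase, so the
        selection is a subsequence of \<open>m\<close>.\<close>
      let ?js = "map2 (\<lambda>i b. if b then 2 * i else 2 * i + 1) ?l bs"
      have "sorted_wrt (<) ?js"
        unfolding sorted_wrt_iff_nth_less
      proof (intro allI impI)
        fix p q assume "p < q" "q < length ?js"
        moreover from this have "?l ! p < ?l ! q" using l(2,3) bs by (simp add: sorted_wrt_iff_nth_less)
        ultimately show "?js ! p < ?js ! q" using l(2) bs by simp
      qed
      then have "mor V N (map m ?js)" by (rule mor_strict_sorted[OF m])
      moreover have "map m ?js = map2 (\<lambda>(u, v) b. if b then u else v) ?ps bs"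
        by (rule nth_equalityI) (use l(2) bs in auto)
      ultimately show ?thesis by simp
    qed
    ultimately show "\<exists>x ps. length ps = n \<and> (\<forall>(u, v)\<in>set ps. x \<in> fib W u \<and> x \<notin> fib W v) \<and>
      (\<forall>bs. length bs = n \<longrightarrow> mor V N (map2 (\<lambda>(u, v) b. if b then u else v) ps bs))"
      by (intro exI[of _ x] exI[of _ ?ps] conjI allI impI) (assumption | simp)+
  qed
qed

text \<open>Over a model \<open>N\<close>, two tuples of the same type start Morley sequences of a coheir with a common
  tail, so it suffices to compare the first two elements of such a sequence.\<close>

lemma nonforking_Lascar_invariant:
  fixes U :: "('x \<Rightarrow> 'a) set set"
  assumes dep: "dependent L M" and N: "mdl N" "small N" "A \<subseteq> N"
    and U: "ultra U" "\<And>X. X \<in> Def L M I UNIV \<Longrightarrow> sdiv A X \<Longrightarrow> X \<notin> U"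
    and f: "f \<in> Aut L M N" and X: "X \<in> Def L M I UNIV" "X \<in> U"
  shows "act f X \<in> U"
proof -
  obtain d :: "nat \<Rightarrow> 'a" where "{X} \<subseteq> Def L M I (range d)"
    by (rule enumerate_params[of "{X}" I]) (use X(1) in simp_all)
  then have "X \<in> Def L M I (range d)" by simp
  then obtain W where W: "W \<in> Def L M (I <+> UNIV) {}" "X = fib W d" by (rule Def_range_fib)
  let ?d = "\<lambda>i. f (d i)"
  obtain V where V: "ultra V" "{c. range c \<subseteq> N} \<in> V" "\<And>X. X \<in> Def L M UNIV N \<Longrightarrow> d \<in> X \<Longrightarrow> X \<in> V"
    by (rule coheir_exists[OF N(1), of d]) blast
  have inv: "invariant N V" by (rule coheir_invariant[OF V(1,2)])
  have dV: "realizes V UNIV N d" by (rule realizes_type[OF V(1,3)])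
  have fdV: "realizes V UNIV N ?d" using realizes_act[OF inv f dV] Aut_image[OF f] by simp
  let ?B = "N \<union> (range d \<union> range ?d)"
  have "small ?B" by (intro small_Un N(2) small_range)
  then obtain m :: "nat \<Rightarrow> nat \<Rightarrow> 'a" where m: "\<And>n. mor V ?B (map m [0..<n])"
    by (rule mor_exists[OF V(1)]) blast
  have step: "fib W' (m 0) \<in> U" if W': "W' \<in> Def L M (I <+> UNIV) {}" "fib W' e \<in> U"
    and e: "realizes V UNIV N e" "range e \<subseteq> ?B" for W' e
  proof -
    let ?m = "case_nat e m"
    have "mor V N (map ?m [0..<n])" for n
    proof (cases n)
      case (Suc k)
      have "map ?m [0..<Suc k] = e # map m [0..<k]"
        by (simp add: upt_conv_Cons map_Suc_upt[symmetric] del: upt_Suc)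
      moreover have "mor V (N \<union> range e) (map m [0..<k])" by (rule mor_mono[OF m]) (use e(2) in blast)
      ultimately show ?thesis using e(1) Suc by simp
    qed simp
    from Lascar_step[OF dep N(2,3) inv W'(1) U this] W'(2) show ?thesis by simp
  qed
  have "fib W (m 0) \<in> U" by (rule step[OF W(1) _ dV]) (use X(2) W(2) in auto)
  \<comment> \<open>\<open>step\<close> only leads from a tuple to the tail; the way back to
    \<open>?d\<close> is the same step for the complement of \<open>W\<close>.\<close>
  moreover have "fib W (m 0) \<notin> U" if "fib W ?d \<notin> U"
  proof -
    have c: "fib (- W) c = - fib W c" for c by (auto simp: mem_fib)
    have "fib (- W) ?d \<in> U" using that U(1) by (simp add: c ultra_Compl)
    then have "fib (- W) (m 0) \<in> U" by (rule step[OF Def_Compl[OF W(1)] _ fdV]) auto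
    then show ?thesis using U(1) by (simp add: c ultra_Compl)
  qed
  ultimately have "fib W ?d \<in> U" by blast
  then show ?thesis using act_fib[OF Aut_empty[OF f] W(1), of d] W(2) by simp
qed


section \<open>Strict extensions\<close>

lemma sforks_act:
  assumes g: "g \<in> Aut L M A" and X: "sforks A I X"
  shows "sforks A I (act g X)"
proof -
  obtain F where F: "finite F" "F \<subseteq> Def L M I UNIV" "\<forall>Y\<in>F. sdiv A Y" "X \<subseteq> \<Union>F"
    using X by (rule sforksE)
  show ?thesis
  proof (rule sforksI)
    show "finite (act g ` F)" using F(1) by simp
    show "act g ` F \<subseteq> Def L M I UNIV"
      using F(2) Def_act_UNIV[OF AutD(1)[OF g]] by (intro image_subsetI) (rule Def_act_UNIV[OF AutD(1)[OF g]], rule subsetD)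
    show "act g X \<subseteq> \<Union>(act g ` F)" using act_mono[OF F(4), of g] by (simp only: act_Union)
    fix Y assume "Y \<in> act g ` F"
    then obtain Z where Z: "Z \<in> F" "Y = act g Z" by (rule imageE)
    then obtain k where "sdivk k A Z" using F(3) unfolding sdiv_def by blast
    then show "sdiv A Y" unfolding Z(2) sdiv_def by (intro exI[of _ k] sdivk_act[OF g])
  qed
qed

text \<open>If the required set were inconsistent, the type of \<open>a\<close> would imply a disjunction of instances
  \<open>Z\<close>, each dividing over \<open>A\<close> or of the form \<open>Y(e\<^sub>Z, x)\<close> with \<open>Y(y, a)\<close> forking over \<open>A\<close>. The
  disjunction \<open>R\<close> of the latter, in disjoint variables \<open>y\<close>, quasi-divides, witnessed by finitely many
  conjugates of \<open>a\<close>, which we place so that their type over everything relevant does not fork over \<open>A\<close>.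
  Then all of them satisfy \<open>R(E, x)\<close> for the joint tuple \<open>E\<close> of the \<open>e\<^sub>Z\<close>, a contradiction.\<close>

lemma strict_extension:
  fixes a :: "'x \<Rightarrow> 'a"
  assumes A: "small A" and I: "small I"
    and ext: "\<And>b :: nat \<times> 'x \<Rightarrow> 'a. nonforking A (UNIV \<times> I) b A"
    and quasi: "\<And>X :: (nat \<times> nat \<Rightarrow> 'a) set. sforks A UNIV X \<Longrightarrow>
      \<exists>G. finite G \<and> G \<subseteq> Aut L M A \<and> (\<Inter>g\<in>G. act g X) = {}"
  obtains U where "ultra U" "\<And>X. X \<in> Def L M I A \<Longrightarrow> a \<in> X \<Longrightarrow> X \<in> U"
    "\<And>X. X \<in> Def L M I UNIV \<Longrightarrow> sdiv A X \<Longrightarrow> X \<notin> U"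
    "\<And>Y e. Y \<in> Def L M ((UNIV :: nat set) <+> I) A \<Longrightarrow> sforks A UNIV (fib Y a) \<Longrightarrow>
      {c. case_sum e c \<in> Y} \<notin> U"
proof -
  let ?P = "{X \<in> Def L M I A. a \<in> X}" and ?Q1 = "{X \<in> Def L M I UNIV. sdiv A X}"
  let ?R = "\<lambda>Y e. Y \<in> Def L M ((UNIV :: nat set) <+> I) A \<and> sforks A UNIV (fib Y a)"
  let ?Q2 = "{{c. case_sum e c \<in> Y} |Y e. ?R Y e}"
  have "fip (?P \<union> uminus ` (?Q1 \<union> ?Q2))"
  proof (rule fip_Un_uminus)
    fix P Q assume P: "finite P" "P \<subseteq> ?P" and Q: "finite Q" "Q \<subseteq> ?Q1 \<union> ?Q2"
    show "\<not> \<Inter>P \<subseteq> \<Union>Q"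
    proof
      assume PQ: "\<Inter>P \<subseteq> \<Union>Q"
      have X0: "\<Inter>P \<in> Def L M I A" "a \<in> \<Inter>P" using P by (auto intro!: Def_Inter)
      obtain d :: "nat \<Rightarrow> 'a" where d: "Q \<inter> ?Q1 \<subseteq> Def L M I (range d)"
        by (rule enumerate_params[of "Q \<inter> ?Q1" I]) (use Q(1) in auto)
      let ?Q = "Q \<inter> ?Q2"
      have finQ: "finite ?Q" using Q(1) by simp
      have "\<forall>Z\<in>?Q. \<exists>t. Z = {c. case_sum (snd t) c \<in> fst t} \<and> ?R (fst t) (snd t)"
      proof
        fix Z assume "Z \<in> ?Q"
        then obtain Y e where "Z = {c. case_sum e c \<in> Y}" "?R Y e" by blast
        then show "\<exists>t. Z = {c. case_sum (snd t) c \<in> fst t} \<and> ?R (fst t) (snd t)"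
          by (intro exI[of _ "(Y, e)"]) simp
      qed
      from bchoice[OF this] obtain t
        where t: "\<forall>Z\<in>?Q. Z = {c. case_sum (snd (t Z)) c \<in> fst (t Z)} \<and> ?R (fst (t Z)) (snd (t Z))" ..
      define Y e where "Y Z = fst (t Z)" and "e Z = snd (t Z)" for Z
      have tZ: "Z = {c. case_sum (e Z) c \<in> Y Z} \<and> ?R (Y Z) (e Z)" if "Z \<in> ?Q" for Z
        using t[rule_format, OF that] unfolding Y_def e_def .
      have Y: "Y Z \<in> Def L M ((UNIV :: nat set) <+> I) A" "sforks A UNIV (fib (Y Z) a)"
        if "Z \<in> ?Q" for Z
        by (rule conjunct1[OF conjunct2[OF tZ[OF that]]], rule conjunct2[OF conjunct2[OF tZ[OF that]]])
      have YZ: "case_sum (e Z) c \<in> Y Z" if "Z \<in> ?Q" "c \<in> Z" for Z c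
        using subsetD[OF equalityD1[OF conjunct1[OF tZ[OF that(1)]]] that(2)] by (rule CollectD)
      \<comment> \<open>Distinct members of \<open>?Q\<close> get disjoint blocks of variables, so
        that the tuples \<open>e Z\<close> combine into one assignment \<open>E\<close>.\<close>
      from finite_imp_inj_to_nat_seg[OF finQ]
      obtain \<iota> :: "('x \<Rightarrow> 'a) set \<Rightarrow> nat" where \<iota>: "inj_on \<iota> ?Q" by (elim exE conjE)
      define E where "E = (\<lambda>(l, i). e (inv_into ?Q \<iota> l) i)"
      have E: "E (\<iota> Z, i) = e Z i" if "Z \<in> ?Q" for Z i
        unfolding E_def prod.case inv_into_f_f[OF \<iota> that] ..
      define Y' where "Y' Z = {y :: nat \<times> nat \<Rightarrow> 'a. (\<lambda>i. y (\<iota> Z, i)) \<in> fib (Y Z) a}" for Z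
      have "sforks A UNIV (\<Union>(Y' ` ?Q))"
      proof (rule sforks_Union)
        fix X assume "X \<in> Y' ` ?Q"
        then obtain Z where Z: "Z \<in> ?Q" "X = Y' Z" by (elim imageE)
        have "sforks A (Pair (\<iota> Z) ` UNIV) (Y' Z)"
          unfolding Y'_def by (rule sforks_reindex[OF Y(2)[OF Z(1)]])
        then show "sforks A UNIV X" unfolding Z(2) by (rule sforks_mono) simp
      qed (use finQ in simp)
      from quasi[OF this] obtain G where G: "finite G" "G \<subseteq> Aut L M A" "(\<Inter>g\<in>G. act g (\<Union>(Y' ` ?Q))) = {}"
        by (elim exE conjE)
      obtain gs where gs: "set gs = G" using finite_list[OF G(1)] ..
      \<comment> \<open>The conjugates of \<open>a\<close> under \<open>G\<close> form one tuple,
        because they must be placed jointly by a single automorphism; \<open>a\<close> itself is the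
        default for the further rows.\<close>
      define b where "b = (\<lambda>(k, i). if k < length gs then (gs ! k) (a i) else a i)"
      obtain V where V: "ultra V" "\<And>X. X \<in> Def L M (UNIV \<times> I) A \<Longrightarrow> b \<in> X \<Longrightarrow> X \<in> V"
        "\<And>X. X \<in> Def L M (UNIV \<times> I) UNIV \<Longrightarrow> sdiv A X \<Longrightarrow> X \<notin> V"
        by (rule nonforking_ultra[OF ext[of b]]) blast
      let ?B = "A \<union> range d"
      have "small ?B" by (intro small_Un A small_range)
      then obtain b' where b': "realizes V (UNIV \<times> I) ?B b'"
        by (rule realizes_exists[OF V(1) small_nat_Times[OF I]])
      have "\<exists>f\<in>Aut L M A. \<forall>x\<in>UNIV \<times> I. f (b x) = b' x"
      proof (rule homogeneity[OF small_nat_Times[OF I] A])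
        fix X assume X: "X \<in> Def L M (UNIV \<times> I) A" "b \<in> X"
        have "X \<in> Def L M (UNIV \<times> I) ?B" by (rule Def_mono[OF X(1)]) simp_all
        then show "b' \<in> X" using b' V(2)[OF X] unfolding realizes_def by blast
      qed
      then obtain f where f: "f \<in> Aut L M A" "\<forall>x\<in>UNIV \<times> I. f (b x) = b' x" by (rule bexE)
      have bf: "bij f" by (rule Aut_bij[OF f(1)])
      \<comment> \<open>A row of \<open>b'\<close> has the type of \<open>a\<close> over
        \<open>A\<close> and so lies in some member of \<open>Q\<close>. That member does not
        divide, by the choice of \<open>V\<close>, hence it belongs to \<open>?Q\<close> and relates
        the row to its block of \<open>E\<close>. Undoing \<open>f\<close> yields the claim for
        \<open>g\<close>.\<close>
      have "(\<lambda>x. inv f (E x)) \<in> act g (\<Union>(Y' ` ?Q))" if gG: "g \<in> G" for g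
      proof -
        obtain k where k: "k < length gs" "gs ! k = g" 
          using gG unfolding gs[symmetric] in_set_conv_nth by (elim exE conjE)
        have gA: "g \<in> Aut L M A" using G(2) gG by (rule subsetD)
        define h where "h = f \<circ> g"
        have h: "h \<in> Aut L M A" unfolding h_def by (rule Aut_comp[OF f(1) gA])
        let ?a = "\<lambda>i. b' (k, i)"
        have ha: "?a i = h (a i)" if "i \<in> I" for i
          using f(2)[rule_format, of "(k, i)"] that k by (simp add: b_def h_def)
        have "(\<lambda>i. h (a i)) \<in> \<Inter>P" using Aut_mem_iff[OF h X0(1), of a] X0(2) by simp
        then have "?a \<in> \<Inter>P" using Def_cong[OF X0(1), of ?a "\<lambda>i. h (a i)"] ha by simp
        then have "?a \<in> \<Union>Q" by (rule subsetD[OF PQ])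
        then obtain Z where Z: "Z \<in> Q" "?a \<in> Z" by (rule UnionE)
        have "Z \<notin> ?Q1"
        proof
          assume "Z \<in> ?Q1"
          then have "sdiv A Z" "Z \<in> Def L M I (range d)" using d Z(1) by auto
          let ?Z = "{v :: nat \<times> 'x \<Rightarrow> 'a. (\<lambda>i. v (k, i)) \<in> Z}"
          have "?Z \<in> Def L M (Pair k ` I) (range d)" by (rule Def_reindex) fact
          then have D: "?Z \<in> Def L M (UNIV \<times> I) (range d)" by (rule Def_mono) auto
          obtain n where "sdivk n A Z" using \<open>sdiv A Z\<close> unfolding sdiv_def ..
          then have dZ: "sdiv A ?Z" unfolding sdiv_def by (intro exI[of _ n] sdivk_reindex)
          have "?Z \<in> Def L M (UNIV \<times> I) UNIV" by (rule Def_mono[OF D]) simp_all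
          then have "?Z \<notin> V" using dZ by (rule V(3))
          moreover have "?Z \<in> Def L M (UNIV \<times> I) ?B" by (rule Def_mono[OF D]) simp_all
          ultimately have "b' \<notin> ?Z" using realizes_iff[OF V(1) b'] by blast
          then show False using Z(2) by simp
        qed
        then have "Z \<in> ?Q2" using subsetD[OF Q(2) Z(1)] by (simp only: Un_iff simp_thms)
        with Z(1) have ZQ: "Z \<in> ?Q" by (rule IntI)
        have "case_sum (e Z) ?a \<in> Y Z" by (rule YZ[OF ZQ Z(2)])
        then have "case_sum (e Z) (\<lambda>i. h (a i)) \<in> Y Z"
          by (subst (asm) Def_cong[OF Y(1)[OF ZQ], of _ "case_sum (e Z) (\<lambda>i. h (a i))"])
            (use ha in auto)
        then have "e Z \<in> act h (fib (Y Z) a)" unfolding act_fib[OF h Y(1)[OF ZQ]] by (simp add: mem_fib)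
        then have "e Z \<in> act f (act g (fib (Y Z) a))" by (simp only: act_act h_def)
        then have "(\<lambda>i. inv f (e Z i)) \<in> act g (fib (Y Z) a)" by (simp only: mem_act[OF bf])
        then have "(\<lambda>x. inv f (E x)) \<in> act g (Y' Z)"
          unfolding Y'_def act_reindex[OF Aut_bij[OF gA]] by (simp add: E[OF ZQ])
        moreover have "act g (Y' Z) \<subseteq> act g (\<Union>(Y' ` ?Q))" by (rule act_mono) (use ZQ in blast)
        ultimately show ?thesis by (rule subsetD[rotated])
      qed
      then have "(\<lambda>x. inv f (E x)) \<in> (\<Inter>g\<in>G. act g (\<Union>(Y' ` ?Q)))" by (rule INT_I)
      then show False unfolding G(3) by simp
    qed
  qed
  then obtain U where U: "ultra U" "?P \<union> uminus ` (?Q1 \<union> ?Q2) \<subseteq> U" by (rule ultra_extend)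
  have Q: "X \<notin> U" if "X \<in> ?Q1 \<union> ?Q2" for X
  proof -
    have "- X \<in> U" by (rule subsetD[OF U(2)], rule UnI2, rule imageI, rule that)
    then show ?thesis using ultra_Compl[OF U(1)] by blast
  qed
  show ?thesis
  proof (rule that[OF U(1)])
    show "X \<in> U" if "X \<in> Def L M I A" "a \<in> X" for X
      by (rule subsetD[OF U(2)]) (use that in simp)
    show "X \<notin> U" if "X \<in> Def L M I UNIV" "sdiv A X" for X by (rule Q) (use that in simp)
    show "{c. case_sum e c \<in> Y} \<notin> U"
      if "Y \<in> Def L M ((UNIV :: nat set) <+> I) A" "sforks A UNIV (fib Y a)" for Y e
      by (rule Q, rule UnI2, rule CollectI, rule exI[of _ Y], rule exI[of _ e]) (use that in simp)
  qed
qed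

text \<open>Suppose \<open>e\<close> satisfies Y(y, c), which forks over \<open>A\<close>. Only
  finitely many coordinates of \<open>e\<close> matter, so the variables may be taken in
  \<open>nat\<close>. An automorphism over \<open>A\<close> sends \<open>a\<close> to
  \<open>c\<close>, so Y(y, a) forks as well. But Y(e, x) is a formula over \<open>C\<close> true of
  \<open>c\<close>, hence a member of \<open>U\<close>, which \<open>strict\<close>
  excludes.\<close>

lemma strict_realization:
  fixes a c :: "'x \<Rightarrow> 'a" and e :: "'z \<Rightarrow> 'a"
  assumes A: "small A" and I: "small I" and U: "ultra U"
    and Utp: "\<And>X. X \<in> Def L M I A \<Longrightarrow> a \<in> X \<Longrightarrow> X \<in> U"
    and strict: "\<And>Y e. Y \<in> Def L M ((UNIV :: nat set) <+> I) A \<Longrightarrow> sforks A UNIV (fib Y a) \<Longrightarrow>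
      {c. case_sum e c \<in> Y} \<notin> U"
    and C: "A \<subseteq> C" "realizes U I C c" "e ` E \<subseteq> C"
  shows "nonforking A E e (A \<union> c ` I)"
  unfolding nonforking_def
proof (intro ballI impI notI)
  fix Y assume Y: "Y \<in> Def L M E (A \<union> c ` I)" "e \<in> Y" "sforks A E Y"
  obtain E1 B1 where E1: "finite E1" "E1 \<subseteq> E" "B1 \<subseteq> A \<union> c ` I" "Y \<in> Def L M E1 B1"
    using Y(1) by (rule Def_finite)
  have YE1: "Y \<in> Def L M E1 (A \<union> c ` I)" by (rule Def_mono[OF E1(4) order_refl E1(3)])
  obtain V where V: "V \<in> Def L M (E1 <+> I) A" "Y = fib V c" using Def_params[OF YE1] .
  obtain \<rho> :: "'z \<Rightarrow> nat" where \<rho>: "inj_on \<rho> E1" using finite_imp_inj_to_nat_seg[OF E1(1)] by metis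
  let ?c = "\<lambda>u :: nat + 'x \<Rightarrow> 'a. case_sum (\<lambda>z. u (Inl (\<rho> z))) (\<lambda>i. u (Inr i))"
  define Y1 where "Y1 = {u. ?c u \<in> V}"
  have "{u :: nat + 'x \<Rightarrow> 'a. (\<lambda>x. case_sum u id (case_sum (\<lambda>z. Inl (Inl (\<rho> z))) (\<lambda>i. Inl (Inr i)) x)) \<in> V}
      \<in> Def L M (\<rho> ` E1 <+> I) A"
    by (rule Def_subst[OF V(1)]) auto
  moreover have "(\<lambda>x. case_sum u id (case_sum (\<lambda>z. Inl (Inl (\<rho> z))) (\<lambda>i. Inl (Inr i)) x)) = ?c u"
    for u :: "nat + 'x \<Rightarrow> 'a"
    by (rule ext) (simp split: sum.split)
  ultimately have Y1: "Y1 \<in> Def L M (\<rho> ` E1 <+> I) A" unfolding Y1_def by simp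
  have Y1': "Y1 \<in> Def L M ((UNIV :: nat set) <+> I) A" by (rule Def_mono[OF Y1]) auto
  define e1 where "e1 n = e (inv_into E1 \<rho> n)" for n
  have e1: "e1 (\<rho> z) = e z" if "z \<in> E1" for z using \<rho> that by (simp add: e1_def)
  let ?S = "{c. case_sum e1 c \<in> Y1}"
  have "?S \<in> Def L M I (A \<union> e1 ` \<rho> ` E1)" by (rule Def_fib_left[OF Y1])
  moreover have "e1 ` \<rho> ` E1 \<subseteq> C" using e1 C(3) E1(2) by auto
  ultimately have S: "?S \<in> Def L M I C" using C(1) by (elim Def_mono) auto
  have "case_sum (\<lambda>z. e1 (\<rho> z)) c \<in> V \<longleftrightarrow> case_sum e c \<in> V"
    by (rule Def_cong[OF V(1)]) (use e1 in auto)
  then have "case_sum (\<lambda>z. e1 (\<rho> z)) c \<in> V" using Y(2) unfolding V(2) mem_fib by (rule iffD2)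
  then have "c \<in> ?S" by (simp add: Y1_def)
  then have SU: "?S \<in> U" using realizes_iff[OF U C(2) S] by simp
  have "{y. (\<lambda>z. y (\<rho> z)) \<in> Y} = fib Y1 c" by (simp add: V(2) fib_def Y1_def)
  then have fk: "sforks A UNIV (fib Y1 c)" using sforks_mono[OF sforks_reindex[OF Y(3), of \<rho>], of UNIV] by simp
  have "\<exists>g\<in>Aut L M A. \<forall>i\<in>I. g (a i) = c i"
  proof (rule homogeneity[OF I A])
    fix X assume X: "X \<in> Def L M I A" "a \<in> X"
    have "X \<in> Def L M I C" by (rule Def_mono[OF X(1) order_refl C(1)])
    then show "c \<in> X" using C(2) Utp[OF X] unfolding realizes_def by blast
  qed
  then obtain g where g: "g \<in> Aut L M A" "\<forall>i\<in>I. g (a i) = c i" by (rule bexE)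
  have "case_sum y c \<in> Y1 \<longleftrightarrow> case_sum y (\<lambda>i. g (a i)) \<in> Y1" for y
    by (rule Def_cong[OF Y1]) (use g(2) in auto)
  then have "fib Y1 c = fib Y1 (\<lambda>i. g (a i))" by (simp add: fib_def)
  then have "fib Y1 c = act g (fib Y1 a)" using act_fib[OF g(1) Y1, of a] by simp
  then have "sforks A UNIV (act (inv g) (act g (fib Y1 a)))" using sforks_act[OF Aut_inv[OF g(1)] fk] by simp
  moreover have "act (inv g) (act g (fib Y1 a)) = fib Y1 a"
    using Aut_bij[OF g(1)] by (simp add: act_act bij_is_inj act_ident)
  ultimately have "sforks A UNIV (fib Y1 a)" by simp
  from strict[OF Y1' this] SU show False by blast
qed


section \<open>Forking equals dividing over models\<close>

theorem model_forking_divides: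
  fixes X :: "('x \<Rightarrow> 'a) set"
  assumes dep: "dependent L M" and N: "mdl N" "small N" and X: "X \<in> Def L M I UNIV" "sforks N I X"
  shows "sdiv N X"
proof -
  obtain F where F: "finite F" "F \<subseteq> Def L M I UNIV" "\<forall>Y\<in>F. sdiv N Y" "X \<subseteq> \<Union>F"
    using X(2) by (rule sforksE)
  have iF: "finite (insert X F)" "insert X F \<subseteq> Def L M I UNIV" using F(1,2) X(1) by simp_all
  obtain d :: "nat \<Rightarrow> 'a" where d: "insert X F \<subseteq> Def L M I (range d)" using enumerate_params[OF iF] .
  \<comment> \<open>Models are extension bases: a coheir extending the type contains no dividing
    set.\<close>
  have ext: "nonforking N (UNIV \<times> UNIV) b N" for b :: "nat \<times> nat \<Rightarrow> 'a"
  proof -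
    obtain U where U: "ultra U" "{c. range c \<subseteq> N} \<in> U" "\<And>X. X \<in> Def L M UNIV N \<Longrightarrow> b \<in> X \<Longrightarrow> X \<in> U"
      by (rule coheir_exists[OF N(1), of b]) blast
    show ?thesis
      unfolding nonforking_def UNIV_Times_UNIV
    proof (intro ballI impI)
      fix X assume "X \<in> Def L M UNIV N" "b \<in> X"
      then have "X \<in> U" by (rule U(3))
      then show "\<not> sforks N UNIV X"
        by (rule ultra_not_sforks[OF U(1), rotated]) (rule coheir_not_sdiv[OF U(1,2)])
    qed
  qed
  obtain U where U: "ultra U" "\<And>X. X \<in> Def L M UNIV N \<Longrightarrow> d \<in> X \<Longrightarrow> X \<in> U"
    "\<And>X. X \<in> Def L M UNIV UNIV \<Longrightarrow> sdiv N X \<Longrightarrow> X \<notin> U"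
    "\<And>Y e. Y \<in> Def L M ((UNIV :: nat set) <+> (UNIV :: nat set)) N \<Longrightarrow> sforks N UNIV (fib Y d) \<Longrightarrow>
      {c. case_sum e c \<in> Y} \<notin> U"
    by (rule strict_extension[OF N(2) small_nat ext, of d])
      (rule model_forking_quasi_divides[OF dep N], assumption, rule that, assumption+)
  \<comment> \<open>The base \<open>N\<close> is itself a model, so Lascar invariance over it is
    invariance over it.\<close>
  have inv: "invariant N U"
    unfolding invariant_def
  proof (intro conjI ballI impI)
    fix f X assume *: "f \<in> Aut L M N" "X \<in> Def L M UNIV UNIV" "X \<in> U"
    show "act f X \<in> U"
    proof (rule nonforking_Lascar_invariant[OF dep N order_refl U(1) _ *])
      show "X \<notin> U" if "X \<in> Def L M UNIV UNIV" "sdiv N X" for X by (rule U(3)[OF that])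
    qed
  qed (rule U(1))
  have conj: "\<exists>g\<in>Aut L M N. (\<lambda>i. g (d i)) = c" if "realizes U UNIV N c" for c
  proof -
    have "\<exists>g\<in>Aut L M N. \<forall>i\<in>UNIV. g (d i) = c i"
    proof (rule homogeneity[OF small_nat N(2)])
      fix X assume X: "X \<in> Def L M UNIV N" "d \<in> X"
      then show "c \<in> X" using that U(2)[OF X] unfolding realizes_def by blast
    qed
    then show ?thesis by (simp add: fun_eq_iff)
  qed
  have "\<exists>W n. W \<in> Def L M (I <+> UNIV) {} \<and> Y = fib W d \<and>
      (\<forall>s. mor U N s \<longrightarrow> length s = n \<longrightarrow> (\<Inter>c\<in>set s. fib W c) = {})" if Y: "Y \<in> F" for Y
  proof -
    have "Y \<in> Def L M I (range d)" by (rule subsetD[OF d]) (simp add: Y)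
    then obtain W where W: "W \<in> Def L M (I <+> UNIV) {}" "Y = fib W d" by (rule Def_range_fib)
    obtain k where k: "sdivk k N Y" using F(3) Y unfolding sdiv_def by blast
    \<comment> \<open>Strictness makes the type of \<open>B\<close> over \<open>N\<close> and
      \<open>c\<close> non-forking, so \<open>sdivk_transfer\<close> provides witnesses of dividing
      by automorphisms over \<open>B\<close>. The conjugates of \<open>c\<close> under these keep
      its type over \<open>B\<close> and hence realise \<open>U\<close> there.\<close>
    have rows: "\<exists>h. (\<forall>i. realizes U UNIV B (h i)) \<and> incons k W h" if B: "small B" "N \<subseteq> B" for B
    proof -
      obtain c where c: "realizes U UNIV B c" by (rule realizes_exists[OF U(1) small_nat B(1)])
      obtain g where g: "g \<in> Aut L M N" "(\<lambda>i. g (d i)) = c" using conj[OF realizes_mono[OF c B(2)]] by (rule bexE)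
      have "act g Y = fib W c" unfolding W(2) g(2)[symmetric] by (rule act_fib[OF Aut_empty[OF g(1)] W(1)])
      then have kc: "sdivk k N (fib W c)" using sdivk_act[OF g(1) k] by simp
      have D: "fib W c \<in> Def L M I (N \<union> range c)" by (rule Def_mono[OF Def_fib[OF W(1)]]) auto
      have nf: "nonforking N B id (N \<union> range c)"
        by (rule strict_realization[OF N(2) small_nat U(1,2,4) B(2) c]) simp_all
      have "sdivk k (N \<union> id ` B) (fib W c)"
      proof (rule sdivk_transfer[OF N(2) B(1) D kc])
        fix Z assume Z: "Z \<in> Def L M B (N \<union> range c)" "id \<in> Z"
        then have "\<not> sforks N B Z" using nf unfolding nonforking_def by blast
        moreover have "Z \<in> Def L M B UNIV" by (rule Def_mono[OF Z(1)]) simp_all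
        ultimately show "\<not> sdiv N Z" using sdiv_imp_sforks by blast
      qed
      then have "sdivk k B (fib W c)" using B(2) by (simp add: sup.absorb2)
      then obtain f :: "nat \<Rightarrow> 'a \<Rightarrow> 'a" where f: "\<forall>i. f i \<in> Aut L M B"
        "\<forall>S. finite S \<longrightarrow> card S = k \<longrightarrow> (\<Inter>i\<in>S. act (f i) (fib W c)) = {}" by (rule sdivkE)
      have eq: "act (f i) (fib W c) = fib W (\<lambda>j. f i (c j))" for i
        by (rule act_fib[OF Aut_empty W(1)]) (use f(1) in blast)
      have r: "realizes U UNIV B (\<lambda>j. f i (c j))" for i
        by (rule realizes_cong[OF c]) (simp only: Aut_mem_iff[OF f(1)[rule_format]])
      show ?thesis
        by (rule exI[of _ "\<lambda>i j. f i (c j)"]) (use r f(2) in \<open>simp only: eq simp_thms\<close>)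
    qed
    from Kim_lemma[OF dep N(2) inv W(1) rows]
    obtain n where "\<forall>s. mor U N s \<longrightarrow> length s = n \<longrightarrow> (\<Inter>c\<in>set s. fib W c) = {}" ..
    then show ?thesis using W by blast
  qed
  then have "\<forall>Y\<in>F. \<exists>t. fst t \<in> Def L M (I <+> UNIV) {} \<and> Y = fib (fst t) d \<and>
      (\<forall>s. mor U N s \<longrightarrow> length s = snd t \<longrightarrow> (\<Inter>c\<in>set s. fib (fst t) c) = {})" by simp
  from bchoice[OF this] obtain t where t: "\<forall>Y\<in>F. fst (t Y) \<in> Def L M (I <+> UNIV) {} \<and> Y = fib (fst (t Y)) d \<and>
      (\<forall>s. mor U N s \<longrightarrow> length s = snd (t Y) \<longrightarrow> (\<Inter>c\<in>set s. fib (fst (t Y)) c) = {})" ..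
  define W n where "W Y = fst (t Y)" and "n Y = snd (t Y)" for Y
  have W: "W Y \<in> Def L M (I <+> UNIV) {}" "Y = fib (W Y) d"
    and n: "\<And>s. mor U N s \<Longrightarrow> length s = n Y \<Longrightarrow> (\<Inter>c\<in>set s. fib (W Y) c) = {}" if "Y \<in> F" for Y
    using t[rule_format, OF that] by (simp_all only: W_def n_def simp_thms)
  obtain m :: "nat \<Rightarrow> nat \<Rightarrow> 'a" where m: "\<And>n. mor U N (map m [0..<n])"
    by (rule mor_exists[OF U(1) N(2)]) blast
  have "\<exists>g\<in>Aut L M N. (\<lambda>j. g (d j)) = m i" for i
    by (rule conj) (use mor_strict_sorted[OF m, of "[i]"] in simp)
  then obtain g where g: "\<And>i. g i \<in> Aut L M N" "\<And>i. (\<lambda>j. g i (d j)) = m i" by metis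
  \<comment> \<open>If this many conjugates share a point, then some disjunct \<open>Y\<close>
    accounts for at least \<open>n Y\<close> of them; they form a Morley sequence along which
    \<open>Y\<close> is inconsistent.\<close>
  have "sdivk (Suc (\<Sum>Y\<in>F. n Y)) N X"
  proof (rule sdivkI[of g])
    fix S :: "nat set" assume S: "finite S" "card S = Suc (\<Sum>Y\<in>F. n Y)"
    show "(\<Inter>i\<in>S. act (g i) X) = {}"
    proof (rule equals0I)
      fix x assume x: "x \<in> (\<Inter>i\<in>S. act (g i) X)"
      have "\<exists>Y\<in>F. x \<in> act (g i) Y" if "i \<in> S" for i
        using x that act_mono[OF F(4), of "g i"] unfolding act_Union by blast
      then obtain y where y: "\<And>i. i \<in> S \<Longrightarrow> y i \<in> F \<and> x \<in> act (g i) (y i)" by metis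
      have "\<exists>Y\<in>F. n Y \<le> card {i \<in> S. y i = Y}"
      proof (rule ccontr)
        assume "\<not> ?thesis"
        then have "(\<Sum>Y\<in>F. card {i \<in> S. y i = Y}) \<le> (\<Sum>Y\<in>F. n Y)" by (intro sum_mono) auto
        moreover have eq: "(\<Union>Y\<in>F. {i \<in> S. y i = Y}) = S" using y by auto
        have "card S \<le> (\<Sum>Y\<in>F. card {i \<in> S. y i = Y})"
          using card_UN_le[OF F(1), of "\<lambda>Y. {i \<in> S. y i = Y}"] unfolding eq .
        ultimately show False using S(2) by linarith
      qed
      then obtain Y where Y: "Y \<in> F" "n Y \<le> card {i \<in> S. y i = Y}" by (rule bexE)
      then obtain T where T: "T \<subseteq> {i \<in> S. y i = Y}" "card T = n Y" "finite T"
        by (meson obtain_subset_with_card_n)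
      let ?s = "map m (sorted_list_of_set T)"
      have "mor U N ?s" by (rule mor_strict_sorted[OF m]) simp
      moreover have "length ?s = n Y" using T(2,3) by simp
      ultimately have "(\<Inter>c\<in>set ?s. fib (W Y) c) = {}" by (rule n[OF Y(1)])
      moreover have "x \<in> fib (W Y) (m i)" if "i \<in> T" for i
      proof -
        have "x \<in> act (g i) Y" using T(1) that y by blast
        moreover have "act (g i) Y = fib (W Y) (m i)"
          using act_fib[OF Aut_empty[OF g(1)] W(1)[OF Y(1)], of i d] W(2)[OF Y(1)] g(2) by metis
        ultimately show ?thesis by simp
      qed
      then have "x \<in> (\<Inter>c\<in>set ?s. fib (W Y) c)" using T(3) by simp
      ultimately show False by simp
    qed
  qed (rule g(1))
  then show ?thesis unfolding sdiv_def ..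
qed


section \<open>Syntactic and semantic forking\<close>

text \<open>Homogeneity extends each map \<open>h i\<close> from the parameters to an automorphism
  over \<open>A\<close>. The instance of the formula depends only on the values at the
  parameters.\<close>

lemma divides_iff_sdiv:
  fixes \<phi> :: "('f, 'r, 'x + 'a) fm"
  assumes A: "small A" and wf: "wf_fm L 0 \<phi>"
  shows "divides L M A \<phi> \<longleftrightarrow> sdiv A {c. holds M c \<phi>}"
proof
  have "finite (params \<phi>)"
    using finite_vimageI[OF finite_fm_vars inj_Inr, of \<phi>] by (simp add: params_def vimage_def)
  then have P: "small (params \<phi>)" by (rule small_finite)
  assume "divides L M A \<phi>"
  then obtain k and h :: "nat \<Rightarrow> 'a \<Rightarrow> 'a" where
    h: "\<forall>i. tp L M (params \<phi>) (h i) A = tp L M (params \<phi>) id A"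
    and hS: "\<forall>S. finite S \<and> card S = k \<longrightarrow> \<not> (\<exists>c. \<forall>i\<in>S. holds M c (inst_params (h i) \<phi>))"
    unfolding divides_def by (elim exE conjE)
  have "\<exists>g\<in>Aut L M A. \<forall>b\<in>params \<phi>. g (id b) = h i b" for i
  proof (rule homogeneity[OF P A])
    fix X assume X: "X \<in> Def L M (params \<phi>) A" "id \<in> X"
    obtain \<psi> where \<psi>: "\<psi> \<in> formulas L (params \<phi>) A" "X = {c. holds M c \<psi>}" using X(1) by (rule DefE)
    then have "\<psi> \<in> tp L M (params \<phi>) id A" using X(2) by (simp add: tp_def)
    then have "\<psi> \<in> tp L M (params \<phi>) (h i) A" using h by simp
    then show "h i \<in> X" using \<psi>(2) by (simp add: tp_def)
  qed
  then have "\<forall>i. \<exists>g. g \<in> Aut L M A \<and> (\<forall>b\<in>params \<phi>. g b = h i b)" by (simp add: Bex_def)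
  from choice[OF this] obtain g where g: "\<forall>i. g i \<in> Aut L M A \<and> (\<forall>b\<in>params \<phi>. g i b = h i b)" ..
  have eq: "act (g i) {c. holds M c \<phi>} = {c. holds M c (inst_params (h i) \<phi>)}" for i
  proof -
    have "inst_params (g i) \<phi> = inst_params (h i) \<phi>"
      unfolding inst_params_def
    proof (rule fm.map_cong0)
      fix z assume z: "z \<in> fm_vars \<phi>"
      show "map_sum id (g i) z = map_sum id (h i) z"
      proof (cases z)
        case (Inr b)
        then have "b \<in> params \<phi>" using z by (simp add: params_def)
        then show ?thesis using g Inr by simp
      qed simp
    qed
    moreover have "g i \<in> Aut L M A" using g by simp
    ultimately show ?thesis using act_holds[OF AutD(1) wf] by metis
  qed
  have "sdivk k A {c. holds M c \<phi>}"
  proof (rule sdivkI[of g])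
    show "g i \<in> Aut L M A" for i using g by blast
    fix S :: "nat set" assume "finite S" "card S = k"
    then have "\<not> (\<exists>c. \<forall>i\<in>S. holds M c (inst_params (h i) \<phi>))" using hS by blast
    then show "(\<Inter>i\<in>S. act (g i) {c. holds M c \<phi>}) = {}" unfolding eq by auto
  qed
  then show "sdiv A {c. holds M c \<phi>}" unfolding sdiv_def ..
next
  assume "sdiv A {c. holds M c \<phi>}"
  then obtain k where "sdivk k A {c. holds M c \<phi>}" unfolding sdiv_def ..
  then obtain g :: "nat \<Rightarrow> 'a \<Rightarrow> 'a" where g: "\<forall>i. g i \<in> Aut L M A"
    "\<forall>S. finite S \<longrightarrow> card S = k \<longrightarrow> (\<Inter>i\<in>S. act (g i) {c. holds M c \<phi>}) = {}" by (rule sdivkE)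
  have "tp L M (params \<phi>) (g i) A = tp L M (params \<phi>) id A" for i
  proof -
    have "holds M (g i) \<psi> \<longleftrightarrow> holds M id \<psi>" if "\<psi> \<in> formulas L (params \<phi>) A" for \<psi> :: "('f, 'r, 'a + 'a) fm"
      using Aut_mem_iff[OF g(1)[rule_format] Def_formula[OF that], of i id] by simp
    then show ?thesis unfolding tp_def by blast
  qed
  moreover have "\<not> (\<exists>c. \<forall>i\<in>S. holds M c (inst_params (g i) \<phi>))" if "finite S \<and> card S = k" for S
  proof -
    have "(\<Inter>i\<in>S. act (g i) {c. holds M c \<phi>}) = {}" using g(2) that by blast
    then show ?thesis unfolding act_holds[OF AutD(1)[OF g(1)[rule_format]] wf] by auto
  qed
  ultimately show "divides L M A \<phi>" unfolding divides_def by (intro exI[of _ k] exI[of _ g]) simp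
qed

lemma forks_iff_sforks:
  fixes \<phi> :: "('f, 'r, 'x + 'a) fm"
  assumes A: "small A" and \<phi>: "\<phi> \<in> formulas L I UNIV"
  shows "forks L M A I \<phi> \<longleftrightarrow> sforks A I {c. holds M c \<phi>}"
proof
  assume "forks L M A I \<phi>"
  then obtain \<Psi> where \<Psi>: "finite \<Psi>" "\<Psi> \<subseteq> formulas L I UNIV" "\<forall>\<psi>\<in>\<Psi>. divides L M A \<psi>"
    "\<forall>c. holds M c \<phi> \<longrightarrow> (\<exists>\<psi>\<in>\<Psi>. holds M c \<psi>)"
    unfolding forks_def by (elim exE conjE)
  show "sforks A I {c. holds M c \<phi>}"
  proof (rule sforksI)
    show "finite ((\<lambda>\<psi>. {c. holds M c \<psi>}) ` \<Psi>)" using \<Psi>(1) by simp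
    show "(\<lambda>\<psi>. {c. holds M c \<psi>}) ` \<Psi> \<subseteq> Def L M I UNIV" using \<Psi>(2) Def_formula by (intro image_subsetI) blast
    show "{c. holds M c \<phi>} \<subseteq> \<Union>((\<lambda>\<psi>. {c. holds M c \<psi>}) ` \<Psi>)" using \<Psi>(4) by blast
    fix Y assume "Y \<in> (\<lambda>\<psi>. {c. holds M c \<psi>}) ` \<Psi>"
    then obtain \<psi> where \<psi>: "\<psi> \<in> \<Psi>" "Y = {c. holds M c \<psi>}" by blast
    then have "wf_fm L 0 \<psi>" using \<Psi>(2) by (auto simp: formulas_def)
    from divides_iff_sdiv[OF A this] show "sdiv A Y" using \<Psi>(3) \<psi> by simp
  qed
next
  assume "sforks A I {c. holds M c \<phi>}"
  then obtain F where F: "finite F" "F \<subseteq> Def L M I UNIV" "\<forall>Y\<in>F. sdiv A Y" "{c. holds M c \<phi>} \<subseteq> \<Union>F"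
    by (rule sforksE)
  have "\<forall>Y\<in>F. \<exists>\<psi>. \<psi> \<in> formulas L I UNIV \<and> Y = {c. holds M c \<psi>}"
    using F(2) unfolding Def_def by blast
  from bchoice[OF this] obtain \<psi> where \<psi>: "\<forall>Y\<in>F. \<psi> Y \<in> formulas L I UNIV \<and> Y = {c. holds M c (\<psi> Y)}" ..
  have "divides L M A (\<psi> Y)" if "Y \<in> F" for Y
  proof -
    have "\<psi> Y \<in> formulas L I UNIV" "Y = {c. holds M c (\<psi> Y)}" using \<psi> that by blast+
    then show ?thesis using divides_iff_sdiv[OF A, of "\<psi> Y"] F(3) that by (simp add: formulas_def)
  qed
  moreover have "\<exists>\<theta>\<in>\<psi> ` F. holds M c \<theta>" if c: "holds M c \<phi>" for c
  proof -
    obtain Y where Y: "Y \<in> F" "c \<in> Y" using F(4) c by blast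
    then have "c \<in> {c. holds M c (\<psi> Y)}" using \<psi> by (metis (no_types, lifting))
    then show ?thesis using Y(1) by blast
  qed
  moreover have "\<psi> ` F \<subseteq> formulas L I UNIV" using \<psi> by blast
  ultimately show "forks L M A I \<phi>"
    unfolding forks_def using \<phi> F(1) by (intro conjI exI[of _ "\<psi> ` F"]) auto
qed

lemma formulas_mono: "B \<subseteq> C \<Longrightarrow> formulas L I B \<subseteq> formulas L I C"
  unfolding formulas_def by blast

lemma type_forks_iff:
  fixes a :: "'x \<Rightarrow> 'a"
  assumes A: "small A"
  shows "type_forks L M A I (tp L M I a B) \<longleftrightarrow> \<not> nonforking A I a B"
proof
  assume "type_forks L M A I (tp L M I a B)"
  then obtain \<Phi> \<phi> where \<Phi>: "finite \<Phi>" "\<Phi> \<subseteq> tp L M I a B" "forks L M A I \<phi>"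
    "\<forall>c. (\<forall>\<psi>\<in>\<Phi>. holds M c \<psi>) \<longrightarrow> holds M c \<phi>"
    unfolding type_forks_def by (elim exE conjE)
  let ?X = "\<Inter>\<psi>\<in>\<Phi>. {c. holds M c \<psi>}"
  have "?X \<in> Def L M I B" using \<Phi>(2) by (intro Def_INT[OF \<Phi>(1)] Def_formula) (auto simp: tp_def)
  moreover have "a \<in> ?X" using \<Phi>(2) by (auto simp: tp_def)
  moreover have "\<phi> \<in> formulas L I UNIV" using \<Phi>(3) by (simp add: forks_def)
  then have "sforks A I {c. holds M c \<phi>}" using forks_iff_sforks[OF A] \<Phi>(3) by blast
  then have "sforks A I ?X" by (rule sforks_subset) (use \<Phi>(4) in auto)
  ultimately show "\<not> nonforking A I a B" unfolding nonforking_def by blast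
next
  assume "\<not> nonforking A I a B"
  then obtain X where X: "X \<in> Def L M I B" "a \<in> X" "sforks A I X" unfolding nonforking_def by blast
  obtain \<phi> where \<phi>: "\<phi> \<in> formulas L I B" "X = {c. holds M c \<phi>}" using X(1) by (rule DefE)
  have "\<phi> \<in> formulas L I UNIV" using \<phi>(1) formulas_mono[of B UNIV] by blast
  then have "forks L M A I \<phi>" using forks_iff_sforks[OF A] X(3) \<phi>(2) by blast
  moreover have "{\<phi>} \<subseteq> tp L M I a B" using \<phi> X(2) by (simp add: tp_def)
  ultimately show "type_forks L M A I (tp L M I a B)"
    unfolding type_forks_def by (intro exI[of _ "{\<phi>}"] exI[of _ \<phi>]) simp
qed

lemma tp_eqI:
  fixes a b :: "'x \<Rightarrow> 'a"
  assumes "\<And>X. X \<in> Def L M I B \<Longrightarrow> a \<in> X \<Longrightarrow> b \<in> X"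
  shows "tp L M I b B = tp L M I a B"
proof -
  have "holds M b \<phi> \<longleftrightarrow> holds M a \<phi>" if "\<phi> \<in> formulas L I B" for \<phi> :: "('f, 'r, 'x + 'a) fm"
    using assms[OF Def_formula[OF that]] assms[OF Def_Compl[OF Def_formula[OF that]]] by auto
  then show ?thesis unfolding tp_def by blast
qed


section \<open>Change of variables\<close>

lemma sforks_finite_support:
  fixes X :: "('x \<Rightarrow> 'a) set"
  assumes "X \<in> Def L M J UNIV" "sforks A J X"
  obtains J0 where "finite J0" "J0 \<subseteq> J" "X \<in> Def L M J0 UNIV" "sforks A J0 X"
proof -
  obtain F where F: "finite F" "F \<subseteq> Def L M J UNIV" "\<forall>Y\<in>F. sdiv A Y" "X \<subseteq> \<Union>F"
    using assms(2) by (rule sforksE)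
  have "\<forall>Y\<in>insert X F. \<exists>J0. finite J0 \<and> J0 \<subseteq> J \<and> Y \<in> Def L M J0 UNIV"
  proof
    fix Y assume "Y \<in> insert X F"
    then have "Y \<in> Def L M J UNIV" using F(2) assms(1) by blast
    then obtain I0 B0 where I0: "finite I0" "I0 \<subseteq> J" "Y \<in> Def L M I0 B0" by (rule Def_finite)
    have "Y \<in> Def L M I0 UNIV" by (rule Def_mono[OF I0(3)]) simp_all
    then show "\<exists>J0. finite J0 \<and> J0 \<subseteq> J \<and> Y \<in> Def L M J0 UNIV" using I0 by blast
  qed
  from bchoice[OF this] obtain s
    where s: "\<forall>Y\<in>insert X F. finite (s Y) \<and> s Y \<subseteq> J \<and> Y \<in> Def L M (s Y) UNIV" ..
  let ?J = "\<Union>(s ` insert X F)"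
  have D: "Y \<in> Def L M ?J UNIV" if "Y \<in> insert X F" for Y
  proof -
    have "Y \<in> Def L M (s Y) UNIV" using s that by blast
    then show ?thesis by (rule Def_mono) (use that in auto)
  qed
  show ?thesis
  proof (rule that[of ?J])
    show "finite ?J" using F(1) s by blast
    show "?J \<subseteq> J" using s by blast
    show "X \<in> Def L M ?J UNIV" by (rule D) simp
    show "sforks A ?J X"
    proof (rule sforksI[OF F(1) _ _ F(4)])
      show "F \<subseteq> Def L M ?J UNIV" using D by blast
    qed (use F(3) in blast)
  qed
qed

text \<open>Condition (3) is stated for finite sets of variables in \<open>nat\<close>. Forking is
  witnessed in finitely many variables, which \<open>\<rho>\<close> renames to numbers; dividing
  comes back along the inverse renaming.\<close>

lemma forking_eq_dividing_sdiv:
  fixes X :: "('x \<Rightarrow> 'a) set"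
  assumes A: "small A" and fd: "forking_eq_dividing L M A"
    and X: "X \<in> Def L M J UNIV" "sforks A J X"
  shows "sdiv A X"
proof -
  obtain J0 where J0: "finite J0" "X \<in> Def L M J0 UNIV" "sforks A J0 X"
    by (rule sforks_finite_support[OF X])
  from finite_imp_inj_to_nat_seg[OF J0(1)]
  obtain \<rho> :: "'x \<Rightarrow> nat" where \<rho>: "inj_on \<rho> J0" by (elim exE conjE)
  let ?X = "{y. (\<lambda>j. y (\<rho> j)) \<in> X}"
  have "?X \<in> Def L M (\<rho> ` J0) UNIV" by (rule Def_reindex[OF J0(2)])
  then obtain \<phi> where \<phi>: "\<phi> \<in> formulas L (\<rho> ` J0) UNIV" "?X = {c. holds M c \<phi>}" by (rule DefE)
  have "sforks A (\<rho> ` J0) ?X" by (rule sforks_reindex[OF J0(3)])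
  then have "forks L M A (\<rho> ` J0) \<phi>" using forks_iff_sforks[OF A \<phi>(1)] \<phi>(2) by simp
  then have "divides L M A \<phi>" using fd \<phi>(1) J0(1) unfolding forking_eq_dividing_def by blast
  then have "sdiv A ?X" using divides_iff_sdiv[OF A, of \<phi>] \<phi> by (simp add: formulas_def)
  then obtain k where k: "sdivk k A ?X" unfolding sdiv_def ..
  have "{c. (\<lambda>n. c (inv_into J0 \<rho> n)) \<in> ?X} = X"
  proof -
    have "(\<lambda>j. c (inv_into J0 \<rho> (\<rho> j))) \<in> X \<longleftrightarrow> c \<in> X" for c
      by (rule Def_cong[OF J0(2)]) (use \<rho> in simp)
    then show ?thesis by simp
  qed
  then have "sdivk k A X" using sdivk_reindex[OF k, of "inv_into J0 \<rho>"] by simp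
  then show ?thesis unfolding sdiv_def ..
qed

text \<open>Condition (1) is stated for index sets in \<open>'k\<close>. Every small set embeds into
  the field of \<open>\<kappa>\<close>, and forking is transported by renaming coordinates.\<close>

lemma nonforking_extension_base_all:
  fixes b :: "'x \<Rightarrow> 'a"
  assumes A: "small A" and base: "nonforking_extension_base L \<kappa> M A" and J: "small J"
  shows "nonforking A J b A"
proof -
  have "|J| \<le>o |Field \<kappa>|"
    using ordLess_imp_ordLeq[OF J[unfolded small_def]] ordIso_symmetric[OF card_of_Field_ordIso[OF card_order_\<kappa>]]
    by (rule ordLeq_ordIso_trans)
  then obtain \<rho> :: "'x \<Rightarrow> 'k" where \<rho>: "inj_on \<rho> J" unfolding card_of_ordLeq[symmetric] by blast
  let ?b = "\<lambda>k. b (inv_into J \<rho> k)"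
  have "small (\<rho> ` J)" by (rule small_image[OF J])
  then have "\<not> type_forks L M A (\<rho> ` J) (tp L M (\<rho> ` J) ?b A)"
    using base unfolding nonforking_extension_base_def small_def by blast
  then have nf: "nonforking A (\<rho> ` J) ?b A" using type_forks_iff[OF A] by blast
  show ?thesis
    unfolding nonforking_def
  proof (intro ballI impI notI)
    fix X assume X: "X \<in> Def L M J A" "b \<in> X" "sforks A J X"
    have "(\<lambda>j. ?b (\<rho> j)) \<in> X \<longleftrightarrow> b \<in> X" by (rule Def_cong[OF X(1)]) (use \<rho> in simp)
    then have "?b \<in> {y. (\<lambda>j. y (\<rho> j)) \<in> X}" using X(2) by simp
    from nf[unfolded nonforking_def, rule_format, OF Def_reindex[OF X(1)] this]
    show False using sforks_reindex[OF X(3), of \<rho>] by (rule notE)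
  qed
qed


section \<open>The equivalences\<close>

text \<open>\<open>N\<close> is moved to \<open>e ` N\<close> so that the type of \<open>e\<close> over the parameters \<open>d\<close> does not fork over \<open>A\<close>;
  then the given disjuncts still divide over \<open>e ` N\<close>.\<close>

lemma extension_base_forking_eq_dividing:
  assumes dep: "dependent L M" and A: "small A" and base: "nonforking_extension_base L \<kappa> M A"
  shows "forking_eq_dividing L M A"
proof -
  have main: "sdiv A X" if X: "X \<in> Def L M I UNIV" "sforks A I X" for I :: "nat set" and X
  proof -
    obtain F where F: "finite F" "F \<subseteq> Def L M I UNIV" "\<forall>Y\<in>F. sdiv A Y" "X \<subseteq> \<Union>F"
      using X(2) by (rule sforksE)
    obtain d :: "nat \<Rightarrow> 'a" where d: "F \<subseteq> Def L M I (range d)" using enumerate_params[OF F(1,2)] .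
    obtain N where N: "A \<subseteq> N" "small N" "mdl N" using Loewenheim_Skolem[OF A] .
    have "nonforking A N id A" by (rule nonforking_extension_base_all[OF A base N(2)])
    then obtain V where V: "ultra V" "\<And>X. X \<in> Def L M N A \<Longrightarrow> id \<in> X \<Longrightarrow> X \<in> V"
      "\<And>X. X \<in> Def L M N UNIV \<Longrightarrow> sdiv A X \<Longrightarrow> X \<notin> V"
      by (rule nonforking_ultra) blast
    let ?B = "A \<union> range d"
    have "small ?B" by (intro small_Un A small_range)
    then obtain e where e: "realizes V N ?B e" by (rule realizes_exists[OF V(1) N(2)])
    have "\<exists>f\<in>Aut L M A. \<forall>n\<in>N. f (id n) = e n"
    proof (rule homogeneity[OF N(2) A])
      fix X assume X: "X \<in> Def L M N A" "id \<in> X"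
      have "X \<in> Def L M N ?B" by (rule Def_mono[OF X(1)]) simp_all
      then show "e \<in> X" using e V(2)[OF X] unfolding realizes_def by blast
    qed
    then obtain f where f: "f \<in> Aut L M A" "\<forall>n\<in>N. f (id n) = e n" by (rule bexE)
    have eN: "e ` N = f ` N" using f(2) by (intro image_cong) simp_all
    have mN: "mdl (e ` N)" unfolding eN by (rule mdl_image[OF AutD(1)[OF f(1)] N(3)])
    have AN: "A \<subseteq> e ` N" unfolding eN using Aut_image[OF f(1)] image_mono[OF N(1), of f] by simp
    have sN: "small (e ` N)" by (rule small_image[OF N(2)])
    have "sdiv (e ` N) Y" if Y: "Y \<in> F" for Y
    proof -
      obtain k where k: "sdivk k A Y" using F(3) Y unfolding sdiv_def by blast
      have YD: "Y \<in> Def L M I ?B" by (rule Def_mono[OF subsetD[OF d Y]]) simp_all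
      have "sdivk k (A \<union> e ` N) Y"
      proof (rule sdivk_transfer[OF A N(2) YD k])
        fix Z assume Z: "Z \<in> Def L M N ?B" "e \<in> Z"
        then have ZV: "Z \<in> V" using realizes_iff[OF V(1) e Z(1)] by simp
        have "Z \<in> Def L M N UNIV" by (rule Def_mono[OF Z(1)]) simp_all
        then show "\<not> sdiv A Z" using V(3) ZV by blast
      qed
      then have "sdivk k (e ` N) Y" using AN by (simp add: sup.absorb2)
      then show ?thesis unfolding sdiv_def ..
    qed
    then have "sforks (e ` N) I X" by (intro sforksI[OF F(1,2) _ F(4)])
    then have "sdiv (e ` N) X" by (rule model_forking_divides[OF dep mN sN X(1)])
    then obtain k where "sdivk k (e ` N) X" unfolding sdiv_def ..
    \<comment> \<open>Automorphisms fixing the model fix \<open>A\<close>, so dividing descends from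
      the model to \<open>A\<close>.\<close>
    then have "sdivk k A X" using AN by (rule sdivk_mono_base)
    then show ?thesis unfolding sdiv_def ..
  qed
  show ?thesis
    unfolding forking_eq_dividing_def
  proof (intro allI impI)
    fix I :: "nat set" and \<phi> :: "('f, 'r, nat + 'a) fm"
    assume "finite I \<and> \<phi> \<in> formulas L I UNIV"
    then have \<phi>: "\<phi> \<in> formulas L I UNIV" "wf_fm L 0 \<phi>" by (simp_all add: formulas_def)
    have X: "{c. holds M c \<phi>} \<in> Def L M I UNIV" by (rule Def_formula[OF \<phi>(1)])
    show "forks L M A I \<phi> \<longleftrightarrow> divides L M A \<phi>"
      unfolding forks_iff_sforks[OF A \<phi>(1)] divides_iff_sdiv[OF A \<phi>(2)]
      using main[OF X] sdiv_imp_sforks[OF X] by blast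
  qed
qed

section \<open>From (3) to (2), and from (2) to (1)\<close>

lemma Def_ex_left:
  fixes X :: "('x + 'y \<Rightarrow> 'a) set"
  assumes "X \<in> Def L M (I <+> J) B"
  shows "{d. \<exists>c. case_sum c d \<in> X} \<in> Def L M J B"
proof -
  let ?s = "case_sum Inr Inl :: 'x + 'y \<Rightarrow> 'y + 'x"
  have "{v. (\<lambda>i. v (?s i)) \<in> X} \<in> Def L M (?s ` (I <+> J)) B" by (rule Def_reindex[OF assms])
  then have "{v. (\<lambda>i. v (?s i)) \<in> X} \<in> Def L M (J <+> I) B" by (rule Def_mono) auto
  from Def_ex[OF this] have "{d. \<exists>c. (\<lambda>i. case_sum d c (?s i)) \<in> X} \<in> Def L M J B" by simp
  moreover have "(\<lambda>i. case_sum d c (?s i)) = case_sum c d" for d :: "'y \<Rightarrow> 'a" and c :: "'x \<Rightarrow> 'a"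
    by (rule ext) (simp split: sum.split)
  ultimately show ?thesis by simp
qed

text \<open>If \<open>W(z, a)\<close> implied the dividing formula \<open>Y(z, b)\<close>, then the formula saying that
  \<open>W(z, y)\<close> is consistent and implies \<open>Y(z, b)\<close> would divide along the same sequence, but it is
  satisfied by \<open>a\<close>.\<close>

lemma forking_eq_dividing_left_extension:
  assumes A: "small A" and fd: "forking_eq_dividing L M A"
  shows "nonforking_left_extension L \<kappa> M A"
  unfolding nonforking_left_extension_def
proof (intro allI impI)
  fix I :: "'k set" and a :: "'k \<Rightarrow> 'a" and J :: "'k set" and b :: "'k \<Rightarrow> 'a" and D :: "'a set"
  assume *: "|I| <o \<kappa> \<and> |J| <o \<kappa> \<and> |D| <o \<kappa> \<and> a ` I \<subseteq> D \<and>
    \<not> type_forks L M A I (tp L M I a (b ` J \<union> A))"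
  then have sm: "small I" "small J" "small D" by (simp_all add: small_def)
  have nf: "nonforking A I a (b ` J \<union> A)" using * type_forks_iff[OF A] by blast
  let ?B = "b ` J \<union> A"
  let ?P = "{X \<in> Def L M D (A \<union> a ` I). id \<in> X}" and ?Q = "{Y \<in> Def L M D ?B. sforks A D Y}"
  have fip: "fip (?P \<union> uminus ` ?Q)"
  proof (rule fip_Un_uminus)
    fix P Q assume P: "finite P" "P \<subseteq> ?P" and Q: "finite Q" "Q \<subseteq> ?Q"
    show "\<not> \<Inter>P \<subseteq> \<Union>Q"
    proof
      assume PQ: "\<Inter>P \<subseteq> \<Union>Q"
      let ?Y = "\<Union>Q"
      have X: "\<Inter>P \<in> Def L M D (A \<union> a ` I)" "id \<in> \<Inter>P" using P by (auto intro!: Def_Inter)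
      obtain W where W: "W \<in> Def L M (D <+> I) A" "\<Inter>P = fib W a" using Def_params[OF X(1)] .
      \<comment> \<open>A finite disjunction of forking formulas forks, so by (3) the whole of
        \<open>?Y\<close> divides, along a single sequence.\<close>
      have Y: "?Y \<in> Def L M D ?B" "sforks A D ?Y"
        using Q by (auto intro!: Def_Union sforks_Union)
      have YU: "?Y \<in> Def L M D UNIV" by (rule Def_mono[OF Y(1)]) simp_all
      obtain k where k: "sdivk k A ?Y"
        using forking_eq_dividing_sdiv[OF A fd YU Y(2)] unfolding sdiv_def ..
      obtain g :: "nat \<Rightarrow> 'a \<Rightarrow> 'a" where g0: "\<forall>i. g i \<in> Aut L M A"
        "\<forall>S. finite S \<longrightarrow> card S = k \<longrightarrow> (\<Inter>i\<in>S. act (g i) ?Y) = {}" using k by (rule sdivkE)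
      note g = g0(1)[rule_format] and gS = g0(2)[rule_format]
      let ?W' = "W \<inter> {u. (\<lambda>z. u (Inl z)) \<in> - ?Y}"
      define \<chi> where "\<chi> = {y. \<exists>z. case_sum z y \<in> W} \<inter> - {y. \<exists>z. case_sum z y \<in> ?W'}"
      have "{u :: 'a + 'k \<Rightarrow> 'a. (\<lambda>z. u (Inl z)) \<in> - ?Y} \<in> Def L M (Inl ` D) ?B"
        by (rule Def_reindex[OF Def_Compl[OF Y(1)]])
      then have "{u :: 'a + 'k \<Rightarrow> 'a. (\<lambda>z. u (Inl z)) \<in> - ?Y} \<in> Def L M (D <+> I) ?B"
        by (rule Def_mono) auto
      moreover have WB: "W \<in> Def L M (D <+> I) ?B" by (rule Def_mono[OF W(1)]) simp_all
      ultimately have \<chi>D: "\<chi> \<in> Def L M I ?B"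
        unfolding \<chi>_def by (intro Def_Int Def_Compl Def_ex_left)
      have mem: "y \<in> \<chi> \<longleftrightarrow> fib W y \<noteq> {} \<and> fib W y \<subseteq> ?Y" for y
        unfolding \<chi>_def by (auto simp: fib_def)
      have a\<chi>: "a \<in> \<chi>" unfolding mem W(2)[symmetric] using X(2) PQ by blast
      have g\<chi>: "fib W y \<noteq> {} \<and> fib W y \<subseteq> act (g i) ?Y" if y: "y \<in> act (g i) \<chi>" for y i
      proof -
        obtain y0 where y0: "y0 \<in> \<chi>" "y = (\<lambda>j. g i (y0 j))" using y unfolding act_def by blast
        have eq: "fib W y = act (g i) (fib W y0)" unfolding y0(2) by (rule act_fib[OF g W(1), symmetric])
        have "fib W y0 \<noteq> {}" "fib W y0 \<subseteq> ?Y" using y0(1) unfolding mem by blast+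
        then show ?thesis unfolding eq using act_mono by (auto simp: act_def)
      qed
      have "sdivk k A \<chi>"
      proof (rule sdivkI[of g])
        fix S :: "nat set" assume S: "finite S" "card S = k"
        show "(\<Inter>i\<in>S. act (g i) \<chi>) = {}"
        proof (rule equals0I)
          fix y assume y: "y \<in> (\<Inter>i\<in>S. act (g i) \<chi>)"
          \<comment> \<open>An empty intersection would be the whole space, so \<open>k\<close> is
            not 0. The index obtained shows that W(z, y) is consistent.\<close>
          have "S \<noteq> {}" using gS[OF S] by auto
          then obtain i0 where "i0 \<in> S" by blast
          then have "fib W y \<noteq> {}" using g\<chi> y by blast
          then obtain z where z: "z \<in> fib W y" by blast
          have "z \<in> act (g i) ?Y" if "i \<in> S" for i
          proof -
            have "y \<in> act (g i) \<chi>" using y that by (rule INT_D)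
            then show ?thesis using g\<chi>[of y i] z by blast
          qed
          then have "z \<in> (\<Inter>i\<in>S. act (g i) ?Y)" by (rule INT_I)
          then show False unfolding gS[OF S] by simp
        qed
      qed (rule g)
      then have "sdiv A \<chi>" unfolding sdiv_def ..
      moreover have "\<chi> \<in> Def L M I UNIV" by (rule Def_mono[OF \<chi>D]) simp_all
      ultimately have "sforks A I \<chi>" by (intro sdiv_imp_sforks)
      then show False using nf \<chi>D a\<chi> unfolding nonforking_def by blast
    qed
  qed
  let ?C = "?B \<union> a ` I"
  have "\<Inter>(?P \<union> uminus ` ?Q) \<noteq> {}"
  proof (rule saturation[OF _ sm(3) _ fip])
    show "small ?C" by (intro small_Un small_image sm A)
    have "X \<in> Def L M D ?C" if "X \<in> ?P" for X
      by (rule Def_mono[of X L M D "A \<union> a ` I"]) (use that in auto)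
    moreover have "- Y \<in> Def L M D ?C" if "Y \<in> ?Q" for Y
      by (rule Def_Compl, rule Def_mono[of Y L M D ?B]) (use that in auto)
    ultimately show "?P \<union> uminus ` ?Q \<subseteq> Def L M D ?C" by (intro Un_least subsetI) (assumption, erule imageE, simp only:)
  qed
  then obtain d where d: "d \<in> \<Inter>(?P \<union> uminus ` ?Q)" by blast
  have "tp L M D d (A \<union> a ` I) = tp L M D id (A \<union> a ` I)"
  proof (rule tp_eqI)
    fix X assume "X \<in> Def L M D (A \<union> a ` I)" "id \<in> X"
    then have "X \<in> ?P \<union> uminus ` ?Q" by blast
    then show "d \<in> X" by (rule InterD[OF d])
  qed
  moreover have "nonforking A D d ?B"
    unfolding nonforking_def
  proof (intro ballI impI notI)
    fix X assume X: "X \<in> Def L M D ?B" "d \<in> X" "sforks A D X"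
    then have "- X \<in> ?P \<union> uminus ` ?Q" by blast
    then have "d \<in> - X" by (rule InterD[OF d])
    then show False using X(2) by simp
  qed
  then have "\<not> type_forks L M A D (tp L M D d ?B)" using type_forks_iff[OF A] by blast
  ultimately show "\<exists>d :: 'a \<Rightarrow> 'a. tp L M D d (A \<union> a ` I) = tp L M D id (A \<union> a ` I) \<and>
    \<not> type_forks L M A D (tp L M D d (b ` J \<union> A))" by blast
qed

text \<open>The type of the empty tuple does not fork: without variables a nonempty definable set is
  everything, and that does not divide. Left extension to the range of \<open>a\<close> gives a
  tuple of the same type over \<open>A\<close> whose type over \<open>A\<close> does not fork, and
  this is a property of the type alone.\<close>

lemma left_extension_extension_base:
  assumes A: "small A" and le: "nonforking_left_extension L \<kappa> M A"
  shows "nonforking_extension_base L \<kappa> M A"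
  unfolding nonforking_extension_base_def
proof (intro allI impI)
  fix I :: "'k set" and a :: "'k \<Rightarrow> 'a" assume "|I| <o \<kappa>"
  then have I: "small I" by (simp add: small_def)
  let ?D = "a ` I"
  have "nonforking A ({} :: 'k set) a A"
    unfolding nonforking_def
  proof (intro ballI impI notI)
    fix X assume X: "X \<in> Def L M ({} :: 'k set) A" "a \<in> X" "sforks A {} X"
    obtain F where F: "F \<subseteq> Def L M ({} :: 'k set) UNIV" "\<forall>Y\<in>F. sdiv A Y" "X \<subseteq> \<Union>F"
      using X(3) by (rule sforksE)
    obtain Y where Y: "Y \<in> F" "a \<in> Y" using F(3) X(2) by blast
    have "Y \<in> Def L M {} UNIV" using F(1) Y(1) by (rule subsetD)
    then have "Y = UNIV" using Def_cong[of Y L M "{}" UNIV a] Y(2) by blast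
    then show False using F(2) Y(1) sdiv_UNIV by blast
  qed
  then have "\<not> type_forks L M A ({} :: 'k set) (tp L M ({} :: 'k set) a (a ` ({} :: 'k set) \<union> A))"
    unfolding image_empty Un_empty_left type_forks_iff[OF A] by simp
  moreover have "|{} :: 'k set| <o \<kappa>" "|?D| <o \<kappa>"
    using small_finite[of "{} :: 'k set"] small_image[OF I, of a] by (simp_all add: small_def)
  ultimately have "\<exists>d :: 'a \<Rightarrow> 'a. tp L M ?D d (A \<union> a ` ({} :: 'k set)) = tp L M ?D id (A \<union> a ` ({} :: 'k set)) \<and>
      \<not> type_forks L M A ?D (tp L M ?D d (a ` ({} :: 'k set) \<union> A))"
    using le[unfolded nonforking_left_extension_def, rule_format, of "{}" "{}" ?D a a] by simp
  then obtain d :: "'a \<Rightarrow> 'a" where d: "tp L M ?D d A = tp L M ?D id A" "\<not> type_forks L M A ?D (tp L M ?D d A)"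
    by auto
  have nf: "nonforking A ?D d A" using d(2) type_forks_iff[OF A] by blast
  have "nonforking A I a A"
    unfolding nonforking_def
  proof (intro ballI impI notI)
    fix X assume X: "X \<in> Def L M I A" "a \<in> X" "sforks A I X"
    let ?X = "{z :: 'a \<Rightarrow> 'a. (\<lambda>i. z (a i)) \<in> X}"
    have XD: "?X \<in> Def L M ?D A" by (rule Def_reindex[OF X(1)])
    then obtain \<phi> where \<phi>: "\<phi> \<in> formulas L ?D A" "?X = {c. holds M c \<phi>}" by (rule DefE)
    have "id \<in> ?X" using X(2) by simp
    then have "\<phi> \<in> tp L M ?D id A" using \<phi> by (simp add: tp_def)
    then have "\<phi> \<in> tp L M ?D d A" using d(1) by simp
    then have "d \<in> ?X" unfolding \<phi>(2) by (simp add: tp_def)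
    from nf[unfolded nonforking_def, rule_format, OF XD this]
    show False using sforks_reindex[OF X(3), of a] by (rule notE)
  qed
  then show "\<not> type_forks L M A I (tp L M I a A)" using type_forks_iff[OF A] by blast
qed

section \<open>From (1) and (3) to (4), and from (4) to (1)\<close>

lemma AutfL_act:
  fixes U :: "('x \<Rightarrow> 'a) set set"
  assumes gen: "\<And>g N X. g \<in> Aut L M N \<Longrightarrow> mdl N \<Longrightarrow> small N \<Longrightarrow> A \<subseteq> N \<Longrightarrow> X \<in> Def L M I UNIV \<Longrightarrow>
      X \<in> U \<Longrightarrow> act g X \<in> U"
    and h: "h \<in> AutfL L \<kappa> M A"
  shows "automorphism L M h \<and> (\<forall>X\<in>Def L M I UNIV. X \<in> U \<longleftrightarrow> act h X \<in> U)"
  using h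
proof (induction h rule: AutfL.induct)
  case (gen g N)
  then have N: "mdl N" "small N" "A \<subseteq> N" and g: "g \<in> Aut L M N"
    by (simp_all add: elem_substructure_mdl small_def Aut_def)
  \<comment> \<open>The inverse of a generator fixes the same model. This upgrades the implication
    to the equivalence on which the case \<open>inverse\<close> relies.\<close>
  have "X \<in> U" if X: "X \<in> Def L M I UNIV" "act g X \<in> U" for X
  proof -
    have "act (inv g) (act g X) \<in> U"
      by (rule assms(1)[OF Aut_inv[OF g] N Def_act_UNIV[OF AutD(1)[OF g] X(1)] X(2)])
    then show ?thesis using Aut_bij[OF g] by (simp add: act_act bij_is_inj act_ident)
  qed
  moreover have "act g X \<in> U" if "X \<in> Def L M I UNIV" "X \<in> U" for X by (rule assms(1)[OF g N that])
  ultimately show ?case using gen.hyps(1) by blast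
next
  case one
  show ?case unfolding act_ident by (intro conjI ballI refl automorphism_id)
next
  case (comp g h)
  have gh: "X \<in> U \<longleftrightarrow> act (g \<circ> h) X \<in> U" if X: "X \<in> Def L M I UNIV" for X
  proof -
    have "act h X \<in> Def L M I UNIV" using comp.IH(2) X by (intro Def_act_UNIV) simp_all
    then show ?thesis using comp.IH X by (simp only: act_act[symmetric]) blast
  qed
  show ?case
    by (intro conjI ballI gh automorphism_comp conjunct1[OF comp.IH(1)] conjunct1[OF comp.IH(2)])
next
  case (inverse g)
  then have g: "automorphism L M g" by simp
  then have b: "bij g" by (rule automorphism_bij)
  have "X \<in> U \<longleftrightarrow> act (inv g) X \<in> U" if X: "X \<in> Def L M I UNIV" for X
  proof -
    have "act (inv g) X \<in> Def L M I UNIV" by (rule Def_act_UNIV[OF automorphism_inv[OF g] X])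
    then have "act (inv g) X \<in> U \<longleftrightarrow> act g (act (inv g) X) \<in> U" using inverse.IH by blast
    moreover have "g \<circ> inv g = id" using b by (simp add: bij_is_surj surj_iff[symmetric])
    ultimately show ?thesis by (simp add: act_act act_ident)
  qed
  then show ?case using automorphism_inv[OF g] by blast
qed

lemma forking_eq_dividing_strict_invariance:
  assumes dep: "dependent L M" and A: "small A" and base: "nonforking_extension_base L \<kappa> M A"
    and fd: "forking_eq_dividing L M A"
  shows "strict_invariance_extension_base L \<kappa> M A"
  unfolding strict_invariance_extension_base_def
proof (intro allI impI)
  fix I :: "'k set" and a :: "'k \<Rightarrow> 'a" assume "|I| <o \<kappa>"
  then have I: "small I" by (simp add: small_def)
  have ext: "nonforking A (UNIV \<times> I) b A" for b :: "nat \<times> 'k \<Rightarrow> 'a"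
    by (rule nonforking_extension_base_all[OF A base small_nat_Times[OF I]])
  have quasi: "\<exists>G. finite G \<and> G \<subseteq> Aut L M A \<and> (\<Inter>g\<in>G. act g X) = {}"
    if X: "sforks A UNIV X" for X :: "(nat \<times> nat \<Rightarrow> 'a) set"
  proof -
    obtain F where F: "finite F" "F \<subseteq> Def L M UNIV UNIV" "\<forall>Y\<in>F. sdiv A Y" "X \<subseteq> \<Union>F"
      using X by (rule sforksE)
    have "sforks A UNIV (\<Union>F)" by (rule sforksI[OF F(1,2)]) (use F(3) in auto)
    then have "sdiv A (\<Union>F)"
      by (rule forking_eq_dividing_sdiv[OF A fd Def_Union[OF F(1,2)]])
    then obtain k where "sdivk k A (\<Union>F)" unfolding sdiv_def ..
    then have "sdivk k A X" using F(4) by (rule sdivk_subset)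
    then obtain g :: "nat \<Rightarrow> 'a \<Rightarrow> 'a" where g: "\<forall>i. g i \<in> Aut L M A"
      "\<forall>S. finite S \<longrightarrow> card S = k \<longrightarrow> (\<Inter>i\<in>S. act (g i) X) = {}" by (rule sdivkE)
    \<comment> \<open>With (3), quasi-dividing is immediate: any \<open>k\<close> translates from
      the sequence have empty intersection.\<close>
    have "(\<Inter>i\<in>{..<k}. act (g i) X) = {}" using g(2) by simp
    then show ?thesis using g(1) by (intro exI[of _ "g ` {..<k}"]) auto
  qed
  obtain U where U: "ultra U" "\<And>X. X \<in> Def L M I A \<Longrightarrow> a \<in> X \<Longrightarrow> X \<in> U"
    "\<And>X. X \<in> Def L M I UNIV \<Longrightarrow> sdiv A X \<Longrightarrow> X \<notin> U"
    "\<And>Y e. Y \<in> Def L M ((UNIV :: nat set) <+> I) A \<Longrightarrow> sforks A UNIV (fib Y a) \<Longrightarrow>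
      {c. case_sum e c \<in> Y} \<notin> U"
    by (rule strict_extension[OF A I ext, of a]) (rule quasi, assumption, rule that, assumption+)
  define q where "q = {\<phi> \<in> formulas L I UNIV. {c. holds M c \<phi>} \<in> U}"
  have "fin_sat M q"
    unfolding fin_sat_def
  proof (intro allI impI)
    fix \<Phi> assume \<Phi>: "finite \<Phi> \<and> \<Phi> \<subseteq> q"
    have "(\<Inter>\<phi>\<in>\<Phi>. {c. holds M c \<phi>}) \<in> U"
      by (rule ultra_Inter[OF U(1), of "(\<lambda>\<phi>. {c. holds M c \<phi>}) ` \<Phi>"]) (use \<Phi> in \<open>auto simp: q_def\<close>)
    then obtain c where "c \<in> (\<Inter>\<phi>\<in>\<Phi>. {c. holds M c \<phi>})" using ultra_nonempty[OF U(1)] by blast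
    then show "\<exists>c. \<forall>\<phi>\<in>\<Phi>. holds M c \<phi>" by (intro exI[of _ c]) simp
  qed
  moreover have "\<phi> \<in> q \<or> Neg \<phi> \<in> q" if \<phi>: "\<phi> \<in> formulas L I UNIV" for \<phi> :: "('f, 'r, 'k + 'a) fm"
  proof -
    have "Neg \<phi> \<in> formulas L I UNIV" "{c. holds M c (Neg \<phi>)} = - {c. holds M c \<phi>}"
      using \<phi> by (auto simp: formulas_def holds_def sat_def)
    then show ?thesis using \<phi> ultra_Compl[OF U(1)] by (simp add: q_def)
  qed
  ultimately have "global_type L M I q" unfolding global_type_def q_def by blast
  moreover have "tp L M I a A \<subseteq> q"
  proof
    fix \<phi> assume \<phi>: "\<phi> \<in> tp L M I a A"
    then have "\<phi> \<in> formulas L I A" "a \<in> {c. holds M c \<phi>}" by (simp_all add: tp_def)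
    then have "{c. holds M c \<phi>} \<in> U" using U(2)[OF Def_formula] by blast
    then show "\<phi> \<in> q" using \<open>\<phi> \<in> formulas L I A\<close> formulas_mono[of A UNIV I] by (auto simp: q_def)
  qed
  moreover have "inst_params h ` q = q" if h: "h \<in> AutfL L \<kappa> M A" for h
  proof -
    have inv: "automorphism L M h \<and> (\<forall>X\<in>Def L M I UNIV. X \<in> U \<longleftrightarrow> act h X \<in> U)" if "h \<in> AutfL L \<kappa> M A" for h
    proof (rule AutfL_act[OF _ that])
      fix g N X assume *: "g \<in> Aut L M N" "mdl N" "small N" "A \<subseteq> N" "X \<in> Def L M I UNIV" "X \<in> U"
      show "act g X \<in> U"
      proof (rule nonforking_Lascar_invariant[OF dep *(2-4) U(1) _ *(1,5,6)])
        show "X \<notin> U" if "X \<in> Def L M I UNIV" "sdiv A X" for X by (rule U(3)[OF that])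
      qed
    qed
    have sub: "inst_params h \<phi> \<in> q" if h: "h \<in> AutfL L \<kappa> M A" and \<phi>: "\<phi> \<in> q" for h \<phi>
    proof -
      have f: "\<phi> \<in> formulas L I UNIV" "{c. holds M c \<phi>} \<in> U" using \<phi> by (simp_all add: q_def)
      then have "act h {c. holds M c \<phi>} \<in> U" using inv[OF h] Def_formula[OF f(1), of M] by blast
      moreover have "act h {c. holds M c \<phi>} = {c. holds M c (inst_params h \<phi>)}"
        by (rule act_holds[of L]) (use inv[OF h] f(1) in \<open>simp_all add: formulas_def\<close>)
      moreover have "inst_params h \<phi> \<in> formulas L I UNIV"
        using inst_params_formulas[OF f(1), of h] formulas_mono[of "h ` UNIV" UNIV I] by blast
      ultimately show ?thesis by (simp add: q_def)
    qed
    have "\<phi> \<in> inst_params h ` q" if \<phi>: "\<phi> \<in> q" for \<phi>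
    proof (rule image_eqI)
      have "bij h" by (rule automorphism_bij[OF conjunct1[OF inv[OF h]]])
      then have hh: "h (inv h b) = b" for b by (simp add: bij_is_surj surj_f_inv_f)
      have "map_sum id h \<circ> map_sum id (inv h) = (id :: 'k + 'a \<Rightarrow> 'k + 'a)"
      proof (rule HOL.ext)
        fix z :: "'k + 'a"
        show "(map_sum id h \<circ> map_sum id (inv h)) z = id z" by (cases z) (simp_all add: hh)
      qed
      then show "\<phi> = inst_params h (inst_params (inv h) \<phi>)"
        by (simp add: inst_params_def fm.map_comp fm.map_id)
      show "inst_params (inv h) \<phi> \<in> q" by (rule sub[OF AutfL.inverse[OF h] \<phi>])
    qed
    then show ?thesis using sub[OF h] by blast
  qed
  moreover have "\<not> type_forks L M A C (tp L M C id (A \<union> c ` I))"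
    if C: "|C| <o \<kappa> \<and> A \<subseteq> C \<and> (\<forall>\<phi>\<in>q \<inter> formulas L I C. holds M c \<phi>)" for C c
  proof -
    have "realizes U I C c"
      unfolding realizes_def
    proof (intro ballI impI)
      fix X assume X: "X \<in> Def L M I C" "X \<in> U"
      obtain \<phi> where \<phi>: "\<phi> \<in> formulas L I C" "X = {c. holds M c \<phi>}" using X(1) by (rule DefE)
      then have "\<phi> \<in> q" using X(2) formulas_mono[of C UNIV I] by (auto simp: q_def)
      then show "c \<in> X" using C \<phi> by blast
    qed
    then have "nonforking A C id (A \<union> c ` I)"
      using C by (intro strict_realization[OF A I U(1,2,4)]) auto
    then show ?thesis using type_forks_iff[OF A] by blast
  qed
  ultimately show "strictly_invariant L \<kappa> M A I (tp L M I a A)"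
    unfolding strictly_invariant_def by (intro exI[of _ q] conjI ballI allI impI)
qed

text \<open>The types over \<open>N\<^sub>0\<close> of the members of the sequence are made equal with the help of a
  non-principal ultrafilter \<open>\<U>\<close> on its indices.\<close>

lemma sdivk_over_model:
  fixes X :: "('x \<Rightarrow> 'a) set"
  assumes A: "small A" and X: "X \<in> Def L M I UNIV" and div: "sdivk k A X"
  obtains N where "mdl N" "small N" "A \<subseteq> N" "sdivk k N X"
proof -
  obtain N0 where N0: "A \<subseteq> N0" "small N0" "mdl N0" using Loewenheim_Skolem[OF A] .
  obtain d :: "nat \<Rightarrow> 'a" where "{X} \<subseteq> Def L M I (range d)"
    by (rule enumerate_params[of "{X}" I]) (use X in simp_all)
  then have "X \<in> Def L M I (range d)" by simp
  then obtain W where W: "W \<in> Def L M (I <+> UNIV) {}" "X = fib W d" by (rule Def_range_fib)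
  obtain g :: "nat \<Rightarrow> 'a \<Rightarrow> 'a" where g0: "\<forall>i. g i \<in> Aut L M A"
    "\<forall>S. finite S \<longrightarrow> card S = k \<longrightarrow> (\<Inter>i\<in>S. act (g i) X) = {}" using div by (rule sdivkE)
  note g = g0(1)[rule_format] and gS = g0(2)[rule_format]
  have fibg: "act (g i) X = fib W (\<lambda>j. g i (d j))" for i
    unfolding W(2) by (rule act_fib[OF Aut_empty[OF g] W(1)])
  have "fip ({} \<union> uminus ` {F :: nat set. finite F})"
  proof (rule fip_Un_uminus)
    fix P Q :: "nat set set" assume P: "P \<subseteq> {}" and Q: "finite Q" "Q \<subseteq> {F. finite F}"
    have "finite (\<Union>Q)" using Q by blast
    then have "\<Union>Q \<noteq> UNIV" by auto
    then show "\<not> \<Inter>P \<subseteq> \<Union>Q" using P by auto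
  qed
  then obtain \<U> :: "nat set set" where \<U>: "ultra \<U>" "{} \<union> uminus ` {F :: nat set. finite F} \<subseteq> \<U>"
    by (rule ultra_extend)
  have inf: "infinite J" if "J \<in> \<U>" for J
  proof
    assume "finite J"
    then have "- J \<in> \<U>" using \<U>(2) by blast
    then show False using that ultra_Compl[OF \<U>(1)] by blast
  qed
  let ?J = "\<lambda>Z. {i. (\<lambda>j. g i (d j)) \<in> Z}"
  let ?Zs = "{Z \<in> Def L M UNIV N0. ?J Z \<in> \<U>}"
  let ?c = "\<lambda>(v :: nat \<times> nat \<Rightarrow> 'a) i j. v (i, j)"
  let ?V = "\<lambda>(Z, i). {v. ?c v i \<in> Z}"
  let ?Q = "\<lambda>S. {v :: nat \<times> nat \<Rightarrow> 'a. \<exists>c. \<forall>i\<in>S. c \<in> fib W (?c v i)}"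
  let ?Qs = "{- ?Q S |S. finite S \<and> card S = k}"
  let ?F = "?V ` (?Zs \<times> UNIV) \<union> ?Qs"
  have "\<Inter>?F \<noteq> {}"
  proof (rule saturation)
    have "?V (Z, i) \<in> Def L M UNIV N0" if "Z \<in> ?Zs" for Z i
    proof -
      have "{v. (\<lambda>j. v (i, j)) \<in> Z} \<in> Def L M (Pair i ` UNIV) N0" by (rule Def_reindex) (use that in simp)
      then have "{v. (\<lambda>j. v (i, j)) \<in> Z} \<in> Def L M UNIV N0" by (rule Def_mono) simp_all
      then show ?thesis by simp
    qed
    moreover have "- ?Q S \<in> Def L M UNIV N0" if "finite S" for S
      by (rule Def_mono[OF Def_Compl[OF Def_ex_fibs[OF W(1) that, where K = UNIV]]]) simp_all
    ultimately show "?F \<subseteq> Def L M UNIV N0" by auto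
    show "small (UNIV :: (nat \<times> nat) set)"
      using small_nat_Times[OF small_nat, of UNIV] by (simp add: UNIV_Times_UNIV)
    show "small N0" by (rule N0(2))
    show "fip ?F"
      unfolding fip_def
    proof (intro allI impI)
      fix F0 assume F0: "finite F0" "F0 \<subseteq> ?F"
      obtain T where T: "finite T" "T \<subseteq> ?Zs \<times> UNIV" "F0 \<subseteq> ?V ` T \<union> ?Qs"
        using F0 by (rule finite_subset_image_Un)
      \<comment> \<open>Infinitely many indices satisfy the finitely many conditions simultaneously,
        and selecting them injectively preserves \<open>k\<close>-inconsistency.\<close>
      have "(\<Inter>(Z, i)\<in>T. ?J Z) \<in> \<U>"
        by (rule ultra_Inter[OF \<U>(1), of "(\<lambda>(Z, i). ?J Z) ` T"]) (use T(1,2) in auto)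
      from infinite_countable_subset[OF inf[OF this]]
      obtain s :: "nat \<Rightarrow> nat" where s: "inj s" "range s \<subseteq> (\<Inter>(Z, i)\<in>T. ?J Z)" by (elim exE conjE)
      define v where "v = (\<lambda>(i, j). g (s i) (d j))"
      have vc: "?c v i = (\<lambda>j. g (s i) (d j))" for i by (simp add: v_def)
      have "v \<in> Y" if Y: "Y \<in> F0" for Y
        using subsetD[OF T(3) Y]
      proof
        assume "Y \<in> ?V ` T"
        then obtain Z i where Z: "(Z, i) \<in> T" "Y = {v. ?c v i \<in> Z}" by auto
        have "s i \<in> ?J Z" using s(2) Z(1) by blast
        then show ?thesis unfolding Z(2) by (simp add: vc)
      next
        assume "Y \<in> ?Qs"
        then obtain S where S: "Y = - ?Q S" "finite S" "card S = k" by (elim CollectE exE conjE)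
        have no: "(\<Inter>i\<in>s ` S. act (g i) X) = {}"
          by (rule gS) (use S(2,3) s(1) in \<open>simp_all add: card_image inj_on_subset[OF s(1)]\<close>)
        show ?thesis
          unfolding S(1)
        proof
          assume "v \<in> ?Q S"
          then obtain c where "\<forall>i\<in>S. c \<in> fib W (?c v i)" unfolding mem_Collect_eq ..
          then have "c \<in> (\<Inter>i\<in>s ` S. act (g i) X)" by (simp add: fibg vc)
          then show False unfolding no by simp
        qed
      qed
      then have "v \<in> \<Inter>F0" by (rule InterI)
      then show "\<Inter>F0 \<noteq> {}" by (metis empty_iff)
    qed
  qed
  then have "\<exists>v. v \<in> \<Inter>?F" by (simp only: ex_in_conv not_False_eq_True)
  then obtain v where v: "v \<in> \<Inter>?F" ..
  have vZ: "?c v i \<in> Z" if "Z \<in> ?Zs" for Z i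
  proof -
    have "?V (Z, i) \<in> ?F" by (rule UnI1, rule imageI) (use that in simp)
    from InterD[OF v this] show ?thesis by simp
  qed
  have "\<exists>h\<in>Aut L M A. \<forall>j\<in>UNIV. h (d j) = ?c v 0 j"
  proof (rule homogeneity[OF small_nat A])
    fix Z assume Z: "Z \<in> Def L M UNIV A" "d \<in> Z"
    have "?J Z = UNIV" using Aut_mem_iff[OF g Z(1)] Z(2) by blast
    moreover have "UNIV \<in> \<U>" by (rule ultra_Inter[OF \<U>(1), of "{}"]) simp_all
    moreover have "Z \<in> Def L M UNIV N0" by (rule Def_mono[OF Z(1) order_refl N0(1)])
    ultimately show "?c v 0 \<in> Z" by (intro vZ) simp
  qed
  then obtain h where h: "h \<in> Aut L M A" "\<forall>j\<in>UNIV. h (d j) = ?c v 0 j" by (rule bexE)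
  have "\<forall>i. \<exists>f. f \<in> Aut L M N0 \<and> (\<forall>j. f (?c v 0 j) = ?c v i j)"
  proof
    fix i
    have "\<exists>f\<in>Aut L M N0. \<forall>j\<in>UNIV. f (?c v 0 j) = ?c v i j"
    proof (rule homogeneity[OF small_nat N0(2)])
      fix Z assume Z: "Z \<in> Def L M UNIV N0" "?c v 0 \<in> Z"
      have "?J Z \<in> \<U>"
      proof (rule ccontr)
        assume "?J Z \<notin> \<U>"
        then have "- ?J Z \<in> \<U>" using ultra_Compl[OF \<U>(1)] by blast
        moreover have "- ?J Z = ?J (- Z)" by blast
        ultimately have "- Z \<in> ?Zs" using Def_Compl[OF Z(1)] by simp
        then show False using vZ[of "- Z" 0] Z(2) by blast
      qed
      then show "?c v i \<in> Z" using Z(1) by (intro vZ) simp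
    qed
    then show "\<exists>f. f \<in> Aut L M N0 \<and> (\<forall>j. f (?c v 0 j) = ?c v i j)" by (simp add: Bex_def)
  qed
  from choice[OF this] obtain f where f: "\<forall>i. f i \<in> Aut L M N0 \<and> (\<forall>j. f i (?c v 0 j) = ?c v i j)" ..
  have bh: "bij h" by (rule Aut_bij[OF h(1)])
  \<comment> \<open>The new sequence starts at a conjugate of \<open>d\<close> over
    \<open>A\<close>. Conjugating back by \<open>h\<close> makes it start at \<open>d\<close> and
    replaces \<open>N0\<close> by another model containing \<open>A\<close>.\<close>
  let ?N = "inv h ` N0"
  let ?f = "\<lambda>i. inv h \<circ> (f i \<circ> h)"
  have fN: "?f i \<in> Aut L M ?N" for i
  proof -
    have "automorphism L M (?f i)"
      using f AutD(1)[OF h(1)] by (intro automorphism_comp automorphism_inv) (simp_all add: AutD(1)[of _ L M N0])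
    moreover have "?f i x = x" if x: "x \<in> ?N" for x
    proof -
      obtain n where n: "n \<in> N0" "x = inv h n" using x by (elim imageE)
      have "h x = n" using n(2) bh by (simp add: bij_is_surj surj_f_inv_f)
      moreover have "f i n = n" using f n(1) AutD(2)[of "f i" L M N0 n] by simp
      ultimately show ?thesis using n(2) by simp
    qed
    ultimately show ?thesis by (simp add: Aut_def)
  qed
  have "sdivk k ?N X"
  proof (rule sdivkI[of ?f])
    fix S :: "nat set" assume S: "finite S" "card S = k"
    have eq: "act (?f i) X = act (inv h) (fib W (?c v i))" for i
    proof -
      have "act (?f i) X = act (inv h) (act (f i) (act h (fib W d)))" by (simp only: act_act W(2))
      also have "act h (fib W d) = fib W (?c v 0)"
        using act_fib[OF Aut_empty[OF h(1)] W(1), of d] h(2) by simp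
      also have "act (f i) (fib W (?c v 0)) = fib W (?c v i)"
        using act_fib[OF Aut_empty W(1), of "f i" N0 "?c v 0"] f by simp
      finally show ?thesis .
    qed
    show "(\<Inter>i\<in>S. act (?f i) X) = {}"
      unfolding eq
    proof (rule equals0I)
      fix c assume "c \<in> (\<Inter>i\<in>S. act (inv h) (fib W (?c v i)))"
      then have "\<forall>i\<in>S. (\<lambda>x. inv (inv h) (c x)) \<in> fib W (?c v i)"
        by (simp add: mem_act[OF bij_imp_bij_inv[OF bh]])
      then have "v \<in> ?Q S" by (intro CollectI exI)
      moreover have "v \<in> - ?Q S" by (rule InterD[OF v], rule UnI2) (use S in blast)
      ultimately show False by simp
    qed
  qed (rule fN)
  moreover have "A \<subseteq> ?N" using image_mono[OF N0(1), of "inv h"] Aut_image[OF Aut_inv[OF h(1)]] by simp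
  moreover have "mdl ?N" by (rule mdl_image[OF automorphism_inv[OF AutD(1)[OF h(1)]] N0(3)])
  moreover have "small ?N" by (rule small_image[OF N0(2)])
  ultimately show ?thesis using that by blast
qed

text \<open>A complete type containing a forking formula contains one of its dividing disjuncts. By
  \<open>sdivk_over_model\<close> that disjunct divides along automorphisms fixing a model around
  \<open>A\<close>. They belong to \<open>AutfL\<close>, so invariance keeps all translates in the
  type, against \<open>k\<close>-inconsistency.\<close>

lemma strict_invariance_imp_extension_base:
  assumes A: "small A" and si: "strict_invariance_extension_base L \<kappa> M A"
  shows "nonforking_extension_base L \<kappa> M A"
  unfolding nonforking_extension_base_def
proof (intro allI impI)
  fix I :: "'k set" and a :: "'k \<Rightarrow> 'a" assume "|I| <o \<kappa>"
  then have "strictly_invariant L \<kappa> M A I (tp L M I a A)"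
    using si unfolding strict_invariance_extension_base_def by blast
  then obtain q where q: "global_type L M I q" "tp L M I a A \<subseteq> q"
    and qinv: "\<forall>g\<in>AutfL L \<kappa> M A. inst_params g ` q = q"
    unfolding strictly_invariant_def by (elim exE conjE)
  have fs: "\<exists>c. \<forall>\<phi>\<in>\<Phi>. holds M c \<phi>" if "finite \<Phi>" "\<Phi> \<subseteq> q" for \<Phi>
    using q(1) that unfolding global_type_def fin_sat_def by blast
  have "nonforking A I a A"
    unfolding nonforking_def
  proof (intro ballI impI notI)
    fix X assume X: "X \<in> Def L M I A" "a \<in> X" "sforks A I X"
    obtain \<phi> where \<phi>: "\<phi> \<in> formulas L I A" "X = {c. holds M c \<phi>}" using X(1) by (rule DefE)
    have \<phi>q: "\<phi> \<in> q" using q(2) \<phi> X(2) by (auto simp: tp_def)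
    obtain F where F: "finite F" "F \<subseteq> Def L M I UNIV" "\<forall>Y\<in>F. sdiv A Y" "X \<subseteq> \<Union>F"
      using X(3) by (rule sforksE)
    have "\<forall>Y\<in>F. \<exists>\<psi>. \<psi> \<in> formulas L I UNIV \<and> Y = {c. holds M c \<psi>}"
      using F(2) unfolding Def_def by blast
    from bchoice[OF this] obtain \<psi> where \<psi>: "\<forall>Y\<in>F. \<psi> Y \<in> formulas L I UNIV \<and> Y = {c. holds M c (\<psi> Y)}" ..
    have "\<exists>Y\<in>F. \<psi> Y \<in> q"
    proof (rule ccontr)
      assume n: "\<not> (\<exists>Y\<in>F. \<psi> Y \<in> q)"
      have "Neg (\<psi> Y) \<in> q" if "Y \<in> F" for Y
        using n \<psi> that q(1) unfolding global_type_def by blast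
      then have "insert \<phi> ((\<lambda>Y. Neg (\<psi> Y)) ` F) \<subseteq> q" using \<phi>q by blast
      with F(1) obtain c where c: "\<forall>\<theta>\<in>insert \<phi> ((\<lambda>Y. Neg (\<psi> Y)) ` F). holds M c \<theta>"
        using fs[of "insert \<phi> ((\<lambda>Y. Neg (\<psi> Y)) ` F)"] by blast
      then have "c \<in> X" using \<phi>(2) by simp
      then obtain Y where Y: "Y \<in> F" "c \<in> Y" using F(4) by blast
      have "holds M c (Neg (\<psi> Y))" using c Y(1) by simp
      then have "c \<notin> {c. holds M c (\<psi> Y)}" by (simp add: holds_def sat_def)
      moreover have "Y = {c. holds M c (\<psi> Y)}" using \<psi> Y(1) by blast
      ultimately show False using Y(2) by (metis (no_types))
    qed
    then obtain Y where Y: "Y \<in> F" "\<psi> Y \<in> q" by (rule bexE)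
    define \<theta> where "\<theta> = \<psi> Y"
    have \<theta>: "\<theta> \<in> q" "\<theta> \<in> formulas L I UNIV" "Y = {c. holds M c \<theta>}"
      using Y \<psi> unfolding \<theta>_def by blast+
    obtain k where k: "sdivk k A Y" using F(3) Y(1) unfolding sdiv_def by blast
    have YD: "Y \<in> Def L M I UNIV" using F(2) Y(1) by (rule subsetD)
    obtain N where N: "mdl N" "small N" "A \<subseteq> N" "sdivk k N Y" using sdivk_over_model[OF A YD k] .
    obtain g :: "nat \<Rightarrow> 'a \<Rightarrow> 'a" where g: "\<forall>i. g i \<in> Aut L M N"
      "\<forall>S. finite S \<longrightarrow> card S = k \<longrightarrow> (\<Inter>i\<in>S. act (g i) Y) = {}" using N(4) by (rule sdivkE)
    have "g i \<in> AutfL L \<kappa> M A" for i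
    proof (rule AutfL.gen[OF _ mdl_elem_substructure[OF N(1)] N(2)[unfolded small_def] N(3)])
      show "automorphism L M (g i)" by (rule AutD(1)[OF g(1)[rule_format]])
      show "g i x = x" if "x \<in> N" for x by (rule AutD(2)[OF g(1)[rule_format] that])
    qed
    then have "inst_params (g i) \<theta> \<in> q" for i using qinv \<theta>(1) by blast
    then obtain c where c: "\<forall>\<phi>\<in>(\<lambda>i. inst_params (g i) \<theta>) ` {..<k}. holds M c \<phi>"
      using fs[of "(\<lambda>i. inst_params (g i) \<theta>) ` {..<k}"] by blast
    have "c \<in> act (g i) Y" if "i < k" for i
    proof -
      have "act (g i) Y = {c. holds M c (inst_params (g i) \<theta>)}"
        unfolding \<theta>(3)
        by (rule act_holds[OF AutD(1)[OF g(1)[rule_format]]]) (use \<theta>(2) in \<open>simp add: formulas_def\<close>)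
      then show ?thesis using c that by simp
    qed
    then have "c \<in> (\<Inter>i\<in>{..<k}. act (g i) Y)" by simp
    then show False using g(2)[rule_format, of "{..<k}"] by simp
  qed
  then show "\<not> type_forks L M A I (tp L M I a A)" using type_forks_iff[OF A] by blast
qed

end

theorem theorem3p29:
  fixes L :: "('f, 'r) lang" and \<kappa> :: "'k rel" and M :: "('f, 'r, 'a) interp" and A :: "'a set"
  assumes "monster L \<kappa> M"
    and "dependent L M"
    and "|A| <o \<kappa>"
  shows "(nonforking_extension_base L \<kappa> M A \<longleftrightarrow> nonforking_left_extension L \<kappa> M A) \<and>
    (nonforking_left_extension L \<kappa> M A \<longleftrightarrow> forking_eq_dividing L M A) \<and>
    (forking_eq_dividing L M A \<longleftrightarrow> strict_invariance_extension_base L \<kappa> M A)"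
proof -
  interpret monster_model L \<kappa> M by unfold_locales (rule assms(1))
  have A: "small A" using assms(3) by (simp add: small_def)
  \<comment> \<open>(1) implies (3), which implies (2), which implies (1); and (4) follows from (1)
    with (3) and implies (1).\<close>
  show ?thesis
    using extension_base_forking_eq_dividing[OF assms(2) A] forking_eq_dividing_left_extension[OF A]
      left_extension_extension_base[OF A] forking_eq_dividing_strict_invariance[OF assms(2) A]
      strict_invariance_imp_extension_base[OF A]
    by blast
qed

end
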